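(* Let $d\ge 1$, $0\le\alpha<2$, and let $K$, $\ell$, $L$, $\mathcal{L}$ and $X$ be as in the context. There exist constants $c>0$ and $\gamma\in(0,1)$ such that for all $r\in(0,\tfrac12)$, all $x_0\in\mathbb{R}^d$ and all bounded functions $u\colon\mathbb{R}^d\to\mathbb{R}$ that are harmonic in $B_r(x_0)$ with respect to $\mathcal{L}$, \[ |u(x)-u(y)|\le c\,\|u\|_\infty\,\frac{L(|x-y|)^{-\gamma}}{L(r)^{-\gamma}}\qquad\text{for all } x,y\in B_{r/4}(x_0),\ x\neq y . \]
   Context: A measurable function $\ell\colon(0,1)\to(0,\infty)$ varies regularly at zero with index $\rho\in\mathbb{R}$ if $\lim_{r\to0+}\ell(\lambda r)/\ell(r)=\lambda^\rho$ for every $\lambda>0$. Standing assumptions: $K\colon\mathbb{R}^d\times(\mathbb{R}^d\setminus\{0\})\to[0,\infty)$ is measurable and satisfies (i) $\sup_{x\in\mathbb{R}^d}\int_{\mathbb{R}^d\setminus\{0\}}(1\wedge|h|^2)K(x,h)\,dh\le K_0$; (ii) $K(x,h)=K(x,-h)$ for all $x,h$; (iii) $\kappa^{-1}\ell(|h|)|h|^{-d}\le K(x,h)\le\kappa\,\ell(|h|)|h|^{-d}$ for all $x$ and $0<|h|\le1$, for some constants $K_0>0$, $\kappa>1$ and some locally bounded function $\ell\colon(0,1)\to(0,\infty)$ varying regularly at zero with index $-\alpha\in(-2,0]$. Define $L(r)=\int_r^1\frac{\ell(s)}{s}\,ds$ for $r\in(0,1)$. The operator $\mathcal{L}\colon C^2_b(\mathbb{R}^d)\to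 C(\mathbb{R}^d)$ is $\mathcal{L}u(x)=\int_{\mathbb{R}^d\setminus\{0\}}\big(u(x+h)-u(x)-\langle\nabla u(x),h\rangle\mathbbm{1}_{B_1}(h)\big)K(x,h)\,dh$. $X=(X_t,\mathbb{P}_x)$ is a strong Markov process with right-continuous paths with left limits such that for every $x\in\mathbb{R}^d$: $\mathbb{P}_x(X_0=x)=1$, and for every $f\in C^2_b(\mathbb{R}^d)$ the process $f(X_t)-f(X_0)-\int_0^t\mathcal{L}f(X_s)\,ds$, $t\ge0$, is a $\mathbb{P}_x$-martingale. For measurable $A$, $\tau_A=\inf\{t>0: X_t\notin A\}$. A bounded function $u\colon\mathbb{R}^d\to\mathbb{R}$ is harmonic in an open set $D$ with respect to $\mathcal{L}$ if for every bounded open $B$ with $\overline B\subset D$ the process $u(X_{\tau_B\wedge t})$, $t\ge0$, is a $\mathbb{P}_x$-martingale for every $x\in\mathbb{R}^d$. $B_r(x_0)$ is the open ball of radius $r$ centered at $x_0$. *)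

theory Defs
  imports "HOL-Probability.Probability"
begin

definition regularly_varying_at_zero :: "(real \<Rightarrow> real) \<Rightarrow> real \<Rightarrow> bool" where
  "regularly_varying_at_zero l \<rho> \<longleftrightarrow>
     (\<forall>c>0. ((\<lambda>r. l (c * r) / l r) \<longlongrightarrow> c powr \<rho>) (at_right 0))"

definition Lfun :: "(real \<Rightarrow> real) \<Rightarrow> real \<Rightarrow> real" where
  "Lfun l r = (LBINT s=r..1. l s / s)"

definition C2b :: "('a::euclidean_space \<Rightarrow> real) set" where
  "C2b = {u. bounded (range u) \<and>
      (\<exists>g H. (\<forall>x. (u has_derivative (\<lambda>h. g x \<bullet> h)) (at x)) \<and>
             (\<forall>x. (g has_derivative blinfun_apply (H x)) (at x)) \<and>
             continuous_on UNIV H \<and> bounded (range g) \<and> bounded (range H))}"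

definition Lop :: "('a::euclidean_space \<Rightarrow> 'a \<Rightarrow> real) \<Rightarrow> ('a \<Rightarrow> real) \<Rightarrow> 'a \<Rightarrow> real" where
  "Lop K u x = (LINT h:(UNIV - {0})|lborel.
      (u (x + h) - u x - frechet_derivative u (at x) h * indicator (ball 0 1) h) * K x h)"

text \<open>Martingale w.r.t. filtration F under M (t >= 0), conditional expectation written out.\<close>
definition is_martingale :: "'w measure \<Rightarrow> (real \<Rightarrow> 'w measure) \<Rightarrow> (real \<Rightarrow> 'w \<Rightarrow> real) \<Rightarrow> bool" where
  "is_martingale M F Y \<longleftrightarrow>
     (\<forall>t\<ge>0. integrable M (Y t) \<and> Y t \<in> borel_measurable (F t)) \<and>
     (\<forall>s t A. 0 \<le> s \<longrightarrow> s \<le> t \<longrightarrow> A \<in> sets (F s) \<longrightarrow>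
        (\<integral>\<omega>. indicator A \<omega> * Y t \<omega> \<partial>M) = (\<integral>\<omega>. indicator A \<omega> * Y s \<omega> \<partial>M))"

text \<open>Exit time tau_A = inf {t > 0. X_t notin A} (infinity if the set is empty).\<close>
definition exit_time :: "(real \<Rightarrow> 'w \<Rightarrow> 'a) \<Rightarrow> 'a set \<Rightarrow> 'w \<Rightarrow> ereal" where
  "exit_time X A \<omega> = (INF t\<in>{t. 0 < t \<and> X t \<omega> \<notin> A}. ereal t)"

definition harmonic_in :: "('a::euclidean_space \<Rightarrow> 'w measure) \<Rightarrow> (real \<Rightarrow> 'w measure) \<Rightarrow>
    (real \<Rightarrow> 'w \<Rightarrow> 'a) \<Rightarrow> ('a \<Rightarrow> real) \<Rightarrow> 'a set \<Rightarrow> bool" where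
  "harmonic_in P F X u D \<longleftrightarrow> bounded (range u) \<and>
     (\<forall>B. open B \<and> bounded B \<and> closure B \<subseteq> D \<longrightarrow>
        (\<forall>x. is_martingale (P x) F
               (\<lambda>t \<omega>. u (X (real_of_ereal (min (ereal t) (exit_time X B \<omega>))) \<omega>))))"

text \<open>Strong Markov property (w.r.t. the filtration F), for finite stopping times,
  stated via the defining identity of conditional expectation given F_T.\<close>
definition strong_markov :: "'w measure \<Rightarrow> ('a::euclidean_space \<Rightarrow> 'w measure) \<Rightarrow>
    (real \<Rightarrow> 'w measure) \<Rightarrow> (real \<Rightarrow> 'w \<Rightarrow> 'a) \<Rightarrow> bool" where
  "strong_markov M P F X \<longleftrightarrow>
     (\<forall>T s f x. stopping_time F T \<and> (\<forall>\<omega>. 0 \<le> T \<omega>) \<and> 0 \<le> s \<and>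
        f \<in> borel_measurable borel \<and> bounded (range (f :: 'a \<Rightarrow> real)) \<longrightarrow>
        (\<forall>A \<in> sets (filtration.pre_sigma (space M) F T).
           (\<integral>\<omega>. indicator A \<omega> * f (X (T \<omega> + s) \<omega>) \<partial>P x) =
           (\<integral>\<omega>. indicator A \<omega> * (\<integral>\<omega>'. f (X s \<omega>') \<partial>P (X (T \<omega>) \<omega>)) \<partial>P x)))"

definition cadlag_paths :: "'w measure \<Rightarrow> (real \<Rightarrow> 'w \<Rightarrow> 'a::topological_space) \<Rightarrow> bool" where
  "cadlag_paths M X \<longleftrightarrow> (\<forall>\<omega>\<in>space M.
     (\<forall>t\<ge>0. continuous (at t within {t..}) (\<lambda>s. X s \<omega>)) \<and>
     (\<forall>t>0. \<exists>l. ((\<lambda>s. X s \<omega>) \<longlongrightarrow> l) (at_left t)))"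

definition sup_norm :: "('a \<Rightarrow> real) \<Rightarrow> real" where
  "sup_norm u = (SUP z. \<bar>u z\<bar>)"

end

theory Submission
  imports Defs
begin

text \<open>
  Everything rests on the law of \<open>X\<close> at \<open>S = min t \<tau>\<close>, where \<open>\<tau>\<close> is the exit time from a closed ball of
  radius comparable to \<open>r\<close> and \<open>t\<close> is a small multiple of \<open>1 / L r\<close>.
  Applying the generator to \<open>\<bar>y - x\<bar>\<^sup>2 / (R\<^sup>2 + \<bar>y - x\<bar>\<^sup>2)\<close> bounds the probability that \<open>X\<^sub>S\<close> is
  at distance \<open>R\<close> or more by a multiple of \<open>t * L R\<close>; in particular \<open>S\<close> has expectation at least
  \<open>t / 2\<close>. Applying it to smooth approximations of indicators of balls gives
  \<open>P (X\<^sub>S \<in> A) \<ge> q * E S * \<nu> A\<close> for Borel sets \<open>A\<close> outside the ball, where \<open>\<nu>\<close> has density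
  \<open>l \<bar>h\<bar> / \<bar>h\<bar>\<^sup>d\<close>; the comparison of kernels at nearby points uses that \<open>l\<close> is almost constant on
  bounded ranges of scales.

  Choose radii \<open>r\<^sub>k\<close> with \<open>L r\<^sub>k = a\<^sup>k * L r\<^sub>0\<close>. The annulus between \<open>r\<^sub>n\<close> and \<open>r\<^sub>n\<^sub>-\<^sub>1\<close> has \<open>\<nu>\<close>-measure comparable to
  \<open>L r\<^sub>n\<close>, so \<open>X\<^sub>S\<close> hits any half of it with a probability bounded below independently of \<open>a\<close>, while it
  leaves the ball of radius \<open>r\<^sub>k\<close> with probability at most \<open>a\<^sup>k\<^sup>-\<^sup>n\<close>. For large \<open>a\<close> the oscillation of a
  harmonic function therefore decays geometrically along the balls of radius \<open>r\<^sub>k\<close>.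
\<close>

section \<open>Regularly varying functions and the jump kernel\<close>

text \<open>The case \<alpha> = 0 dictates the set-up. There \<open>L (r / 2) / L r\<close> tends to
  1 as r tends to 0, so a jump out of a ball of radius r lands between r and 2r only with vanishing
  probability, and an iteration over geometrically shrinking balls has no uniform constant.
  Measuring scales by \<open>L\<close> restores it: up to constants, \<open>L r\<close> is the rate
  of jumps longer than r, and an annulus across which \<open>L\<close> changes by a fixed factor
  carries a fixed share of that rate. This is also why the time scale is \<open>1 / L r\<close>, and
  why the tail at a larger radius \<open>\<rho>\<close> comes out as the ratio
  \<open>L \<rho> / L r\<close>. Stopping at the minimum with \<open>t\<close> avoids any upper
  bound on the exit time, and harmonicity provides a martingale at bounded times anyway. The price
  is that the stopped path often still lies in the ball. This is harmless: there the function is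
  controlled by the oscillation bound of the larger balls, and the contraction only needs a fixed
  chance of landing in the favourable half of the annulus.\<close>

text \<open>Two subsets of an interval of length \<open>3T\<close>, each of measure above \<open>3T/2\<close>, intersect; a common point
  compares \<open>h (x + v)\<close> and \<open>h x\<close> with the same third value.\<close>

lemma increments_locally_bounded:
  fixes h :: "real \<Rightarrow> real" and c T :: real
  assumes meas [measurable]: "h \<in> borel_measurable borel"
    and lim: "\<And>v. ((\<lambda>x. h (x + v) - h x) \<longlongrightarrow> c * v) at_top"
    and T: "T > 0"
  shows "\<exists>B. \<exists>x0. \<forall>x\<ge>x0. \<forall>v\<in>{0..T}. \<bar>h (x + v) - h x\<bar> \<le> B"
proof (rule ccontr)
  define B where "B = \<bar>c\<bar> * (2 * T) + 1"
  assume "\<not> ?thesis"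
  then have "\<forall>n::nat. \<exists>x v. x \<ge> real n \<and> v \<in> {0..T} \<and> \<bar>h (x + v) - h x\<bar> > 2 * B"
    by (meson not_le)
  then obtain xs vs where xs: "\<And>n. xs n \<ge> real n" and vs: "\<And>n. vs n \<in> {0..T}"
    and big: "\<And>n. \<bar>h (xs n + vs n) - h (xs n)\<bar> > 2 * B"
    by metis
  \<comment> \<open>Asking for all later indices makes these sets increase with \<open>n\<close>,
    and pointwise convergence says that they exhaust \<open>{0..2*T}\<close>; continuity of the
    measure from below then does the work of Egorov's theorem.\<close>
  define I where "I y n = {v \<in> {0..2*T}. \<forall>m\<ge>n. \<bar>h (y m + v) - h (y m)\<bar> \<le> B}"
    for y :: "nat \<Rightarrow> real" and n
  have I_sets [measurable]: "I y n \<in> sets borel" for y n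
  proof -
    have "I y n = {v \<in> space borel. v \<in> {0..2*T} \<and> (\<forall>m. m \<ge> n \<longrightarrow> \<bar>h (y m + v) - h (y m)\<bar> \<le> B)}"
      by (auto simp: I_def)
    also have "\<dots> \<in> sets borel" by measurable
    finally show ?thesis .
  qed
  have I_lm: "I y n \<in> lmeasurable" for y n
    by (rule bounded_set_imp_lmeasurable)
       (auto simp: I_def intro: bounded_subset[OF bounded_closed_interval[of 0 "2*T"]])
  have large: "\<forall>\<^sub>F n in sequentially. measure lebesgue (I y n) > 3/2 * T"
    if y: "filterlim y at_top sequentially" for y
  proof -
    have inc: "incseq (I y)"
      by (auto simp: incseq_def I_def)
    have un: "(\<Union>n. I y n) = {0..2*T}"
    proof -
      have "v \<in> (\<Union>n. I y n)" if v: "v \<in> {0..2*T}" for v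
      proof -
        have "((\<lambda>m. h (y m + v) - h (y m)) \<longlonglongrightarrow> c * v)"
          using filterlim_compose[OF lim y] by simp
        then have "((\<lambda>m. \<bar>h (y m + v) - h (y m)\<bar>) \<longlonglongrightarrow> \<bar>c * v\<bar>)"
          by (rule tendsto_rabs)
        moreover have "\<bar>c * v\<bar> < B"
        proof -
          have "\<bar>c * v\<bar> \<le> \<bar>c\<bar> * (2*T)"
            using v by (auto simp: abs_mult intro!: mult_left_mono)
          then show ?thesis unfolding B_def by simp
        qed
        ultimately have "\<forall>\<^sub>F m in sequentially. \<bar>h (y m + v) - h (y m)\<bar> < B"
          by (rule order_tendstoD)
        then obtain n where "\<forall>m\<ge>n. \<bar>h (y m + v) - h (y m)\<bar> < B"
          by (auto simp: eventually_sequentially)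
        then show ?thesis using v by (auto simp: I_def intro!: exI[of _ n] less_imp_le)
      qed
      then show ?thesis by (auto simp: I_def)
    qed
    have "(\<lambda>n. measure lebesgue (I y n)) \<longlonglongrightarrow> measure lebesgue (\<Union>n. I y n)"
    proof (rule Lim_measure_incseq)
      show "emeasure lebesgue (\<Union>n. I y n) \<noteq> \<infinity>"
        unfolding un using T by simp
    qed (use inc I_lm in auto)
    then have "(\<lambda>n. measure lebesgue (I y n)) \<longlonglongrightarrow> 2 * T"
      using T by (simp add: un)
    then show ?thesis
      by (rule order_tendstoD) (use T in auto)
  qed
  have lim1: "filterlim xs at_top sequentially"
    by (rule filterlim_at_top_mono[OF filterlim_real_sequentially]) (use xs in auto)
  have lim2: "filterlim (\<lambda>n. xs n + vs n) at_top sequentially"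
    by (rule filterlim_at_top_mono[OF lim1]) (use vs in auto)
  have "\<forall>\<^sub>F n in sequentially. measure lebesgue (I xs n) > 3/2 * T \<and>
          measure lebesgue (I (\<lambda>n. xs n + vs n) n) > 3/2 * T"
    using large[OF lim1] large[OF lim2] by eventually_elim auto
  then obtain n where n: "measure lebesgue (I xs n) > 3/2 * T"
      "measure lebesgue (I (\<lambda>n. xs n + vs n) n) > 3/2 * T"
    by (auto simp: eventually_sequentially)
  define J where "J = (+) (vs n) ` I (\<lambda>n. xs n + vs n) n"
  have J: "J \<in> lmeasurable" "measure lebesgue J > 3/2 * T"
    using n(2) I_lm by (auto simp: J_def measurable_translation measure_translation)
  have "I xs n \<inter> J \<noteq> {}"
  proof
    assume disj: "I xs n \<inter> J = {}"
    have "measure lebesgue (I xs n \<union> J) = measure lebesgue (I xs n) + measure lebesgue J"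
      using disj by (subst measure_Un2[OF I_lm J(1)]) (simp add: Diff_triv Int_commute)
    moreover have "measure lebesgue (I xs n \<union> J) \<le> measure lebesgue {0..3*T}"
    proof (rule measure_mono_fmeasurable)
      have "I xs n \<subseteq> {0..2*T}" "J \<subseteq> (+) (vs n) ` {0..2*T}"
        by (auto simp: I_def J_def)
      then show "I xs n \<union> J \<subseteq> {0..3*T}"
        using vs[of n] T by fastforce
      show "I xs n \<union> J \<in> sets lebesgue"
        using I_lm J(1) by (intro sets.Un fmeasurableD)
    qed simp
    ultimately show False using n(1) J T by simp
  qed
  then obtain w where w: "w \<in> I (\<lambda>n. xs n + vs n) n" "vs n + w \<in> I xs n"
    by (auto simp: J_def)
  have "\<bar>h (xs n + vs n + w) - h (xs n + vs n)\<bar> \<le> B" "\<bar>h (xs n + (vs n + w)) - h (xs n)\<bar> \<le> B"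
    using w by (auto simp: I_def)
  then show False using big[of n] by (simp add: add.assoc)
qed

text \<open>In the variable \<open>x = - ln s\<close>, regular variation is pointwise convergence of
  the increments of \<open>ln (l (exp (- x)))\<close>; measurability upgrades it to a bound for all
  increments of length at most 2, and \<open>ln 4 \<le> 2\<close> turns that into a comparison of
  scales up to a factor 4 either way.\<close>

lemma regularly_varying_quasi_constant:
  fixes l :: "real \<Rightarrow> real"
  assumes pos: "\<forall>r\<in>{0<..<1}. 0 < l r"
    and meas: "l \<in> borel_measurable (restrict_space borel {0<..<1})"
    and rv: "regularly_varying_at_zero l \<rho>"
  shows "\<exists>C\<ge>1. \<exists>s0. 0 < s0 \<and> s0 \<le> 1/8 \<and>
     (\<forall>s c. 0 < s \<longrightarrow> s < s0 \<longrightarrow> 1/4 \<le> c \<longrightarrow> c \<le> 4 \<longrightarrow> l (c * s) \<le> C * l s)"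
proof -
  define h where "h x = (if x > 0 then ln (l (exp (- x))) else 0)" for x
  define m where "m s = (if s \<in> {0<..<1} then l s else 0)" for s
  have m [measurable]: "m \<in> borel_measurable borel"
  proof -
    have "(\<lambda>s. l s * indicator {0<..<1} s) \<in> borel_measurable borel"
      using meas by (subst (asm) borel_measurable_restrict_space_iff) (auto simp: mult.commute)
    moreover have "(\<lambda>s. l s * indicator {0<..<1} s) = m"
      by (auto simp: m_def indicator_def)
    ultimately show ?thesis by simp
  qed
  have h_eq: "h = (\<lambda>x. if x > 0 then ln (m (exp (- x))) else 0)"
    by (auto simp: h_def m_def fun_eq_iff)
  have hm: "h \<in> borel_measurable borel"
    unfolding h_eq by measurable
  have lim: "((\<lambda>x. h (x + v) - h x) \<longlongrightarrow> (- \<rho>) * v) at_top" for v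
  proof -
    have f0: "filterlim (\<lambda>x::real. exp (- x)) (at_right 0) at_top"
    proof (rule tendsto_imp_filterlim_at_right)
      show "((\<lambda>x::real. exp (- x)) \<longlongrightarrow> 0) at_top"
        by (rule filterlim_compose[OF exp_at_bot filterlim_uminus_at_bot_at_top])
    qed simp
    have "((\<lambda>r. l (exp (- v) * r) / l r) \<longlongrightarrow> exp (- v) powr \<rho>) (at_right 0)"
      using rv by (auto simp: regularly_varying_at_zero_def)
    then have "((\<lambda>r. ln (l (exp (- v) * r) / l r)) \<longlongrightarrow> ln (exp (- v) powr \<rho>)) (at_right 0)"
      by (rule tendsto_ln) (simp add: powr_def)
    then have "((\<lambda>x. ln (l (exp (- v) * exp (- x)) / l (exp (- x)))) \<longlongrightarrow> ln (exp (- v) powr \<rho>)) at_top"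
      by (rule filterlim_compose[OF _ f0])
    moreover have "ln (exp (- v) powr \<rho>) = (- \<rho>) * v"
      by (simp add: powr_def)
    moreover have "\<forall>\<^sub>F x in at_top. ln (l (exp (- v) * exp (- x)) / l (exp (- x))) = h (x + v) - h x"
      using eventually_gt_at_top[of "max 0 (- v)"]
    proof eventually_elim
      case (elim x)
      have "0 < l (exp (- x))" "0 < l (exp (- (x + v)))"
        using elim pos by auto
      moreover have "exp (- v) * exp (- x) = exp (- (x + v))"
        by (simp add: mult_exp_exp)
      ultimately show ?case
        using elim by (simp add: h_def ln_div)
    qed
    ultimately show ?thesis
      using Lim_transform_eventually by fastforce
  qed
  have "\<exists>B. \<exists>x0. \<forall>x\<ge>x0. \<forall>v\<in>{0..2}. \<bar>h (x + v) - h x\<bar> \<le> B"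
    by (rule increments_locally_bounded[OF hm lim]) simp
  then obtain B x0 where B': "\<forall>x\<ge>x0. \<forall>v\<in>{0..2}. \<bar>h (x + v) - h x\<bar> \<le> B"
    by blast
  then have B: "\<bar>h (x + v) - h x\<bar> \<le> B" if "x \<ge> x0" "v \<in> {0..2}" for x v
    using that by blast
  \<comment> \<open>The 2 keeps \<open>x + v\<close> beyond \<open>x0\<close> when \<open>v\<close>
    is negative; the 4 makes \<open>exp (- y0)\<close> at most 1/8, so that \<open>4 * s\<close>
    stays inside the unit interval.\<close>
  define y0 where "y0 = max 4 (x0 + 2)"
  have ln4: "ln 4 \<le> (2::real)"
  proof -
    have "(4::real) \<le> exp 2"
      using exp_ge_add_one_self[of 1] exp_double[of "1::real"] power_mono[of 2 "exp (1::real)" 2]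
      by simp
    then have "ln (4::real) \<le> ln (exp 2)" by (subst ln_le_cancel_iff) auto
    then show ?thesis by simp
  qed
  have B0: "B \<ge> 0"
    using B[of x0 0] by simp
  have main: "l (c * s) \<le> exp B * l s"
    if s: "0 < s" "s < exp (- y0)" and c: "1/4 \<le> c" "c \<le> 4" for s c
  proof -
    define x where "x = - ln s"
    define v where "v = - ln c"
    have x: "x > y0"
    proof -
      have "ln s < - y0"
        using s ln_less_cancel_iff[of s "exp (- y0)"] by simp
      then show ?thesis by (simp add: x_def)
    qed
    have v: "- 2 \<le> v" "v \<le> 2"
    proof -
      have "ln c \<le> ln 4" using c by simp
      moreover have "ln (1/4) \<le> ln c" using c by (subst ln_le_cancel_iff) auto
      moreover have "ln (1/4::real) = - ln 4" by (simp add: ln_div)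
      ultimately show "- 2 \<le> v" "v \<le> 2" using ln4 unfolding v_def by linarith+
    qed
    have xv: "x > x0" "x + v > x0" "x > 0" "x + v > 0"
      using x v unfolding y0_def by auto
    have "\<bar>h (x + v) - h x\<bar> \<le> B"
    proof (cases "v \<ge> 0")
      case True
      then show ?thesis using B[of x v] v xv by auto
    next
      case False
      then show ?thesis using B[of "x + v" "- v"] v xv by auto
    qed
    then have "h (x + v) \<le> B + h x" by simp
    then have le: "ln (l (exp (- (x + v)))) \<le> B + ln (l (exp (- x)))"
      using xv by (simp add: h_def)
    have es: "exp (- x) = s" "exp (- (x + v)) = c * s"
      using s c by (auto simp: x_def v_def exp_add exp_minus)
    have p: "0 < l s" "0 < l (c * s)"
      using bspec[OF pos, of "exp (- x)"] bspec[OF pos, of "exp (- (x + v))"] xv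
        exp_less_one_iff[of "- x"] exp_less_one_iff[of "- (x + v)"] exp_gt_zero[of "- x"] exp_gt_zero[of "- (x + v)"]
      unfolding es by auto
    have "exp (ln (l (c * s))) \<le> exp (B + ln (l s))"
      using le es by simp
    then show ?thesis using p by (simp add: exp_add)
  qed
  have e8: "exp (- y0) \<le> 1/8"
  proof -
    have "exp (- y0) \<le> exp (- 4)" by (simp add: y0_def)
    also have "exp (- 4 :: real) \<le> 1/8"
    proof -
      have "(1 + 1)^4 \<le> (exp 1 :: real)^4" using exp_ge_add_one_self[of "1::real"] by (intro power_mono) auto
      also have "(exp 1)^4 = exp (4::real)" using exp_of_nat_mult[of 4 "1::real"] by simp
      finally have "8 \<le> exp (4::real)" by simp
      then show ?thesis by (simp add: exp_minus field_simps)
    qed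
    finally show ?thesis .
  qed
  have "0 < exp (- y0) \<and> exp (- y0) \<le> 1/8 \<and> (\<forall>s c. 0 < s \<longrightarrow> s < exp (- y0) \<longrightarrow> 1/4 \<le> c \<longrightarrow> c \<le> 4 \<longrightarrow> l (c * s) \<le> exp B * l s)"
    using main e8 exp_gt_zero by blast
  then show ?thesis
    using B0 one_le_exp_iff by blast
qed

section \<open>Polar coordinates for radial functions\<close>

text \<open>Half-lines pull back to balls, whose volume is known, and they form an
  intersection-stable generator. Differentiating the volume in the radius yields the density, so no
  surface measure has to be constructed.\<close>

lemma distr_lborel_norm:
  defines "n \<equiv> DIM('a::euclidean_space)"
  shows "distr lborel borel (norm :: 'a \<Rightarrow> real) =
    density lborel (\<lambda>s. ennreal (n * unit_ball_vol n * s ^ (n - 1)) * indicator {0..} s)"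
    (is "?D = ?E")
proof -
  have n: "n > 0" by (simp add: n_def)
  have D: "emeasure ?D {..r} = (if r < 0 then 0 else ennreal (unit_ball_vol n * r ^ n))" for r
  proof -
    have "emeasure ?D {..r} = emeasure lborel (cball (0::'a) r)"
      by (subst emeasure_distr) (auto intro!: arg_cong[where f="emeasure lborel"])
    then show ?thesis
      by (auto simp: emeasure_cball n_def)
  qed
  have E: "emeasure ?E {..r} = (if r < 0 then 0 else ennreal (unit_ball_vol n * r ^ n))" for r
  proof -
    have "emeasure ?E {..r} = (\<integral>\<^sup>+ s. ennreal (n * unit_ball_vol n * s ^ (n - 1)) * indicator {0..r} s \<partial>lborel)"
      by (subst emeasure_density) (auto intro!: nn_integral_cong split: split_indicator)
    also have "\<dots> = (if r < 0 then 0 else ennreal (unit_ball_vol n * r ^ n))"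
    proof (cases "r < 0")
      case False
      have "(\<integral>\<^sup>+ s. ennreal (n * unit_ball_vol n * s ^ (n - 1)) * indicator {0..r} s \<partial>lborel)
          = unit_ball_vol n * r ^ n - unit_ball_vol n * 0 ^ n"
        using False n by (intro nn_integral_FTC_Icc) (auto intro!: derivative_eq_intros)
      then show ?thesis using False n by simp
    qed simp
    finally show ?thesis .
  qed
  show ?thesis
  proof (rule measure_eqI_generator_eq)
    show "Int_stable (range atMost :: real set set)"
      by (auto simp: Int_stable_def)
    show "range atMost \<subseteq> Pow (UNIV :: real set)" by simp
    show "emeasure ?D A = emeasure ?E A" if "A \<in> range atMost" for A
      using that D E by auto
    show "sets ?D = sigma_sets UNIV (range atMost)" "sets ?E = sigma_sets UNIV (range atMost)"
      by (simp_all add: borel_eq_atMost)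
    show "range (\<lambda>i::nat. {..real i}) \<subseteq> range atMost" by auto
    show "(\<Union>i::nat. {..real i}) = UNIV"
      by (auto simp: real_arch_simple)
    show "emeasure ?D {..real i} \<noteq> \<infinity>" for i by (simp add: D)
  qed
qed

lemma nn_integral_norm:
  fixes g :: "real \<Rightarrow> ennreal"
  assumes [measurable]: "g \<in> borel_measurable borel"
  shows "(\<integral>\<^sup>+ h. g (norm (h::'a::euclidean_space)) \<partial>lborel) =
    ennreal (DIM('a) * unit_ball_vol DIM('a)) *
      (\<integral>\<^sup>+ s. ennreal (s ^ (DIM('a) - 1)) * indicator {0..} s * g s \<partial>lborel)"
proof -
  have "(\<integral>\<^sup>+ h. g (norm (h::'a)) \<partial>lborel) = (\<integral>\<^sup>+ s. g s \<partial>distr lborel borel (norm :: 'a \<Rightarrow> real))"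
    by (subst nn_integral_distr) auto
  also have "\<dots> = (\<integral>\<^sup>+ s. ennreal (DIM('a) * unit_ball_vol DIM('a) * s ^ (DIM('a) - 1)) * indicator {0..} s * g s \<partial>lborel)"
    unfolding distr_lborel_norm by (subst nn_integral_density) auto
  also have "\<dots> = (\<integral>\<^sup>+ s. ennreal (DIM('a) * unit_ball_vol DIM('a)) * (ennreal (s ^ (DIM('a) - 1)) * indicator {0..} s * g s) \<partial>lborel)"
    by (intro nn_integral_cong) (auto simp: ennreal_mult' mult_ac split: split_indicator)
  also have "\<dots> = ennreal (DIM('a) * unit_ball_vol DIM('a)) *
      (\<integral>\<^sup>+ s. ennreal (s ^ (DIM('a) - 1)) * indicator {0..} s * g s \<partial>lborel)"
    by (subst nn_integral_cmult) auto
  finally show ?thesis .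
qed


section \<open>The jump kernel and the scale function \<open>L\<close>\<close>

locale regular_kernel =
  fixes K :: "'a::euclidean_space \<Rightarrow> 'a \<Rightarrow> real"
    and l :: "real \<Rightarrow> real"
    and \<alpha> K0 \<kappa> :: real
  assumes alpha: "\<alpha> < 2"
    and l_pos: "\<forall>r\<in>{0<..<1}. 0 < l r"
    and l_meas: "l \<in> borel_measurable (restrict_space borel {0<..<1})"
    and l_rv: "regularly_varying_at_zero l (- \<alpha>)"
    and K_meas: "(\<lambda>(x, h). K x h) \<in> borel_measurable (borel \<Otimes>\<^sub>M borel)"
    and K_nonneg: "\<forall>x h. h \<noteq> 0 \<longrightarrow> 0 \<le> K x h"
    and K0: "0 < K0"
      "\<forall>x. (\<integral>\<^sup>+ h. ennreal (indicator (UNIV - {0}) h * min 1 (norm h ^ 2) * K x h) \<partial>lborel)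
             \<le> ennreal K0"
    and K_sym: "\<forall>x h. h \<noteq> 0 \<longrightarrow> K x h = K x (- h)"
    and kappa: "1 < \<kappa>"
      "\<forall>x h. 0 < norm h \<and> norm h \<le> 1 \<longrightarrow>
          l (norm h) / norm h ^ DIM('a) / \<kappa> \<le> K x h \<and>
          K x h \<le> \<kappa> * l (norm h) / norm h ^ DIM('a)"
begin

text \<open>\<open>l\<close> is only given on the open unit interval; the extension by zero is Borel
  on the whole line and cuts \<open>J\<close> off at distance 1, so that integrals over jumps need
  no separate restriction.\<close>

definition lz :: "real \<Rightarrow> real" where "lz s = (if s \<in> {0<..<1} then l s else 0)"

text \<open>The translation-invariant jump density with which every \<open>K x\<close> is compared;
  it is the density of the measure \<nu> of the overview.\<close>

definition J :: "'a \<Rightarrow> real" where "J h = lz (norm h) / norm h ^ DIM('a)"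

text \<open>The surface measure of the unit sphere.\<close>

definition \<omega> :: real where "\<omega> = DIM('a) * unit_ball_vol DIM('a)"

lemma \<omega>_pos: "\<omega> > 0"
  by (simp add: \<omega>_def)

lemma lz_nonneg [simp]: "0 \<le> lz s"
  using l_pos by (auto simp: lz_def intro: less_imp_le)

lemma lz_measurable [measurable]: "lz \<in> borel_measurable borel"
proof -
  have "(\<lambda>s. l s * indicator {0<..<1} s) \<in> borel_measurable borel"
    using l_meas by (subst (asm) borel_measurable_restrict_space_iff) (auto simp: mult.commute)
  moreover have "(\<lambda>s. l s * indicator {0<..<1} s) = lz"
    by (auto simp: lz_def indicator_def)
  ultimately show ?thesis by simp
qed

lemma J_nonneg [simp]: "0 \<le> J h"
  by (simp add: J_def)

lemma J_measurable [measurable]: "J \<in> borel_measurable borel"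
  unfolding J_def by measurable

lemma K_measurable [measurable (raw)]:
  "f \<in> borel_measurable N \<Longrightarrow> g \<in> borel_measurable N \<Longrightarrow> (\<lambda>x. K (f x) (g x)) \<in> borel_measurable N"
  using measurable_compose[OF measurable_Pair K_meas, of f N g] by simp

lemma K_bounds:
  assumes "0 < norm h" "norm h < 1"
  shows "J h / \<kappa> \<le> K x h" "K x h \<le> \<kappa> * J h"
  using kappa(2)[rule_format, of h x] assms by (auto simp: J_def lz_def)

text \<open>The Jacobian of polar coordinates cancels all but one power of \<open>s\<close>,
  whatever the dimension; this is what makes \<open>L\<close> the radial measure of the jumps beyond
  a given distance.\<close>

lemma nn_integral_J:
  assumes [measurable]: "g \<in> borel_measurable borel" and g: "\<And>s. 0 \<le> s \<Longrightarrow> 0 \<le> g s"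
  shows "(\<integral>\<^sup>+ h. ennreal (g (norm h) * J h) \<partial>lborel) = ennreal \<omega> * (\<integral>\<^sup>+ s. ennreal (g s * (lz s / s)) \<partial>lborel)"
proof -
  have "(\<integral>\<^sup>+ h. ennreal (g (norm h) * J h) \<partial>lborel) = ennreal \<omega> *
      (\<integral>\<^sup>+ s. ennreal (s ^ (DIM('a) - 1)) * indicator {0..} s * ennreal (g s * (lz s / s ^ DIM('a))) \<partial>lborel)"
    unfolding J_def \<omega>_def by (subst nn_integral_norm[symmetric]) auto
  also have "(\<integral>\<^sup>+ s. ennreal (s ^ (DIM('a) - 1)) * indicator {0..} s * ennreal (g s * (lz s / s ^ DIM('a))) \<partial>lborel)
     = (\<integral>\<^sup>+ s. ennreal (g s * (lz s / s)) \<partial>lborel)"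
  proof (intro nn_integral_cong)
    fix s :: real
    show "ennreal (s ^ (DIM('a) - 1)) * indicator {0..} s * ennreal (g s * (lz s / s ^ DIM('a))) =
         ennreal (g s * (lz s / s))"
    proof (cases "0 < s \<and> s < 1")
      case True
      have "s ^ DIM('a) = s ^ (DIM('a) - 1) * s"
        by (metis DIM_positive Suc_pred' power_Suc2)
      then have "s ^ (DIM('a) - 1) * (g s * (lz s / s ^ DIM('a))) = g s * (lz s / s)"
        using True by (auto simp: field_simps)
      then show ?thesis
        using True g[of s] by (simp flip: ennreal_mult')
    qed (auto simp: lz_def)
  qed
  finally show ?thesis .
qed

text \<open>The bound \<open>K0\<close> at the single point 0, passed through the lower bound on
  \<open>K\<close>, is a second moment bound for \<open>J\<close>. The tail integrals defining
  \<open>L\<close> and the truncated second moments are dominated by it.\<close>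

lemma integrable_s_lz: "integrable lborel (\<lambda>s. s * lz s)"
proof -
  have "ennreal \<omega> * (\<integral>\<^sup>+ s. ennreal (s^2 * (lz s / s)) \<partial>lborel) = (\<integral>\<^sup>+ h. ennreal ((norm h)^2 * J h) \<partial>lborel)"
    by (subst nn_integral_J) auto
  also have "\<dots> \<le> (\<integral>\<^sup>+ h. ennreal \<kappa> * ennreal (indicator (UNIV - {0}) h * min 1 (norm h ^ 2) * K 0 h) \<partial>lborel)"
  proof (intro nn_integral_mono)
    fix h :: 'a
    show "ennreal ((norm h)^2 * J h) \<le> ennreal \<kappa> * ennreal (indicator (UNIV - {0}) h * min 1 (norm h ^ 2) * K 0 h)"
    proof (cases "0 < norm h \<and> norm h < 1")
      case True
      then have "(norm h)\<^sup>2 \<le> 1" by (simp add: power_le_one)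
      moreover have "J h \<le> \<kappa> * K 0 h"
        using K_bounds(1)[of h 0] True kappa(1) by (simp add: field_simps)
      ultimately have "(norm h)^2 * J h \<le> \<kappa> * (indicator (UNIV - {0}) h * min 1 (norm h ^ 2) * K 0 h)"
        using True by (auto simp: min_def mult_left_mono mult.left_commute)
      then show ?thesis
        using kappa(1) by (simp add: ennreal_leI flip: ennreal_mult')
    qed (auto simp: J_def lz_def)
  qed
  also have "\<dots> \<le> ennreal \<kappa> * ennreal K0"
    using K0(2) by (subst nn_integral_cmult) (auto intro!: mult_left_mono)
  also have "\<dots> < \<infinity>" by (simp add: ennreal_mult_less_top)
  finally have "(\<integral>\<^sup>+ s. ennreal (s^2 * (lz s / s)) \<partial>lborel) < \<infinity>"
    using \<omega>_pos by (auto simp: ennreal_mult_less_top)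
  moreover have "s^2 * (lz s / s) = s * lz s" for s
    by (simp add: power2_eq_square lz_def)
  ultimately have "(\<integral>\<^sup>+ s. ennreal (s * lz s) \<partial>lborel) < \<infinity>" by simp
  moreover have "0 \<le> s * lz s" for s by (simp add: lz_def l_pos less_imp_le)
  ultimately show ?thesis by (intro integrableI_nonneg) auto
qed

lemma integrable_lz_div:
  assumes "0 < a" "A \<in> sets borel" "A \<subseteq> {a..}"
  shows "integrable lborel (\<lambda>s. indicator A s * (lz s / s))"
proof (rule Bochner_Integration.integrable_bound)
  show "integrable lborel (\<lambda>s. 1 / a^2 * (s * lz s))"
    by (intro integrable_mult_right integrable_s_lz)
  show "AE s in lborel. norm (indicator A s * (lz s / s)) \<le> norm (1 / a^2 * (s * lz s))"
  proof (intro AE_I2)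
    fix s :: real
    have "lz s / s \<le> 1 / a^2 * (s * lz s)" if "s \<in> A"
    proof -
      have s: "a \<le> s" using that assms by auto
      then have "a^2 \<le> s^2" using assms by (intro power_mono) auto
      then have "a^2 * lz s \<le> s^2 * lz s" by (intro mult_right_mono) auto
      then show ?thesis using s assms by (simp add: field_simps power2_eq_square)
    qed
    then show "norm (indicator A s * (lz s / s)) \<le> norm (1 / a^2 * (s * lz s))"
      by (auto simp: lz_def l_pos less_imp_le abs_mult split: split_indicator)
  qed
qed (use assms in measurable)

abbreviation L :: "real \<Rightarrow> real" where "L \<equiv> Lfun l"

lemma L_eq:
  assumes "r < 1" "0 < r"
  shows "L r = (\<integral>s. indicator {r..} s * (lz s / s) \<partial>lborel)"
proof -
  have "L r = (\<integral>s. indicator {r<..<1} s * (l s / s) \<partial>lborel)"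
    using assms unfolding Lfun_def interval_lebesgue_integral_def set_lebesgue_integral_def
    by (simp add: one_ereal_def)
  also have "\<dots> = (\<integral>s. indicator {r..} s * (lz s / s) \<partial>lborel)"
  proof (rule integral_cong_AE)
    have eq: "(\<lambda>s. indicator {r<..<1} s * (l s / s)) = (\<lambda>s. indicator {r<..<1} s * (lz s / s))"
      using assms by (auto simp: lz_def indicator_def)
    show "(\<lambda>s. indicator {r<..<1} s * (l s / s)) \<in> borel_measurable lborel"
      unfolding eq by measurable
    show "AE s in lborel. indicator {r<..<1} s * (l s / s) = indicator {r..} s * (lz s / s)"
      using AE_lborel_singleton[of r] AE_lborel_singleton[of 1]
      by eventually_elim (use assms in \<open>auto simp: lz_def indicator_def\<close>)
  qed measurable
  finally show ?thesis .
qed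

lemma ennreal_L:
  assumes "r < 1" "0 < r"
  shows "ennreal (L r) = (\<integral>\<^sup>+ s. ennreal (indicator {r..} s * (lz s / s)) \<partial>lborel)"
  using assms unfolding L_eq[OF assms]
  by (intro nn_integral_eq_integral[symmetric] integrable_lz_div) (auto simp: indicator_def)

lemma L_diff:
  assumes "0 < r" "r \<le> r'" "r' < 1"
  shows "L r - L r' = (\<integral>s. indicator {r..<r'} s * (lz s / s) \<partial>lborel)"
proof -
  have "L r - L r' = (\<integral>s. indicator {r..} s * (lz s / s) - indicator {r'..} s * (lz s / s) \<partial>lborel)"
    using assms by (subst Bochner_Integration.integral_diff) (auto simp: L_eq simp del: times_divide_eq_right intro!: integrable_lz_div)
  also have "\<dots> = (\<integral>s. indicator {r..<r'} s * (lz s / s) \<partial>lborel)"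
    using assms by (intro Bochner_Integration.integral_cong) (auto simp: indicator_def)
  finally show ?thesis .
qed

lemma L_antimono:
  assumes "0 < r" "r \<le> r'" "r' < 1"
  shows "L r' \<le> L r"
proof -
  have "0 \<le> (\<integral>s. indicator {r..<r'} s * (lz s / s) \<partial>lborel)"
    using assms by (intro integral_nonneg_AE) (auto simp: indicator_def)
  then show ?thesis using L_diff[OF assms] by simp
qed

lemma L_pos:
  assumes "0 < r" "r < 1"
  shows "0 < L r"
proof -
  have nn: "0 \<le> indicator {r..} s * (lz s / s)" for s
    using assms by (auto simp: indicator_def)
  have "L r \<noteq> 0"
  proof
    assume "L r = 0"
    then have "AE s in lborel. indicator {r..} s * (lz s / s) = 0"
      using assms nn unfolding L_eq[OF assms(2,1)]
      by (subst (asm) integral_nonneg_eq_0_iff_AE) (auto simp del: times_divide_eq_right intro: integrable_lz_div)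
    then have "AE s in lborel. s \<notin> {r<..<1}"
    proof eventually_elim
      case (elim s)
      then show ?case using assms bspec[OF l_pos, of s] by (auto simp: lz_def indicator_def)
    qed
    then have "emeasure lborel {x. r < x \<and> x < 1} = 0"
      by (subst (asm) AE_iff_measurable[OF _ refl]) auto
    moreover have "{x. r < x \<and> x < 1} = {r<..<1}" by auto
    ultimately show False using assms by simp
  qed
  moreover have "0 \<le> L r"
    unfolding L_eq[OF assms(2,1)] using nn by (intro integral_nonneg_AE) auto
  ultimately show ?thesis by simp
qed

text \<open>\<open>L\<close> is continuous as an indefinite integral. Since \<open>L\<close> can
  stay bounded near zero, a level is only sought between two radii whose values of \<open>L\<close>
  enclose it.\<close>

lemma L_IVT:
  assumes "0 < s" "s \<le> r" "r < 1" "L r \<le> v" "v \<le> L s"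
  shows "\<exists>q. s \<le> q \<and> q \<le> r \<and> L q = v"
proof -
  define f where "f q = indicator {s..} q * (lz q / q)" for q
  have f_int: "integrable lborel f"
    unfolding f_def using assms by (intro integrable_lz_div) auto
  have int: "f integrable_on {s..r}"
    by (rule set_borel_integral_eq_integral(1))
       (use f_int integrable_mult_indicator[of "{s..r}" lborel f] in \<open>auto simp: set_integrable_def\<close>)
  have "continuous_on {s..r} (\<lambda>q. L s - L q)"
  proof -
    have "L s - L q = integral {s..q} f" if "q \<in> {s..r}" for q
    proof -
      have "L s - L q = (\<integral>x. indicator {s..<q} x * (lz x / x) \<partial>lborel)"
        using L_diff[of s q] that assms by auto
      also have "\<dots> = (\<integral>x. indicator {s..q} x * f x \<partial>lborel)"
      proof (rule integral_cong_AE)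
        show "AE x in lborel. indicator {s..<q} x * (lz x / x) = indicator {s..q} x * f x"
          using AE_lborel_singleton[of q]
          by eventually_elim (auto simp: f_def indicator_def)
      qed (auto simp: f_def)
      also have "\<dots> = integral {s..q} f"
        by (subst set_borel_integral_eq_integral(2)[symmetric])
           (use f_int integrable_mult_indicator[of "{s..q}" lborel f] in \<open>auto simp: set_integrable_def set_lebesgue_integral_def\<close>)
      finally show ?thesis .
    qed
    moreover have "continuous_on {s..r} (\<lambda>q. integral {s..q} f)"
      by (rule indefinite_integral_continuous_1[OF int])
    ultimately show ?thesis
      using continuous_on_cong[OF refl, of "{s..r}" "\<lambda>q. L s - L q" "\<lambda>q. integral {s..q} f"] by simp
  qed
  then have "continuous_on {s..r} (\<lambda>q. L s - (L s - L q))"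
    by (rule continuous_on_diff[OF continuous_on_const])
  then have "continuous_on {s..r} L" by (simp add: algebra_simps del: diff_diff_eq2)
  then show ?thesis
    using assms by (intro IVT2') auto
qed


text \<open>The place where \<alpha> < 2 enters: halving the argument multiplies \<open>l\<close> in
  the limit by \<open>2 powr \<alpha>\<close>, which is below 4, and the midpoint between the two
  serves as \<open>\<theta>\<close> for all small arguments.\<close>

lemma lz_half_le:
  obtains \<theta> s0 where "0 < \<theta>" "\<theta> < 4" "0 < s0" "\<And>s. 0 < s \<Longrightarrow> s < s0 \<Longrightarrow> lz (s / 2) \<le> \<theta> * lz s"
proof -
  define \<theta> where "\<theta> = ((1/2::real) powr (- \<alpha>) + 4) / 2"
  have "(1/2::real) powr (- \<alpha>) = 2 powr \<alpha>"
    by (simp add: powr_minus powr_divide)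
  also have "\<dots> < 2 powr 2"
    using alpha by (intro powr_less_mono) auto
  finally have lt: "(1/2::real) powr (- \<alpha>) < \<theta>" "\<theta> < 4"
    by (simp_all add: \<theta>_def)
  have "((\<lambda>r. l (1/2 * r) / l r) \<longlongrightarrow> (1/2) powr (- \<alpha>)) (at_right 0)"
    using l_rv unfolding regularly_varying_at_zero_def by (metis half_gt_zero_iff zero_less_one)
  then have "\<forall>\<^sub>F r in at_right 0. l (1/2 * r) / l r < \<theta>"
    using lt(1) by (rule order_tendstoD)
  then obtain b where b: "b > 0" "\<And>r. 0 < r \<Longrightarrow> r < b \<Longrightarrow> l (1/2 * r) / l r < \<theta>"
    unfolding eventually_at_right_field by auto
  show ?thesis
  proof (rule that[of \<theta> "min b 1"])
    show "lz (s / 2) \<le> \<theta> * lz s" if s: "0 < s" "s < min b 1" for s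
    proof -
      have "0 < l s" using s l_pos by auto
      then have "l (s / 2) \<le> \<theta> * l s"
        using b(2)[of s] s by (simp add: field_simps)
      then show ?thesis using s by (simp add: lz_def)
    qed
  qed (use lt b in \<open>auto simp: \<theta>_def add_pos_pos\<close>)
qed

text \<open>Pruitt's function of the scale \<open>R\<close>: it bounds the generator on functions
  that vary by order one over distances of order \<open>R\<close>, and hence the rate at which the
  process moves that far.\<close>

abbreviation trunc_mass :: "real \<Rightarrow> 'a \<Rightarrow> ennreal" where
  "trunc_mass R y \<equiv> \<integral>\<^sup>+ h. ennreal (indicator (UNIV - {0}) h * min 1 ((norm h / R)\<^sup>2) * K y h) \<partial>lborel"

text \<open>Karamata's theorem without series: substituting \<open>s \<mapsto> s/2\<close> gives \<open>G (R/2) \<le> q * G R\<close> with \<open>q < 1\<close> for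
  \<open>G R = (\<integral>s. s * l s)\<close> over \<open>(0,R)\<close>, so \<open>G R\<close> is controlled by the scale \<open>[R/2,R)\<close> alone.\<close>

lemma kernel_scale_bounds:
  obtains C s0 where "1 \<le> C" "0 < s0" "s0 \<le> 1/8"
    "\<And>s c. 0 < s \<Longrightarrow> s < 4 * s0 \<Longrightarrow> 1/4 \<le> c \<Longrightarrow> c \<le> 4 \<Longrightarrow> lz (c * s) \<le> C * lz s"
    "\<And>R. 0 < R \<Longrightarrow> R < s0 \<Longrightarrow> L (R / 4) \<le> C * L R"
    "\<And>y R. 0 < R \<Longrightarrow> R < s0 \<Longrightarrow>
       trunc_mass R y \<le> ennreal (C * L R)"
proof -
  obtain C1 s1 where C1: "1 \<le> C1" "0 < s1" "s1 \<le> 1/8"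
    and "\<And>s c. 0 < s \<Longrightarrow> s < s1 \<Longrightarrow> 1/4 \<le> c \<Longrightarrow> c \<le> 4 \<Longrightarrow> l (c * s) \<le> C1 * l s"
    using regularly_varying_quasi_constant[OF l_pos l_meas l_rv] by blast
  then have lC: "lz (c * s) \<le> C1 * lz s" if "0 < s" "s < s1" "1/4 \<le> c" "c \<le> 4" for s c
  proof -
    have "c * s \<le> 4 * s" using that by simp
    then have "c * s < 1" using that C1 by linarith
    moreover have "0 < c * s" using that by simp
    moreover have "s < 1" using that C1 by auto
    ultimately show ?thesis
      using that \<open>\<And>s c. 0 < s \<Longrightarrow> s < s1 \<Longrightarrow> 1/4 \<le> c \<Longrightarrow> c \<le> 4 \<Longrightarrow> l (c * s) \<le> C1 * l s\<close>
      by (simp add: lz_def)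
  qed
  obtain \<theta> s2 where \<theta>: "0 < \<theta>" "\<theta> < 4" "0 < s2" "\<And>s. 0 < s \<Longrightarrow> s < s2 \<Longrightarrow> lz (s / 2) \<le> \<theta> * lz s"
    using lz_half_le by blast
  \<comment> \<open>Radii will stay below \<open>s0\<close>, but distances measured from a displaced
    centre can be larger; the comparison of \<open>lz\<close> is therefore kept valid up to
    \<open>4 * s0\<close>.\<close>
  define s0 where "s0 = min (s1 / 4) s2"
  have s0: "0 < s0" "s0 \<le> 1/8" "4 * s0 \<le> s1" "s0 \<le> s2"
    using C1 \<theta> by (auto simp: s0_def)

  \<comment> \<open>The interval from \<open>R\<close> to \<open>2 * R\<close> alone contributes a
    multiple of \<open>lz R\<close> to \<open>L R\<close>, because \<open>lz\<close> is almost
    constant there.\<close>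
  have l_le_L: "lz R \<le> 2 * C1 * L R" if R: "0 < R" "R < s0" for R
  proof -
    have "lz R / (2 * C1) = (\<integral>s. indicator {R..<2*R} s * (lz R / (C1 * (2*R))) \<partial>lborel)"
      using R by simp
    also have "\<dots> \<le> (\<integral>s. indicator {R..<2*R} s * (lz s / s) \<partial>lborel)"
    proof (rule integral_mono)
      show "integrable lborel (\<lambda>s. indicator {R..<2*R} s * (lz s / s))"
        using R by (intro integrable_lz_div) auto
      show "integrable lborel (\<lambda>s. indicator {R..<2*R} s * (lz R / (C1 * (2*R))))"
        using R by (intro integrable_mult_left integrable_real_indicator) auto
      show "indicator {R..<2*R} s * (lz R / (C1 * (2*R))) \<le> indicator {R..<2*R} s * (lz s / s)" for s
      proof (cases "s \<in> {R..<2*R}")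
        case True
        have "lz ((R / s) * s) \<le> C1 * lz s"
          using True R s0 by (intro lC) (auto simp: field_simps)
        then have "lz R / C1 \<le> lz s"
          using True R C1 by (simp add: field_simps)
        then have "(lz R / C1) / (2 * R) \<le> lz s / s"
          using True R C1 by (intro frac_le) auto
        then show ?thesis using True by simp
      qed simp
    qed
    also have "\<dots> = L R - L (2*R)"
      using R s0 by (intro L_diff[symmetric]) auto
    also have "\<dots> \<le> L R" using L_pos[of "2*R"] R s0 by simp
    finally show ?thesis using C1 by (simp add: field_simps)
  qed

  have doubling: "L (R / 4) \<le> (1 + 6 * C1^2) * L R" if R: "0 < R" "R < s0" for R
  proof -
    have "L (R / 4) - L R = (\<integral>s. indicator {R/4..<R} s * (lz s / s) \<partial>lborel)"
      using R s0 by (intro L_diff) auto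
    also have "\<dots> \<le> (\<integral>s. indicator {R/4..<R} s * (C1 * lz R / (R / 4)) \<partial>lborel)"
    proof (rule integral_mono)
      show "integrable lborel (\<lambda>s. indicator {R/4..<R} s * (lz s / s))"
        using R by (intro integrable_lz_div[of "R/4"]) auto
      show "integrable lborel (\<lambda>s. indicator {R/4..<R} s * (C1 * lz R / (R/4)))"
        using R by (intro integrable_mult_left integrable_real_indicator) auto
      show "indicator {R/4..<R} s * (lz s / s) \<le> indicator {R/4..<R} s * (C1 * lz R / (R / 4))" for s
      proof (cases "s \<in> {R/4..<R}")
        case True
        have "lz ((s / R) * R) \<le> C1 * lz R"
          using True R s0 by (intro lC) (auto simp: field_simps)
        then have "lz s \<le> C1 * lz R"
          using R by simp
        then have "lz s / s \<le> (C1 * lz R) / (R / 4)"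
          using True R C1 by (intro frac_le) auto
        then show ?thesis using True by simp
      qed simp
    qed
    also have "\<dots> = 3 * C1 * lz R"
      using R by (simp add: field_simps)
    also have "\<dots> \<le> 3 * C1 * (2 * C1 * L R)"
      using R C1 by (intro mult_left_mono l_le_L) auto
    finally show ?thesis by (simp add: power2_eq_square algebra_simps)
  qed

  \<comment> \<open>The integrand of \<open>G\<close> carries one factor \<open>s\<close>, and the
    substitution halves both it and \<open>ds\<close>; these two halves give the 1/4 against which
    \<open>\<theta> < 4\<close> is measured.\<close>
  define q where "q = \<theta> / 4"
  have q: "0 < q" "q < 1" using \<theta> by (auto simp: q_def)
  define G where "G R = (\<integral>s. indicator {0<..<R} s * (s * lz s) \<partial>lborel)" for R
  have Gint: "integrable lborel (\<lambda>s. indicator {0<..<R} s * (s * lz s))" for R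
    using integrable_mult_indicator[OF _ integrable_s_lz, of "{0<..<R}"] by simp
  have G_le: "G R \<le> 2 * C1^2 / (1 - q) * (R^2 * L R)" if R: "0 < R" "R < s0" for R
  proof -
    have "G (R/2) = \<bar>1/2\<bar> * (\<integral>s. indicator {0<..<R/2} (0 + 1/2 * s) * ((0 + 1/2 * s) * lz (0 + 1/2 * s)) \<partial>lborel)"
      unfolding G_def by (subst lborel_integral_real_affine[where c="1/2" and t=0]) auto
    also have "\<dots> = (\<integral>s. indicator {0<..<R} s * (s / 4 * lz (s / 2)) \<partial>lborel)"
      by (subst integral_mult_right_zero[symmetric])
         (intro Bochner_Integration.integral_cong, auto simp: indicator_def)
    also have "\<dots> \<le> (\<integral>s. q * (indicator {0<..<R} s * (s * lz s)) \<partial>lborel)"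
    proof (rule integral_mono_AE')
      show "integrable lborel (\<lambda>s. q * (indicator {0<..<R} s * (s * lz s)))"
        by (intro integrable_mult_right Gint)
      show "AE s in lborel. indicator {0<..<R} s * (s / 4 * lz (s / 2)) \<le> q * (indicator {0<..<R} s * (s * lz s))"
      proof (intro AE_I2)
        fix s
        show "indicator {0<..<R} s * (s / 4 * lz (s / 2)) \<le> q * (indicator {0<..<R} s * (s * lz s))"
        proof (cases "s \<in> {0<..<R}")
          case True
          have "lz (s/2) \<le> \<theta> * lz s" using True R s0 by (intro \<theta>) auto
          then have "s / 4 * lz (s/2) \<le> s / 4 * (\<theta> * lz s)"
            using True by (intro mult_left_mono) auto
          then show ?thesis using True by (simp add: q_def mult_ac)
        qed simp
      qed
      show "AE s in lborel. 0 \<le> q * (indicator {0<..<R} s * (s * lz s))"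
        using q by (auto simp: indicator_def)
    qed
    also have "\<dots> = q * G R" by (simp add: G_def)
    finally have "G (R/2) \<le> q * G R" .
    moreover have "G R - G (R/2) \<le> 2 * C1^2 * (R^2 * L R)"
    proof -
      have "G R - G (R/2) = (\<integral>s. indicator {R/2..<R} s * (s * lz s) \<partial>lborel)"
        unfolding G_def using R
        by (subst Bochner_Integration.integral_diff[symmetric, OF Gint Gint])
           (auto intro!: Bochner_Integration.integral_cong simp: indicator_def)
      also have "\<dots> \<le> (\<integral>s. indicator {0..<R} s * (R * (C1 * lz R)) \<partial>lborel)"
      proof (rule integral_mono_AE')
        show "integrable lborel (\<lambda>s. indicator {0..<R} s * (R * (C1 * lz R)))"
          using R by (intro integrable_mult_left integrable_real_indicator) auto
        show "AE s in lborel. indicator {R/2..<R} s * (s * lz s) \<le> indicator {0..<R} s * (R * (C1 * lz R))"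
        proof (intro AE_I2)
          fix s
          show "indicator {R/2..<R} s * (s * lz s) \<le> indicator {0..<R} s * (R * (C1 * lz R))"
          proof (cases "s \<in> {R/2..<R}")
            case True
            have "lz ((s / R) * R) \<le> C1 * lz R"
              using True R s0 by (intro lC) (auto simp: field_simps)
            then have "s * lz s \<le> R * (C1 * lz R)"
              using True R by (intro mult_mono) auto
            then show ?thesis using True R by simp
          qed (use R C1 in \<open>auto simp: indicator_def\<close>)
        qed
        show "AE s in lborel. 0 \<le> indicator {0..<R} s * (R * (C1 * lz R))"
          using R C1 by (auto simp: indicator_def)
      qed
      also have "\<dots> = C1 * R^2 * lz R"
        using R by (simp add: power2_eq_square mult_ac)
      also have "\<dots> \<le> C1 * R^2 * (2 * C1 * L R)"
        using R C1 by (intro mult_left_mono l_le_L) auto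
      finally show ?thesis by (simp add: power2_eq_square mult_ac)
    qed
    ultimately have "(1 - q) * G R \<le> 2 * C1^2 * (R^2 * L R)"
      by (simp add: algebra_simps)
    then show ?thesis using q by (simp add: field_simps)
  qed

  \<comment> \<open>One summand for each range of jumps: shorter than \<open>R\<close>, between
    \<open>R\<close> and 1, and longer than 1. The last contributes only the constant
    \<open>K0\<close>, which is absorbed by \<open>L R \<ge> L (1/2)\<close>.\<close>
  define C2 where "C2 = \<kappa> * \<omega> * (2 * C1^2 / (1 - q)) + \<kappa> * \<omega> + K0 / L (1/2)"
  have kern: "trunc_mass R y \<le> ennreal (C2 * L R)"
    if R: "0 < R" "R < s0" for y R
  proof -
    have R1: "R < 1" using R s0 by simp
    have "trunc_mass R y
      \<le> (\<integral>\<^sup>+ h. ennreal (\<kappa> / R^2) * ennreal ((\<lambda>s. indicator {0<..<R} s * s^2) (norm h) * J h)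
           + ennreal \<kappa> * ennreal (indicator {R..} (norm h) * J h)
           + ennreal (indicator (UNIV - {0}) h * min 1 (norm h ^ 2) * K y h) \<partial>lborel)"
    proof (intro nn_integral_mono)
      fix h :: 'a
      define a where "a = \<kappa> / R^2 * (indicator {0<..<R} (norm h) * (norm h)^2 * J h)"
      define b where "b = \<kappa> * (indicator {R..} (norm h) * J h)"
      define c where "c = indicator (UNIV - {0}) h * min 1 (norm h ^ 2) * K y h"
      have nn: "0 \<le> a" "0 \<le> b" "0 \<le> c"
        using kappa(1) K_nonneg by (auto simp: a_def b_def c_def indicator_def)
      have "indicator (UNIV - {0}) h * min 1 ((norm h / R)\<^sup>2) * K y h \<le> a + b + c"
      proof (cases "h = 0")
        case False
        consider "norm h < R" | "R \<le> norm h" "norm h < 1" | "1 \<le> norm h" by linarith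
        then show ?thesis
        proof cases
          case 1
          have "min 1 ((norm h / R)\<^sup>2) * K y h \<le> (norm h / R)\<^sup>2 * (\<kappa> * J h)"
            using 1 R1 False K_nonneg by (intro mult_mono K_bounds) auto
          also have "\<dots> = a" using 1 False by (simp add: a_def power_divide)
          finally show ?thesis using nn False by simp
        next
          case 2
          have "min 1 ((norm h / R)\<^sup>2) * K y h \<le> 1 * (\<kappa> * J h)"
            using 2 False K_nonneg by (intro mult_mono K_bounds) auto
          also have "\<dots> = b" using 2 by (simp add: b_def)
          finally show ?thesis using nn False by simp
        next
          case 3
          have "1 \<le> norm h ^ 2" using 3 by simp
          then have "c = K y h" using False by (simp add: c_def)
          moreover have "min 1 ((norm h / R)\<^sup>2) * K y h \<le> 1 * K y h"
            using False K_nonneg by (intro mult_right_mono) auto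
          ultimately show ?thesis using nn False by simp
        qed
      qed (use nn in simp)
      then have "ennreal (indicator (UNIV - {0}) h * min 1 ((norm h / R)\<^sup>2) * K y h) \<le> ennreal (a + b + c)"
        by (rule ennreal_leI)
      also have "\<dots> = ennreal a + ennreal b + ennreal c"
        using nn by simp
      also have "ennreal a = ennreal (\<kappa> / R^2) * ennreal ((\<lambda>s. indicator {0<..<R} s * s^2) (norm h) * J h)"
        unfolding a_def using kappa(1) by (intro ennreal_mult') simp
      also have "ennreal b = ennreal \<kappa> * ennreal (indicator {R..} (norm h) * J h)"
        using kappa(1) by (simp add: b_def ennreal_mult')
      finally show "ennreal (indicator (UNIV - {0}) h * min 1 ((norm h / R)\<^sup>2) * K y h) \<le>
        ennreal (\<kappa> / R^2) * ennreal ((\<lambda>s. indicator {0<..<R} s * s^2) (norm h) * J h)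
           + ennreal \<kappa> * ennreal (indicator {R..} (norm h) * J h)
           + ennreal (indicator (UNIV - {0}) h * min 1 (norm h ^ 2) * K y h)"
        unfolding c_def .
    qed
    also have "\<dots> = ennreal (\<kappa> / R^2) * (\<integral>\<^sup>+ h. ennreal ((\<lambda>s. indicator {0<..<R} s * s^2) (norm (h::'a)) * J h) \<partial>lborel)
       + ennreal \<kappa> * (\<integral>\<^sup>+ h. ennreal (indicator {R..} (norm (h::'a)) * J h) \<partial>lborel)
       + (\<integral>\<^sup>+ h. ennreal (indicator (UNIV - {0}) h * min 1 (norm h ^ 2) * K y h) \<partial>lborel)"
      by (simp add: nn_integral_add nn_integral_cmult)
    also have "\<dots> \<le> ennreal (\<kappa> / R^2) * (ennreal \<omega> * ennreal (G R)) + ennreal \<kappa> * (ennreal \<omega> * ennreal (L R)) + ennreal K0"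
    proof (intro add_mono mult_left_mono)
      have "(\<integral>\<^sup>+ h. ennreal ((\<lambda>s. indicator {0<..<R} s * s^2) (norm (h::'a)) * J h) \<partial>lborel)
         = ennreal \<omega> * (\<integral>\<^sup>+ s. ennreal (indicator {0<..<R} s * (s * lz s)) \<partial>lborel)"
        by (subst nn_integral_J)
           (auto intro!: arg_cong2[where f="(*)"] nn_integral_cong simp: indicator_def power2_eq_square)
      also have "\<dots> = ennreal \<omega> * ennreal (G R)"
        unfolding G_def using Gint[of R]
        by (subst nn_integral_eq_integral) (auto simp: indicator_def)
      finally show "(\<integral>\<^sup>+ h. ennreal ((\<lambda>s. indicator {0<..<R} s * s^2) (norm (h::'a)) * J h) \<partial>lborel) \<le> ennreal \<omega> * ennreal (G R)"
        by simp
      have "(\<integral>\<^sup>+ h. ennreal (indicator {R..} (norm (h::'a)) * J h) \<partial>lborel) = ennreal \<omega> * ennreal (L R)"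
        by (subst nn_integral_J) (auto simp: ennreal_L[OF R1 R(1)])
      then show "(\<integral>\<^sup>+ h. ennreal (indicator {R..} (norm (h::'a)) * J h) \<partial>lborel) \<le> ennreal \<omega> * ennreal (L R)"
        by simp
      show "(\<integral>\<^sup>+ h. ennreal (indicator (UNIV - {0}) h * min 1 (norm h ^ 2) * K y h) \<partial>lborel) \<le> ennreal K0"
        using K0(2) by blast
    qed auto
    also have "\<dots> = ennreal (\<kappa> / R^2 * (\<omega> * G R) + \<kappa> * (\<omega> * L R) + K0)"
    proof -
      have "0 \<le> G R" unfolding G_def by (intro integral_nonneg_AE) (auto simp: indicator_def)
      then show ?thesis
        using kappa(1) \<omega>_pos L_pos[OF R(1) R1] K0(1) by (simp add: ennreal_mult'[symmetric] ennreal_plus[symmetric] del: ennreal_plus)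
    qed
    also have "\<dots> \<le> ennreal (C2 * L R)"
    proof (rule ennreal_leI)
      have "\<kappa> / R^2 * (\<omega> * G R) \<le> \<kappa> / R^2 * (\<omega> * (2 * C1^2 / (1 - q) * (R^2 * L R)))"
        using kappa(1) \<omega>_pos R by (intro mult_left_mono G_le) auto
      also have "\<dots> = \<kappa> * \<omega> * (2 * C1^2 / (1 - q)) * L R"
        using R by simp
      finally have 1: "\<kappa> / R^2 * (\<omega> * G R) \<le> \<kappa> * \<omega> * (2 * C1^2 / (1 - q)) * L R" .
      have "L (1/2) \<le> L R" using R s0 by (intro L_antimono) auto
      then have "K0 \<le> K0 / L (1/2) * L R"
        using K0(1) L_pos[of "1/2"] by (simp add: field_simps)
      with 1 show "\<kappa> / R^2 * (\<omega> * G R) + \<kappa> * (\<omega> * L R) + K0 \<le> C2 * L R"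
        unfolding C2_def by (simp add: algebra_simps)
    qed
    finally show ?thesis .
  qed

  define C where "C = max (1 + 6 * C1^2) (max C1 C2)"
  show ?thesis
  proof (rule that[of C s0])
    show "1 \<le> C" using C1 by (simp add: C_def)
    show "lz (c * s) \<le> C * lz s" if "0 < s" "s < 4 * s0" "1/4 \<le> c" "c \<le> 4" for s c
    proof -
      have "lz (c * s) \<le> C1 * lz s" using that s0 by (intro lC) auto
      also have "\<dots> \<le> C * lz s" by (intro mult_right_mono) (auto simp: C_def)
      finally show ?thesis .
    qed
    show "L (R / 4) \<le> C * L R" if R: "0 < R" "R < s0" for R
    proof -
      have "L (R / 4) \<le> (1 + 6 * C1^2) * L R" by (rule doubling[OF R])
      also have "\<dots> \<le> C * L R" using L_pos[of R] R s0 by (intro mult_right_mono) (auto simp: C_def)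
      finally show ?thesis .
    qed
    show "trunc_mass R y \<le> ennreal (C * L R)"
      if R: "0 < R" "R < s0" for y R
    proof -
      have "C2 * L R \<le> C * L R" using L_pos[of R] R s0 by (intro mult_right_mono) (auto simp: C_def)
      then show ?thesis using kern[OF R, of y] by (meson ennreal_leI order_trans)
    qed
  qed (use s0 in auto)
qed

end

section \<open>Test functions and the generator\<close>

lemma continuous_bounded_compact_support:
  fixes g :: "real \<Rightarrow> real"
  assumes "continuous_on {0..} g" "\<And>v. v > V \<Longrightarrow> g v = 0"
  obtains B where "0 \<le> B" "\<And>v. 0 \<le> v \<Longrightarrow> \<bar>g v\<bar> * (1 + v) \<le> B"
proof -
  have "continuous_on {0..V} (\<lambda>v. \<bar>g v\<bar> * (1 + v))"
    by (intro continuous_intros continuous_on_subset[OF assms(1)]) auto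
  then have "bounded ((\<lambda>v. \<bar>g v\<bar> * (1 + v)) ` {0..V})"
    by (intro compact_imp_bounded compact_continuous_image) auto
  then obtain B where "\<forall>x\<in>(\<lambda>v. \<bar>g v\<bar> * (1 + v)) ` {0..V}. norm x \<le> B"
    unfolding bounded_iff by blast
  then have B: "\<bar>g v\<bar> * (1 + v) \<le> B" if "v \<in> {0..V}" for v
    using that by force
  show ?thesis
  proof (rule that[of "max 0 B"])
    fix v :: real assume "0 \<le> v"
    then show "\<bar>g v\<bar> * (1 + v) \<le> max 0 B"
      using B[of v] assms(2)[of v] by (cases "v \<le> V") auto
  qed simp
qed

text \<open>The squared norm is smooth at the centre. The gradient is \<open>2 * g1\<close> times
  \<open>y - c\<close>, and the Hessian is \<open>4 * g2\<close> times the rank-one map of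
  \<open>y - c\<close> plus \<open>2 * g1\<close> times the identity; the weight
  \<open>1 + v\<close> in the hypotheses pays for the factors \<open>norm (y - c)\<close> and its
  square.\<close>

lemma C2b_radial:
  fixes c :: "'a::euclidean_space" and g g1 g2 :: "real \<Rightarrow> real"
  assumes d1: "\<And>v. 0 \<le> v \<Longrightarrow> (g has_real_derivative g1 v) (at v)"
    and d2: "\<And>v. 0 \<le> v \<Longrightarrow> (g1 has_real_derivative g2 v) (at v)"
    and cont: "continuous_on {0..} g2"
    and B: "\<And>v. 0 \<le> v \<Longrightarrow> \<bar>g v\<bar> \<le> B"
    and B1: "\<And>v. 0 \<le> v \<Longrightarrow> \<bar>g1 v\<bar> * (1 + v) \<le> B"
    and B2: "\<And>v. 0 \<le> v \<Longrightarrow> \<bar>g2 v\<bar> * (1 + v) \<le> B"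
  shows "(\<lambda>y. g ((norm (y - c))\<^sup>2)) \<in> C2b"
    and "((\<lambda>y. g ((norm (y - c))\<^sup>2)) has_derivative (\<lambda>h. ((2 * g1 ((norm (y - c))\<^sup>2)) *\<^sub>R (y - c)) \<bullet> h)) (at y)"
proof -
  define r where "r y = (norm (y - c))\<^sup>2" for y
  define G where "G y = (2 * g1 (r y)) *\<^sub>R (y - c)" for y
  define H where "H y = (4 * g2 (r y)) *\<^sub>R (blinfun_scaleR_left (y - c) o\<^sub>L blinfun_inner_left (y - c)) +
      (2 * g1 (r y)) *\<^sub>R id_blinfun" for y
  have r0 [simp]: "0 \<le> r y" for y by (simp add: r_def)
  have dr: "(r has_derivative (\<lambda>h. 2 * ((y - c) \<bullet> h))) (at y)" for y
    unfolding r_def power2_norm_eq_inner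
    by (auto intro!: derivative_eq_intros simp: inner_commute)
  have dg: "((\<lambda>y. g (r y)) has_derivative (\<lambda>h. G y \<bullet> h)) (at y)" for y
  proof -
    have "((\<lambda>y. g (r y)) has_derivative (\<lambda>h. g1 (r y) * (2 * ((y - c) \<bullet> h)))) (at y)"
      using has_derivative_compose[OF dr[of y], of g "(*) (g1 (r y))"] d1[of "r y"]
      by (simp add: has_field_derivative_def)
    then show ?thesis by (simp add: G_def mult_ac)
  qed
  have dG: "(G has_derivative blinfun_apply (H y)) (at y)" for y
  proof -
    have 1: "((\<lambda>y. g1 (r y)) has_derivative (\<lambda>h. g2 (r y) * (2 * ((y - c) \<bullet> h)))) (at y)"
      using has_derivative_compose[OF dr[of y], of g1 "(*) (g2 (r y))"] d2[of "r y"]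
      by (simp add: has_field_derivative_def)
    have "(G has_derivative (\<lambda>h. (2 * g1 (r y)) *\<^sub>R h + (2 * (g2 (r y) * (2 * ((y - c) \<bullet> h)))) *\<^sub>R (y - c))) (at y)"
      unfolding G_def by (auto intro!: derivative_eq_intros 1)
    moreover have "blinfun_apply (H y) = (\<lambda>h. (2 * g1 (r y)) *\<^sub>R h + (2 * (g2 (r y) * (2 * ((y - c) \<bullet> h)))) *\<^sub>R (y - c))"
      by (auto simp: H_def fun_eq_iff blinfun.bilinear_simps inner_commute)
    ultimately show ?thesis by simp
  qed
  have cr: "continuous_on UNIV r"
    unfolding r_def by (intro continuous_intros)
  have cg1: "continuous_on {0..} g1"
    by (intro continuous_at_imp_continuous_on ballI DERIV_isCont[OF d2]) auto
  have cH: "continuous_on UNIV H"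
    unfolding H_def
    by (intro continuous_intros bounded_linear.continuous_on[OF bounded_linear_blinfun_scaleR_left]
        bounded_linear.continuous_on[OF bounded_linear_blinfun_inner_left]
        continuous_on_compose2[OF cont cr] continuous_on_compose2[OF cg1 cr]) auto
  have sq: "norm (y - c) \<le> 1 + r y" for y
  proof -
    have "0 \<le> (norm (y - c) - 1)\<^sup>2" by simp
    then show ?thesis using r0[of y] norm_ge_zero[of "y - c"] unfolding r_def power2_diff one_power2 mult_1_right by linarith
  qed
  have bG: "norm (G y) \<le> 2 * B" for y
  proof -
    have "norm (G y) = 2 * (\<bar>g1 (r y)\<bar> * norm (y - c))" by (simp add: G_def abs_mult)
    also have "\<dots> \<le> 2 * (\<bar>g1 (r y)\<bar> * (1 + r y))"
      using sq by (intro mult_left_mono) auto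
    also have "\<dots> \<le> 2 * B" using B1[OF r0] by (intro mult_left_mono) auto
    finally show ?thesis .
  qed
  have bH: "norm (H y) \<le> 6 * B" for y
  proof -
    have b1: "\<bar>g1 (r y)\<bar> \<le> B"
      using B1[OF r0[of y]] mult_left_mono[of 1 "1 + r y" "\<bar>g1 (r y)\<bar>"] by simp
    have b2: "\<bar>g2 (r y)\<bar> * (norm (y - c))\<^sup>2 \<le> B"
      using B2[OF r0[of y]] mult_left_mono[of "r y" "1 + r y" "\<bar>g2 (r y)\<bar>"] by (simp add: r_def)
    show ?thesis
    proof (rule norm_blinfun_bound)
      show "0 \<le> 6 * B" using b1 by simp
      fix h :: 'a
      have "norm (blinfun_apply (H y) h) = norm ((4 * g2 (r y) * ((y - c) \<bullet> h)) *\<^sub>R (y - c) + (2 * g1 (r y)) *\<^sub>R h)"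
        by (simp add: H_def blinfun.bilinear_simps inner_commute)
      also have "\<dots> \<le> 4 * (\<bar>g2 (r y)\<bar> * (\<bar>(y - c) \<bullet> h\<bar> * norm (y - c))) + 2 * (\<bar>g1 (r y)\<bar> * norm h)"
        by (rule norm_triangle_le) (simp add: abs_mult)
      also have "\<dots> \<le> 4 * (\<bar>g2 (r y)\<bar> * ((norm (y - c) * norm h) * norm (y - c))) + 2 * (B * norm h)"
        using b1 by (intro add_mono mult_left_mono mult_right_mono Cauchy_Schwarz_ineq2) auto
      also have "\<dots> = 4 * ((\<bar>g2 (r y)\<bar> * (norm (y - c))\<^sup>2) * norm h) + 2 * (B * norm h)"
        by (simp add: power2_eq_square)
      also have "\<dots> \<le> 4 * (B * norm h) + 2 * (B * norm h)"
        using b2 by (intro add_mono mult_left_mono mult_right_mono) auto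
      finally show "norm (blinfun_apply (H y) h) \<le> 6 * B * norm h" by simp
    qed
  qed
  have "bounded (range (\<lambda>y. g (r y)))"
    using B unfolding bounded_iff by (intro exI[of _ B]) auto
  moreover have "bounded (range G)"
    using bG unfolding bounded_iff by (intro exI[of _ "2 * B"]) auto
  moreover have "bounded (range H)"
    using bH unfolding bounded_iff by (intro exI[of _ "6 * B"]) auto
  ultimately have "(\<lambda>y. g (r y)) \<in> C2b"
    unfolding C2b_def using dg dG cH by (auto intro!: exI[of _ G] exI[of _ H])
  then show "(\<lambda>y. g ((norm (y - c))\<^sup>2)) \<in> C2b" by (simp add: r_def)
  show "((\<lambda>y. g ((norm (y - c))\<^sup>2)) has_derivative (\<lambda>h. ((2 * g1 ((norm (y - c))\<^sup>2)) *\<^sub>R (y - c)) \<bullet> h)) (at y)"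
    using dg[of y] by (simp add: r_def G_def)
qed

text \<open>A bounded second derivative makes the gradient Lipschitz; the mean value inequality for
  \<open>p\<close>, the function along the segment minus its linear part, then gives a quadratic
  remainder.\<close>

lemma C2b_taylor:
  fixes f :: "'a::euclidean_space \<Rightarrow> real"
  assumes "f \<in> C2b"
  obtains g B where "0 \<le> B" "\<And>x. (f has_derivative (\<lambda>h. g x \<bullet> h)) (at x)"
    "\<And>x. \<bar>f x\<bar> \<le> B" "continuous_on UNIV g"
    "\<And>x h. \<bar>f (x + h) - f x - g x \<bullet> h\<bar> \<le> B * (norm h)\<^sup>2"
proof -
  obtain g H where fb: "bounded (range f)" and df: "\<And>x. (f has_derivative (\<lambda>h. g x \<bullet> h)) (at x)"
    and dg: "\<And>x. (g has_derivative blinfun_apply (H x)) (at x)"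
    and Hb: "bounded (range H)"
    using assms unfolding C2b_def by auto
  obtain B1 where B1: "\<And>x. \<bar>f x\<bar> \<le> B1" using fb unfolding bounded_iff by auto
  obtain B2 where B2: "\<And>x. norm (H x) \<le> B2" using Hb unfolding bounded_iff by auto
  have B20: "0 \<le> B2" using B2[of 0] norm_ge_zero[of "H 0"] by linarith
  have lip: "norm (g y - g x) \<le> B2 * norm (y - x)" for x y
    by (rule differentiable_bound[of UNIV g "\<lambda>x. blinfun_apply (H x)"])
       (use dg B2 in \<open>auto simp: norm_blinfun.rep_eq[symmetric] has_derivative_at_withinI\<close>)
  have taylor: "\<bar>f (x + h) - f x - g x \<bullet> h\<bar> \<le> B2 * (norm h)\<^sup>2" for x h
  proof -
    define p where "p s = f (x + s *\<^sub>R h) - s * (g x \<bullet> h)" for s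
    have dp: "(p has_derivative (\<lambda>u. u * ((g (x + s *\<^sub>R h) - g x) \<bullet> h))) (at s)" for s
    proof -
      have "((\<lambda>s. x + s *\<^sub>R h) has_derivative (\<lambda>u. u *\<^sub>R h)) (at s)"
        by (auto intro!: derivative_eq_intros)
      from has_derivative_compose[OF this df[of "x + s *\<^sub>R h"]]
      have "((\<lambda>s. f (x + s *\<^sub>R h)) has_derivative (\<lambda>u. g (x + s *\<^sub>R h) \<bullet> (u *\<^sub>R h))) (at s)" .
      then show ?thesis
        unfolding p_def by (auto intro!: derivative_eq_intros simp: algebra_simps inner_diff_left)
    qed
    have "norm (p 1 - p 0) \<le> (B2 * (norm h)\<^sup>2) * norm (1 - 0 :: real)"
    proof (rule differentiable_bound[of "{0..1}" p "\<lambda>s u. u * ((g (x + s *\<^sub>R h) - g x) \<bullet> h)"])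
      fix s :: real assume s: "s \<in> {0..1}"
      show "(p has_derivative (\<lambda>u. u * ((g (x + s *\<^sub>R h) - g x) \<bullet> h))) (at s within {0..1})"
        by (rule has_derivative_at_withinI[OF dp])
      have "\<bar>(g (x + s *\<^sub>R h) - g x) \<bullet> h\<bar> \<le> norm (g (x + s *\<^sub>R h) - g x) * norm h"
        by (rule Cauchy_Schwarz_ineq2)
      also have "\<dots> \<le> (B2 * norm (x + s *\<^sub>R h - x)) * norm h"
        by (intro mult_right_mono lip) auto
      also have "\<dots> \<le> (B2 * (1 * norm h)) * norm h"
        using s B20 by (auto intro!: mult_right_mono mult_left_mono simp: mult_left_le_one_le)
      finally have "\<bar>(g (x + s *\<^sub>R h) - g x) \<bullet> h\<bar> \<le> B2 * (norm h)\<^sup>2"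
        by (simp add: power2_eq_square)
      then show "onorm (\<lambda>u. u * ((g (x + s *\<^sub>R h) - g x) \<bullet> h)) \<le> B2 * (norm h)\<^sup>2"
        by (intro onorm_le) (auto simp: abs_mult mult.commute intro!: mult_left_mono)
    qed auto
    then show ?thesis by (simp add: p_def)
  qed
  have cg: "continuous_on UNIV g"
    by (intro continuous_at_imp_continuous_on ballI has_derivative_continuous[OF dg])
  show ?thesis
  proof (rule that[of "max B1 B2" g])
    show "\<bar>f (x + h) - f x - g x \<bullet> h\<bar> \<le> max B1 B2 * (norm h)\<^sup>2" for x h
      by (rule order_trans[OF taylor]) (intro mult_right_mono, auto)
  qed (use B1 B20 df cg in \<open>auto simp: le_max_iff_disj\<close>)
qed

lemma C2b_continuous:
  assumes "f \<in> C2b"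
  shows "continuous_on UNIV (f :: 'a::euclidean_space \<Rightarrow> real)"
proof -
  obtain g where df: "\<And>x. (f has_derivative (\<lambda>h. g x \<bullet> h)) (at x)"
    using assms unfolding C2b_def by auto
  show ?thesis
    by (intro continuous_at_imp_continuous_on ballI has_derivative_continuous[OF df])
qed

lemma C2b_measurable: "f \<in> C2b \<Longrightarrow> f \<in> borel_measurable borel"
  by (rule borel_measurable_continuous_onI[OF C2b_continuous])

lemma lborel_integral_reflect:
  fixes f :: "'a::euclidean_space \<Rightarrow> real"
  assumes [measurable]: "f \<in> borel_measurable borel"
  shows "(\<integral>x. f (- x) \<partial>lborel) = (\<integral>x. f x \<partial>lborel)"
proof -
  have "(lborel :: 'a measure) = distr lborel borel uminus"
    using lborel_affine[of "-1" "0::'a"] by (simp add: density_1 cong: distr_cong)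
  then have "(\<integral>x. f x \<partial>lborel) = (\<integral>x. f x \<partial>distr lborel borel uminus)"
    by simp
  also have "\<dots> = (\<integral>x. f (- x) \<partial>lborel)"
    by (subst integral_distr) auto
  finally show ?thesis by simp
qed

lemma lborel_integral_translate:
  fixes f :: "'a::euclidean_space \<Rightarrow> real"
  assumes [measurable]: "f \<in> borel_measurable borel"
  shows "(\<integral>x. f (c + x) \<partial>lborel) = (\<integral>x. f x \<partial>lborel)"
  using integral_distr[of "(+) c" lborel borel f] by (simp add: lborel_distr_plus)

lemma has_real_derivative_max0_power:
  "((\<lambda>v::real. max 0 v ^ Suc (Suc k)) has_real_derivative real (Suc (Suc k)) * max 0 v ^ Suc k) (at v)"
proof -
  consider "v < 0" | "v = 0" | "v > 0" by linarith
  then show ?thesis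
  proof cases
    case 1
    have "((\<lambda>v::real. 0) has_real_derivative 0) (at v)" by simp
    then have "((\<lambda>v::real. max 0 v ^ Suc (Suc k)) has_real_derivative 0) (at v)"
      by (rule has_field_derivative_transform_within_open[of _ _ _ "{..<0}"]) (use 1 in auto)
    then show ?thesis using 1 by simp
  next
    case 3
    have "((\<lambda>v::real. v ^ Suc (Suc k)) has_real_derivative real (Suc (Suc k)) * v ^ Suc k) (at v)"
      by (auto intro!: derivative_eq_intros simp del: power_Suc)
    then have "((\<lambda>v::real. max 0 v ^ Suc (Suc k)) has_real_derivative real (Suc (Suc k)) * v ^ Suc k) (at v)"
      by (rule has_field_derivative_transform_within_open[of _ _ _ "{0<..}"]) (use 3 in auto)
    then show ?thesis using 3 by simp
  next
    case 2
    have "((\<lambda>h::real. max 0 h ^ Suc (Suc k) / h) \<longlongrightarrow> 0) (at 0)"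
    proof (rule Lim_null_comparison)
      show "\<forall>\<^sub>F h in at 0. norm (max 0 h ^ Suc (Suc k) / h) \<le> \<bar>h\<bar> ^ Suc k"
      proof (intro always_eventually allI)
        fix h :: real
        show "norm (max 0 h ^ Suc (Suc k) / h) \<le> \<bar>h\<bar> ^ Suc k"
        proof (cases "h > 0")
          case False
          then have "max 0 h = 0" by simp
          then have "norm (max 0 h ^ Suc (Suc k) / h) = 0" by simp
          moreover have "0 \<le> \<bar>h\<bar> ^ Suc k" by (rule zero_le_power) simp
          ultimately show ?thesis by linarith
        qed (auto simp: max_def)
      qed
      show "((\<lambda>h::real. \<bar>h\<bar> ^ Suc k) \<longlongrightarrow> 0) (at 0)"
        by (auto intro!: tendsto_eq_intros)
    qed
    then show ?thesis using 2 by (simp add: DERIV_def)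
  qed
qed

text \<open>The cubed truncation \<open>a\<close> is twice continuously differentiable; composed
  with the squared distance it is positive exactly on the ball and at most 1, so
  \<open>1 - (1 - a) ^ (n + 2)\<close> evaluated there tends to 1 inside. Unlike mollified
  indicators, these functions vanish exactly outside the ball. The exponent starts at 2 so that both
  derivatives have one formula for every \<open>n\<close>.\<close>

lemma C2b_ball_approx:
  fixes c :: "'a::euclidean_space"
  assumes s: "0 < s"
  obtains \<phi> :: "nat \<Rightarrow> 'a \<Rightarrow> real" where
    "\<And>n. \<phi> n \<in> C2b" "\<And>n y. 0 \<le> \<phi> n y" "\<And>n y. \<phi> n y \<le> 1"
    "\<And>n y. y \<notin> ball c s \<Longrightarrow> \<phi> n y = 0" "\<And>y. y \<in> ball c s \<Longrightarrow> (\<lambda>n. \<phi> n y) \<longlonglongrightarrow> 1"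
proof -
  define b where "b v = max 0 (1 - v / s\<^sup>2)" for v
  define a where "a v = b v ^ 3" for v
  define a1 where "a1 v = - 3 / s\<^sup>2 * b v ^ 2" for v
  define a2 where "a2 v = 6 / s^4 * b v" for v
  define g where "g n v = 1 - (1 - a v) ^ (n + 2)" for n v
  define g1 where "g1 n v = real (n + 2) * (1 - a v) ^ (n + 1) * a1 v" for n v
  define g2 where "g2 n v = real (n + 2) * (1 - a v) ^ (n + 1) * a2 v
      - real (n + 2) * real (n + 1) * (1 - a v) ^ n * a1 v ^ 2" for n v
  have d0: "((\<lambda>v. 1 - v / s\<^sup>2) has_real_derivative - 1 / s\<^sup>2) (at v)" for v
    using DERIV_diff[OF DERIV_const DERIV_cdivide[OF DERIV_ident], of 1 "s\<^sup>2" v] by simp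
  have da: "(a has_real_derivative a1 v) (at v)" for v
    using DERIV_chain2[OF has_real_derivative_max0_power[of 1] d0[of v]]
    by (simp add: a_def[abs_def] a1_def b_def[abs_def] numeral_eq_Suc)
  have da1: "(a1 has_real_derivative a2 v) (at v)" for v
  proof -
    have "((\<lambda>v. b v ^ 2) has_real_derivative 2 * b v * (- 1 / s\<^sup>2)) (at v)"
      using DERIV_chain2[OF has_real_derivative_max0_power[of 0] d0[of v]]
      by (simp add: b_def[abs_def] numeral_eq_Suc)
    from DERIV_cmult[OF this, of "- 3 / s\<^sup>2"] show ?thesis
      using s by (simp add: a1_def[abs_def] a2_def field_simps power2_eq_square power4_eq_xxxx)
  qed
  have cb: "continuous_on X b" for X unfolding b_def by (intro continuous_intros) (use s in auto)
  have b01: "0 \<le> b v" "b v \<le> 1" if "0 \<le> v" for v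
    using that by (auto simp: b_def)
  have a01: "0 \<le> a v" "a v \<le> 1" if "0 \<le> v" for v
    using b01[OF that] by (auto simp: a_def power_le_one)
  have b0: "b v = 0" if "v \<ge> s\<^sup>2" for v
    using that s by (simp add: b_def)
  have pow: "((\<lambda>v. (1 - a v) ^ Suc m) has_real_derivative - (real (Suc m) * (1 - a v) ^ m * a1 v)) (at v)" for m v
    using DERIV_power_Suc[OF DERIV_diff[OF DERIV_const da[of v]], of 1 m] by (simp add: mult_ac)
  have dg: "(g n has_real_derivative g1 n v) (at v)" for n v
    using DERIV_diff[OF DERIV_const pow[of "n + 1" v], of 1] unfolding g_def[abs_def] g1_def by simp
  have dg1: "(g1 n has_real_derivative g2 n v) (at v)" for n v
    using DERIV_mult[OF DERIV_cmult[OF pow[of n v], of "real (n + 2)"] da1[of v]]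
    unfolding g1_def[abs_def] g2_def by (simp add: power2_eq_square mult_ac)
  have c1: "continuous_on X (g1 n)" "continuous_on X (g2 n)" for X n
    unfolding g1_def g2_def a_def a1_def a2_def by (intro continuous_intros cb)+
  have z: "g1 n v = 0" "g2 n v = 0" if "v > s\<^sup>2" for n v
    using b0[of v] that by (simp_all add: g1_def g2_def a1_def a2_def)
  have g01: "0 \<le> g n v" "g n v \<le> 1" if "0 \<le> v" for n v
  proof -
    have "0 \<le> (1 - a v) ^ (n + 2)" "(1 - a v) ^ (n + 2) \<le> 1"
      using a01[OF that] by (intro zero_le_power power_le_one; simp)+
    then show "0 \<le> g n v" "g n v \<le> 1" unfolding g_def by linarith+
  qed
  define \<phi> where "\<phi> n y = g n ((norm (y - c))\<^sup>2)" for n and y :: 'a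
  show ?thesis
  proof (rule that[of \<phi>])
    fix n
    obtain B1 where B1: "0 \<le> B1" "\<And>v. 0 \<le> v \<Longrightarrow> \<bar>g1 n v\<bar> * (1 + v) \<le> B1"
      using continuous_bounded_compact_support[OF c1(1) z(1)] by blast
    obtain B2 where B2: "0 \<le> B2" "\<And>v. 0 \<le> v \<Longrightarrow> \<bar>g2 n v\<bar> * (1 + v) \<le> B2"
      using continuous_bounded_compact_support[OF c1(2) z(2)] by blast
    show "\<phi> n \<in> C2b"
      unfolding \<phi>_def
    proof (rule C2b_radial(1)[where B="1 + B1 + B2"])
      show "\<bar>g n v\<bar> \<le> 1 + B1 + B2" if "0 \<le> v" for v
        using g01[OF that, of n] B1(1) B2(1) by simp
      show "\<bar>g1 n v\<bar> * (1 + v) \<le> 1 + B1 + B2" "\<bar>g2 n v\<bar> * (1 + v) \<le> 1 + B1 + B2" if "0 \<le> v" for v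
        using B1(2)[OF that] B2(2)[OF that] B1(1) B2(1) by simp_all
    qed (use dg dg1 c1 in auto)
    show "0 \<le> \<phi> n y" "\<phi> n y \<le> 1" for y
      using g01 by (simp_all add: \<phi>_def)
    show "\<phi> n y = 0" if "y \<notin> ball c s" for y
    proof -
      have "s\<^sup>2 \<le> (norm (y - c))\<^sup>2"
        using that s by (intro power_mono) (auto simp: dist_norm norm_minus_commute)
      then show ?thesis by (simp add: \<phi>_def g_def a_def b0)
    qed
  next
    fix y assume "y \<in> ball c s"
    then have "(norm (y - c))\<^sup>2 < s\<^sup>2"
      using s by (intro power_strict_mono) (auto simp: dist_norm norm_minus_commute)
    then have "0 < b ((norm (y - c))\<^sup>2)"
      using s by (simp add: b_def)
    then have "0 < a ((norm (y - c))\<^sup>2)" by (simp add: a_def)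
    moreover have "a ((norm (y - c))\<^sup>2) \<le> 1" by (intro a01) simp
    ultimately have "(\<lambda>n. (1 - a ((norm (y - c))\<^sup>2)) ^ n) \<longlonglongrightarrow> 0"
      by (intro LIMSEQ_realpow_zero) auto
    then have "(\<lambda>n. (1 - a ((norm (y - c))\<^sup>2)) ^ (n + 2)) \<longlonglongrightarrow> 0"
      by (rule LIMSEQ_ignore_initial_segment)
    from tendsto_diff[OF tendsto_const[of 1] this] show "(\<lambda>n. \<phi> n y) \<longlonglongrightarrow> 1"
      by (simp add: \<phi>_def g_def)
  qed
qed


section \<open>Estimates of the generator\<close>

context regular_kernel
begin

abbreviation small_jumps :: "'a \<Rightarrow> 'a \<Rightarrow> real" where
  "small_jumps x h \<equiv> indicator (UNIV - {0}) h * min 1 ((norm h)\<^sup>2) * K x h"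

lemma integrable_small_jumps:
  "integrable lborel (\<lambda>h. small_jumps x h)"
  "(\<integral>h. small_jumps x h \<partial>lborel) \<le> K0"
proof -
  have nn: "0 \<le> small_jumps x h" for h
    using K_nonneg by (auto simp: indicator_def)
  have le: "(\<integral>\<^sup>+ h. ennreal (indicator (UNIV - {0}) h * min 1 (norm h ^ 2) * K x h) \<partial>lborel) \<le> ennreal K0"
    using K0(2) by blast
  then show int: "integrable lborel (\<lambda>h. small_jumps x h)"
    using nn by (intro integrableI_nonneg) (auto simp: le_less_trans[OF le])
  show "(\<integral>h. small_jumps x h \<partial>lborel) \<le> K0"
    using le K0(1) nn by (subst (asm) nn_integral_eq_integral[OF int]) auto
qed

lemma K_measurable_section [measurable]: "K x \<in> borel_measurable borel"
  by (rule K_measurable[where f="\<lambda>_. x" and g="\<lambda>h. h"]) (rule measurable_const, simp, rule measurable_ident_sets, simp)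

abbreviation jump_part :: "('a \<Rightarrow> real) \<Rightarrow> ('a \<Rightarrow> 'a) \<Rightarrow> 'a \<Rightarrow> 'a \<Rightarrow> real" where
  "jump_part f g x h \<equiv>
     indicator (UNIV - {0}) h * ((f (x + h) - f x - (g x \<bullet> h) * indicator (ball 0 1) h) * K x h)"

lemma Lop_integrand:
  fixes f :: "'a \<Rightarrow> real"
  assumes "f \<in> C2b" and df: "\<And>x. (f has_derivative (\<lambda>h. g x \<bullet> h)) (at x)"
  shows Lop_eq: "Lop K f x = (\<integral>h. jump_part f g x h \<partial>lborel)"
    and Lop_integrable: "integrable lborel (\<lambda>h. jump_part f g x h)"
    and Lop_measurable: "Lop K f \<in> borel_measurable borel"
    and Lop_bounded: "bounded (range (Lop K f))"
proof -
  obtain g' B where B: "0 \<le> B" "\<And>x. (f has_derivative (\<lambda>h. g' x \<bullet> h)) (at x)"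
    "\<And>x. \<bar>f x\<bar> \<le> B" "continuous_on UNIV g'"
    "\<And>x h. \<bar>f (x + h) - f x - g' x \<bullet> h\<bar> \<le> B * (norm h)\<^sup>2"
    by (rule C2b_taylor[OF assms(1)]) (rule that; assumption)
  have "g' x = g x" for x
  proof -
    have "(\<lambda>h. g' x \<bullet> h) = (\<lambda>h. g x \<bullet> h)"
      by (rule has_derivative_unique[OF B(2)[of x] df[of x]])
    from fun_cong[OF this, of "g' x - g x"]
    have "(g' x - g x) \<bullet> (g' x - g x) = 0"
      by (simp only: inner_diff_left right_minus_eq)
    then show ?thesis by (simp only: inner_eq_zero_iff right_minus_eq)
  qed
  then have g': "g' = g" by (rule ext)
  have cf: "continuous_on UNIV f"
    by (intro continuous_at_imp_continuous_on ballI has_derivative_continuous[OF df])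
  have [measurable]: "f \<in> borel_measurable borel" "g \<in> borel_measurable borel"
    by (rule borel_measurable_continuous_onI[OF cf], rule borel_measurable_continuous_onI[OF B(4)[unfolded g']])
  have [measurable]: "ball 0 1 \<in> sets (borel :: 'a measure)" by simp
  have Lop_eq: "Lop K f x = (\<integral>h. jump_part f g x h \<partial>lborel)" for x
    unfolding Lop_def set_lebesgue_integral_def frechet_derivative_at[OF df, symmetric] by (simp only: real_scaleR_def)
  have le: "\<bar>jump_part f g x h\<bar>
     \<le> 2 * B * (small_jumps x h)" for x h
  proof (cases "h = 0")
    case False
    have "\<bar>f (x + h) - f x - (g x \<bullet> h) * indicator (ball 0 1) h\<bar> \<le> 2 * B * min 1 ((norm h)\<^sup>2)"
    proof (cases "norm h < 1")
      case True
      then have "(norm h)\<^sup>2 \<le> 1" by (simp add: power_le_one)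
      moreover have "B * (norm h)\<^sup>2 \<ge> 0" using B(1) by simp
      ultimately show ?thesis using True B(5)[of x h] by (auto simp: g' min_def)
    next
      case False
      then have "1 \<le> (norm h)\<^sup>2" by simp
      then show ?thesis using False B(3)[of x] B(3)[of "x + h"] by (auto simp: min_def)
    qed
    then have "\<bar>f (x + h) - f x - (g x \<bullet> h) * indicator (ball 0 1) h\<bar> * K x h \<le> 2 * B * min 1 ((norm h)\<^sup>2) * K x h"
      using K_nonneg False by (intro mult_right_mono) auto
    then show ?thesis using False K_nonneg by (simp add: abs_mult)
  qed simp
  have int: "integrable lborel (\<lambda>h. jump_part f g x h)" for x
  proof (rule Bochner_Integration.integrable_bound)
    show "integrable lborel (\<lambda>h. 2 * B * (small_jumps x h))"
      by (intro integrable_mult_right integrable_small_jumps)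
    show "AE h in lborel. norm (jump_part f g x h)
       \<le> norm (2 * B * (small_jumps x h))"
      by (intro AE_I2, unfold real_norm_def) (rule order_trans[OF le abs_ge_self])
  qed measurable
  show "Lop K f x = (\<integral>h. jump_part f g x h \<partial>lborel)"
    "integrable lborel (\<lambda>h. jump_part f g x h)"
    by (rule Lop_eq int)+
  show "Lop K f \<in> borel_measurable borel"
    unfolding Lop_eq[abs_def] by (intro lborel.borel_measurable_lebesgue_integral) measurable
  have "\<bar>Lop K f x\<bar> \<le> 2 * B * K0" for x
  proof -
    have "\<bar>Lop K f x\<bar> \<le> (\<integral>h. \<bar>jump_part f g x h\<bar> \<partial>lborel)"
      unfolding Lop_eq by (rule integral_abs_bound)
    also have "\<dots> \<le> (\<integral>h. 2 * B * (small_jumps x h) \<partial>lborel)"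
      by (intro integral_mono le integrable_mult_right integrable_small_jumps integrable_abs int)
    also have "\<dots> = 2 * B * (\<integral>h. small_jumps x h \<partial>lborel)"
      by simp
    also have "\<dots> \<le> 2 * B * K0"
      using B(1) by (intro mult_left_mono integrable_small_jumps(2)) auto
    finally show ?thesis .
  qed
  then show "bounded (range (Lop K f))"
    unfolding bounded_iff by auto
qed

lemma Lop_C2b:
  assumes "f \<in> C2b"
  shows Lop_C2b_measurable: "Lop K f \<in> borel_measurable borel"
    and Lop_C2b_bounded: "\<exists>D. \<forall>y. \<bar>Lop K f y\<bar> \<le> D"
proof -
  obtain g where df: "\<And>x. (f has_derivative (\<lambda>h. g x \<bullet> h)) (at x)"
    using assms unfolding C2b_def by auto
  show "Lop K f \<in> borel_measurable borel" by (rule Lop_measurable[OF assms df])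
  show "\<exists>D. \<forall>y. \<bar>Lop K f y\<bar> \<le> D"
    using Lop_bounded[OF assms df] unfolding bounded_iff by auto
qed

text \<open>Where \<open>f\<close> vanishes in a neighbourhood, its value, gradient and compensator
  drop out, and the generator is the intensity of jumps weighted by \<open>f\<close>;
  \<open>j\<close> is a minorant of that intensity where \<open>f\<close> is not zero.\<close>

lemma Lop_ge:
  fixes f j :: "'a \<Rightarrow> real"
  assumes "f \<in> C2b" and f0: "\<And>w. 0 \<le> f w"
    and U: "open U" "y \<in> U" "\<And>w. w \<in> U \<Longrightarrow> f w = 0"
    and j [measurable]: "j \<in> borel_measurable borel" and j0: "\<And>w. 0 \<le> j w"
    and jK: "\<And>w. f w \<noteq> 0 \<Longrightarrow> j w \<le> K y (w - y)"
  shows "(\<integral>w. f w * j w \<partial>lborel) \<le> Lop K f y"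
proof -
  obtain g where df: "\<And>x. (f has_derivative (\<lambda>h. g x \<bullet> h)) (at x)"
    using assms(1) unfolding C2b_def by auto
  have [measurable]: "f \<in> borel_measurable borel" by (rule C2b_measurable[OF assms(1)])
  have "((\<lambda>_. 0) has_derivative (\<lambda>_. 0)) (at y)" by simp
  then have "(f has_derivative (\<lambda>_. 0)) (at y)"
    by (rule has_derivative_transform_within_open[OF _ U(1,2)]) (use U(3) in simp)
  then have "(\<lambda>h. g y \<bullet> h) = (\<lambda>_. 0)"
    by (rule has_derivative_unique[OF df[of y]])
  then have g0: "g y \<bullet> h = 0" for h by (rule fun_cong)
  have fy: "f y = 0" using U by simp
  define k where "k w = indicator (UNIV - {0}) (w - y) * (f w * K y (w - y))" for w
  have k_measurable [measurable]: "k \<in> borel_measurable borel"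
    unfolding k_def by measurable
  have int: "integrable lborel (\<lambda>h. k (y + h))"
    using Lop_integrable[OF assms(1) df, of y] by (simp add: k_def g0 fy)
  have Leq: "Lop K f y = (\<integral>h. k (y + h) \<partial>lborel)"
    using Lop_eq[OF assms(1) df, of y] by (simp add: k_def g0 fy)
  have int_k: "integrable lborel k"
    using int integrable_distr_eq[of "(+) y" lborel borel k] by (simp add: lborel_distr_plus)
  have "(\<integral>w. f w * j w \<partial>lborel) \<le> (\<integral>w. k w \<partial>lborel)"
  proof (rule integral_mono_AE'[OF int_k])
    show "AE w in lborel. f w * j w \<le> k w"
    proof (intro AE_I2)
      fix w
      show "f w * j w \<le> k w"
      proof (cases "f w = 0")
        case False
        then have "w \<noteq> y" using fy by auto
        then show ?thesis using False f0[of w] jK[OF False] by (auto simp: k_def intro: mult_left_mono)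
      qed (simp add: k_def)
    qed
    show "AE w in lborel. 0 \<le> k w"
    proof (intro AE_I2)
      fix w show "0 \<le> k w"
        using f0[of w] K_nonneg by (cases "w = y") (auto simp: k_def)
    qed
  qed
  also have "\<dots> = Lop K f y"
    unfolding Leq by (rule lborel_integral_translate[symmetric]) measurable
  finally show ?thesis .
qed

text \<open>The generator compensates jumps up to length 1, but the Taylor bound is useful only up
  to \<open>R\<close>. Symmetry of \<open>K\<close> allows the compensator to be cut at
  \<open>R\<close> instead; beyond it, \<open>\<bar>f (y + h) - f y\<bar> \<le> 1\<close> suffices,
  whence \<open>1 \<le> B\<close>.\<close>

lemma Lop_le_truncated:
  fixes f :: "'a \<Rightarrow> real"
  assumes f: "f \<in> C2b" and df: "\<And>x. (f has_derivative (\<lambda>h. g x \<bullet> h)) (at x)"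
    and R: "0 < R" "R < 1" and B: "1 \<le> B"
    and f01: "\<And>x. 0 \<le> f x" "\<And>x. f x \<le> 1"
    and small: "\<And>h. norm h \<le> R \<Longrightarrow> \<bar>f (y + h) - f y - g y \<bullet> h\<bar> \<le> B * (norm h / R)\<^sup>2"
    and c: "0 \<le> c" "trunc_mass R y \<le> ennreal c"
  shows "\<bar>Lop K f y\<bar> \<le> B * c"
proof -
  have [measurable]: "f \<in> borel_measurable borel" by (rule C2b_measurable[OF f])
  define m where "m h = indicator (UNIV - {0}) h * min 1 ((norm h / R)\<^sup>2) * K y h" for h
  have m_nn: "0 \<le> m h" for h using K_nonneg by (auto simp: m_def indicator_def)
  have [measurable]: "m \<in> borel_measurable borel" unfolding m_def by measurable
  have m_int: "integrable lborel m"
    using m_nn le_less_trans[OF c(2), of \<infinity>] unfolding m_def[symmetric]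
    by (intro integrableI_nonneg) auto
  have m_le: "(\<integral>h. m h \<partial>lborel) \<le> c"
    using c m_nn unfolding m_def[symmetric] by (subst (asm) nn_integral_eq_integral[OF m_int]) auto
  define p where "p h = indicator (UNIV - {0}) h * ((f (y + h) - f y - (g y \<bullet> h) * indicator {h. norm h \<le> R} h) * K y h)" for h
  define q where "q h = indicator {h. R < norm h \<and> norm h < 1} h * ((g y \<bullet> h) * K y h)" for h
  have [measurable]: "p \<in> borel_measurable borel" "q \<in> borel_measurable borel"
    unfolding p_def q_def by measurable
  have split: "indicator (UNIV - {0}) h * ((f (y + h) - f y - (g y \<bullet> h) * indicator (ball 0 1) h) * K y h) = p h - q h" for h
    using R by (auto simp: p_def q_def indicator_def algebra_simps)
  have p_le: "\<bar>p h\<bar> \<le> B * m h" for h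
  proof (cases "h = 0")
    case False
    have "\<bar>f (y + h) - f y - (g y \<bullet> h) * indicator {h. norm h \<le> R} h\<bar> \<le> B * min 1 ((norm h / R)\<^sup>2)"
    proof (cases "norm h \<le> R")
      case True
      then have "(norm h / R)\<^sup>2 \<le> 1" using R by (intro power_le_one) auto
      then show ?thesis using small[OF True] True by (simp add: min_def)
    next
      case False
      then have "1 \<le> (norm h / R)\<^sup>2" using R by simp
      then show ?thesis
        using False B f01(1)[of y] f01(2)[of y] f01(1)[of "y + h"] f01(2)[of "y + h"] by (auto simp: min_def abs_le_iff)
    qed
    then have "\<bar>f (y + h) - f y - (g y \<bullet> h) * indicator {h. norm h \<le> R} h\<bar> * K y h \<le> B * min 1 ((norm h / R)\<^sup>2) * K y h"
      using K_nonneg False by (intro mult_right_mono) auto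
    then show ?thesis using False K_nonneg by (simp add: abs_mult p_def m_def)
  qed (simp add: p_def m_def)
  have p_int: "integrable lborel p"
  proof (rule Bochner_Integration.integrable_bound)
    show "integrable lborel (\<lambda>h. B * m h)" by (intro integrable_mult_right m_int)
    show "AE h in lborel. norm (p h) \<le> norm (B * m h)"
      by (intro AE_I2, unfold real_norm_def) (rule order_trans[OF p_le abs_ge_self])
  qed measurable
  have q_int: "integrable lborel q"
  proof -
    have "integrable lborel (\<lambda>h. p h - (p h - q h))"
      using Lop_integrable[OF f df, of y] unfolding split by (rule Bochner_Integration.integrable_diff[OF p_int])
    then show ?thesis by simp
  qed
  \<comment> \<open>the compensator over \<open>R < \<bar>h\<bar> < 1\<close> is an odd function of \<open>h\<close>\<close>
  have "(\<integral>h. q h \<partial>lborel) = (\<integral>h. q (- h) \<partial>lborel)"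
    by (rule lborel_integral_reflect[symmetric]) measurable
  also have "\<dots> = (\<integral>h. - q h \<partial>lborel)"
  proof (intro Bochner_Integration.integral_cong refl)
    fix h
    show "q (- h) = - q h"
      using K_sym[rule_format, of h y, symmetric] R by (cases "h = 0") (auto simp: q_def indicator_def)
  qed
  finally have q0: "(\<integral>h. q h \<partial>lborel) = 0" by simp
  have "Lop K f y = (\<integral>h. p h \<partial>lborel)"
    unfolding Lop_eq[OF f df] split using p_int q_int q0 by simp
  then have "\<bar>Lop K f y\<bar> \<le> (\<integral>h. \<bar>p h\<bar> \<partial>lborel)"
    using integral_norm_bound[of lborel p] by simp
  also have "\<dots> \<le> (\<integral>h. B * m h \<partial>lborel)"
    by (intro integral_mono p_le integrable_abs p_int integrable_mult_right m_int)
  also have "\<dots> \<le> B * c"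
    using B m_le by simp
  finally show ?thesis .
qed

text \<open>The function is 0 at \<open>x\<close>, at least 1/2 from distance \<open>R\<close> on,
  and rational in the squared distance, so its Taylor remainder can be computed exactly and bounded
  uniformly in \<open>y\<close>.\<close>

lemma Lop_test_function:
  fixes x :: 'a
  assumes R: "0 < R" "R < 1"
    and c: "0 \<le> c" "\<And>y. trunc_mass R y \<le> ennreal c"
  defines "f \<equiv> \<lambda>y. (norm (y - x))\<^sup>2 / (R\<^sup>2 + (norm (y - x))\<^sup>2)"
  shows "f \<in> C2b" "\<bar>Lop K f y\<bar> \<le> 6 * c"
proof -
  define g where "g v = v / (R\<^sup>2 + v)" for v
  define g1 where "g1 v = R\<^sup>2 / (R\<^sup>2 + v)\<^sup>2" for v
  define g2 where "g2 v = - 2 * R\<^sup>2 / (R\<^sup>2 + v) ^ 3" for v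
  have pos: "0 < R\<^sup>2 + v" if "0 \<le> v" for v
    using that R by (intro add_pos_nonneg) auto
  have d1: "(g has_real_derivative g1 v) (at v)" if "0 \<le> v" for v
    unfolding g_def g1_def using pos[OF that]
    by (auto intro!: derivative_eq_intros simp: power2_eq_square)
  have d2: "(g1 has_real_derivative g2 v) (at v)" if "0 \<le> v" for v
  proof -
    have D: "R\<^sup>2 + v \<noteq> 0" using pos[OF that] by simp
    have "((\<lambda>v. R\<^sup>2 * inverse ((R\<^sup>2 + v) ^ 2)) has_real_derivative
        R\<^sup>2 * - (inverse ((R\<^sup>2 + v) ^ 2) * (2 * (R\<^sup>2 + v)) * inverse ((R\<^sup>2 + v) ^ 2))) (at v)"
      using D by (auto intro!: derivative_eq_intros)
    moreover have "R\<^sup>2 * - (inverse (D ^ 2) * (2 * D) * inverse (D ^ 2)) = - 2 * R\<^sup>2 / D ^ 3" if "D \<noteq> 0" for D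
      using that by (simp add: field_simps power2_eq_square power3_eq_cube)
    moreover have "g1 = (\<lambda>v. R\<^sup>2 * inverse ((R\<^sup>2 + v) ^ 2))"
      by (simp add: g1_def fun_eq_iff divide_inverse)
    ultimately show ?thesis
      unfolding g2_def using D by metis
  qed
  have cont: "continuous_on {0..} g2"
    unfolding g2_def using pos by (intro continuous_intros) (auto simp: less_le)
  have b0: "\<bar>g v\<bar> \<le> 1" if "0 \<le> v" for v
    using that pos[OF that] by (auto simp: g_def)
  \<comment> \<open>Chosen so that \<open>1 + v\<close> is at most \<open>A\<close> times the
    denominator \<open>R\<^sup>2 + v\<close>, which absorbs the weight that
    \<open>C2b_radial\<close> asks for.\<close>
  define A where "A = 1 + 1 / R\<^sup>2"
  have A1: "1 \<le> A" by (simp add: A_def)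
  have vA: "1 + v \<le> A * (R\<^sup>2 + v)" if "0 \<le> v" for v
    using that R by (simp add: A_def field_simps)
  have cancel: "a / D\<^sup>2 * (A * D) = A * (a / D)" "a / D ^ 3 * (A * D) = A * (a / D) * (1 / D)"
    if "D \<noteq> 0" for a D :: real
    using that by (simp_all add: power2_eq_square power3_eq_cube)
  have b1: "\<bar>g1 v\<bar> * (1 + v) \<le> A" if "0 \<le> v" for v
  proof -
    have p: "0 < R\<^sup>2 + v" by (rule pos[OF that])
    have "\<bar>g1 v\<bar> * (1 + v) \<le> (R\<^sup>2 / (R\<^sup>2 + v)\<^sup>2) * (A * (R\<^sup>2 + v))"
      using vA[OF that] by (simp add: g1_def mult_left_mono divide_right_mono)
    also have "\<dots> = A * (R\<^sup>2 / (R\<^sup>2 + v))"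
      using p by (intro cancel) simp
    also have "\<dots> \<le> A * 1"
      using p that A1 by (intro mult_left_mono) auto
    finally show ?thesis by simp
  qed
  have b2: "\<bar>g2 v\<bar> * (1 + v) \<le> 2 * A / R\<^sup>2" if "0 \<le> v" for v
  proof -
    have p: "0 < R\<^sup>2 + v" by (rule pos[OF that])
    have "\<bar>g2 v\<bar> * (1 + v) \<le> (2 * R\<^sup>2 / (R\<^sup>2 + v) ^ 3) * (A * (R\<^sup>2 + v))"
      using vA[OF that] p by (simp add: g2_def mult_left_mono divide_right_mono)
    also have "\<dots> = A * (2 * R\<^sup>2 / (R\<^sup>2 + v)) * (1 / (R\<^sup>2 + v))"
      using p by (intro cancel) simp
    also have "\<dots> = 2 * A * (R\<^sup>2 / (R\<^sup>2 + v)) * (1 / (R\<^sup>2 + v))"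
      by simp
    also have "\<dots> \<le> 2 * A * 1 * (1 / R\<^sup>2)"
      using p that A1 R by (intro mult_mono frac_le) auto
    finally show ?thesis by simp
  qed
  note rad = C2b_radial[OF d1 d2 cont, of "max 1 (max A (2 * A / R\<^sup>2))" x]
  have rad': "(\<lambda>y. g ((norm (y - x))\<^sup>2)) \<in> C2b"
    "((\<lambda>y. g ((norm (y - x))\<^sup>2)) has_derivative (\<lambda>h. ((2 * g1 ((norm (y - x))\<^sup>2)) *\<^sub>R (y - x)) \<bullet> h)) (at y)" for y
    by (rule rad; use b0 b1 b2 in \<open>simp add: le_max_iff_disj\<close>)+
  have f_eq: "f = (\<lambda>y. g ((norm (y - x))\<^sup>2))" by (simp add: f_def g_def)
  show "f \<in> C2b" using rad' by (simp add: f_eq)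
  define G where "G y = (2 * g1 ((norm (y - x))\<^sup>2)) *\<^sub>R (y - x)" for y
  have dG: "(f has_derivative (\<lambda>h. G y \<bullet> h)) (at y)" for y
    using rad'(2) by (simp add: f_eq G_def)
  show "\<bar>Lop K f y\<bar> \<le> 6 * c"
  proof (rule Lop_le_truncated[OF \<open>f \<in> C2b\<close> dG R _ _ _ _ c(1) c(2)])
    show "0 \<le> f y" "f y \<le> 1" for y
      using b0[of "(norm (y - x))\<^sup>2"] by (auto simp: f_eq g_def)
    fix h :: 'a assume h: "norm h \<le> R"
    define w where "w = y - x"
    define N where "N = (norm w)\<^sup>2"
    define H where "H = (norm h)\<^sup>2"
    define p where "p = w \<bullet> h"
    define D where "D = R\<^sup>2 + N"
    define E where "E = R\<^sup>2 + (norm (w + h))\<^sup>2"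
    have N0: "0 \<le> N" "0 \<le> H" by (auto simp: N_def H_def)
    have HR: "H \<le> R\<^sup>2" unfolding H_def using h by (intro power_mono) auto
    have nE: "(norm (w + h))\<^sup>2 = N + 2 * p + H"
      unfolding N_def H_def p_def power2_norm_eq_inner by (simp add: inner_add inner_commute)
    then have E: "E = D + 2 * p + H" by (simp add: E_def D_def)
    have DR: "R\<^sup>2 \<le> D" "R\<^sup>2 \<le> E" "0 < R\<^sup>2" using R N0 by (auto simp: D_def E_def)
    then have DE: "0 < D" "0 < E" by linarith+
    have p1: "\<bar>p\<bar> \<le> norm w * norm h" by (simp add: p_def Cauchy_Schwarz_ineq2)
    have p2: "p\<^sup>2 \<le> N * H"
      using power_mono[OF p1, of 2] by (simp add: N_def H_def power_mult_distrib)
    have "0 \<le> (norm w - norm h)\<^sup>2" by simp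
    then have p3: "2 * \<bar>p\<bar> \<le> N + H"
      using p1 unfolding power2_diff N_def H_def by linarith
    have "f (y + h) - f y - G y \<bullet> h = (N + 2 * p + H) / E - N / D - 2 * R\<^sup>2 * p / D\<^sup>2"
    proof -
      have "y + h - x = w + h" by (simp add: w_def)
      then have "f (y + h) = (N + 2 * p + H) / E"
        unfolding f_eq g_def E_def by (simp only: nE)
      moreover have "f y = N / D" by (simp add: f_eq g_def w_def[symmetric] N_def D_def)
      moreover have "G y \<bullet> h = 2 * R\<^sup>2 * p / D\<^sup>2"
        by (simp add: G_def g1_def w_def[symmetric] p_def N_def D_def)
      ultimately show ?thesis by simp
    qed
    \<comment> \<open>Both fractions are 1 minus \<open>R\<^sup>2\<close> over their denominator;
      after cancellation only terms of at least second order in \<open>h\<close> remain in the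
      numerator.\<close>
    also have "\<dots> = R\<^sup>2 * (H * D - 4 * p\<^sup>2 - 2 * p * H) / (E * D\<^sup>2)"
    proof -
      have "(N + 2 * p + H) / E = 1 - R\<^sup>2 / E" "N / D = 1 - R\<^sup>2 / D"
        using DE E by (simp_all add: D_def field_simps)
      then have "(N + 2 * p + H) / E - N / D - 2 * R\<^sup>2 * p / D\<^sup>2 = R\<^sup>2 / D - R\<^sup>2 / E - 2 * R\<^sup>2 * p / D\<^sup>2"
        by simp
      also have "\<dots> = R\<^sup>2 * (D * E - D * D - 2 * p * E) / (E * D\<^sup>2)"
        using DE by (simp add: field_simps power2_eq_square)
      also have "D * E - D * D - 2 * p * E = H * D - 4 * p\<^sup>2 - 2 * p * H"
        unfolding E by (simp add: algebra_simps power2_eq_square)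
      finally show ?thesis .
    qed
    finally have eq: "f (y + h) - f y - G y \<bullet> h = R\<^sup>2 * (H * D - 4 * p\<^sup>2 - 2 * p * H) / (E * D\<^sup>2)" .
    have "\<bar>H * D - 4 * p\<^sup>2 - 2 * p * H\<bar> \<le> H * D + 4 * p\<^sup>2 + (2 * \<bar>p\<bar>) * H"
    proof -
      have "\<bar>2 * p * H\<bar> = 2 * \<bar>p\<bar> * H" "0 \<le> H * D" "0 \<le> p\<^sup>2"
        using N0 DE by (auto simp: abs_mult)
      then show ?thesis by linarith
    qed
    \<comment> \<open>The constant 6 is 1 + 4 + 1: Cauchy-Schwarz gives
      \<open>p\<^sup>2 \<le> N * H\<close>, and together with \<open>H \<le> R\<^sup>2\<close> it
      gives \<open>2 * \<bar>p\<bar> \<le> D\<close>.\<close>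
    also have "\<dots> \<le> H * D + 4 * (D * H) + D * H"
    proof (intro add_mono mult_left_mono mult_right_mono)
      show "p\<^sup>2 \<le> D * H" using p2 N0 R mult_right_mono[of N D H] by (simp add: D_def)
      show "2 * \<bar>p\<bar> \<le> D" using p3 HR by (simp add: D_def)
    qed (use N0 in auto)
    finally have num: "\<bar>H * D - 4 * p\<^sup>2 - 2 * p * H\<bar> \<le> 6 * H * D" by (simp add: mult_ac)
    have "\<bar>f (y + h) - f y - G y \<bullet> h\<bar> = R\<^sup>2 * \<bar>H * D - 4 * p\<^sup>2 - 2 * p * H\<bar> / (E * D\<^sup>2)"
      using DE by (simp add: eq abs_mult)
    also have "\<dots> \<le> R\<^sup>2 * (6 * H * D) / (E * D\<^sup>2)"
      using num DE by (intro divide_right_mono mult_left_mono) auto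
    also have "\<dots> = 6 * H * (R\<^sup>2 / E) / D"
      using DE by (simp add: power2_eq_square)
    also have "6 * H * (R\<^sup>2 / E) / D \<le> 6 * H * 1 / R\<^sup>2"
    proof -
      have "R\<^sup>2 / E \<le> 1" using divide_le_eq_1_pos[OF DE(2)] DR(2) by blast
      then have "6 * H * (R\<^sup>2 / E) \<le> 6 * H * 1"
        using N0 by (intro mult_left_mono) auto
      moreover have "0 \<le> 6 * H * 1" using N0 by simp
      ultimately show ?thesis using DR by (intro frac_le)
    qed
    finally show "\<bar>f (y + h) - f y - G y \<bullet> h\<bar> \<le> 6 * (norm h / R)\<^sup>2"
      by (simp add: H_def power_divide)
  qed simp
qed

end

section \<open>Exit times and optional stopping\<close>

lemma exit_time_nonneg: "0 \<le> exit_time X A \<omega>"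
  unfolding exit_time_def by (intro INF_greatest) auto

lemma exit_time_mono: "A \<subseteq> B \<Longrightarrow> exit_time X A \<omega> \<le> exit_time X B \<omega>"
  unfolding exit_time_def by (intro INF_superset_mono) auto

lemma exit_time_less_iff:
  "exit_time X A \<omega> < ereal s \<longleftrightarrow> (\<exists>t>0. t < s \<and> X t \<omega> \<notin> A)"
  unfolding exit_time_def by (auto simp: INF_less_iff)

lemma is_martingale_expectation:
  assumes "prob_space N" "is_martingale N F Y" "filtration (space N) F" "0 \<le> s" "s \<le> t"
  shows "(\<integral>\<omega>. Y t \<omega> \<partial>N) = (\<integral>\<omega>. Y s \<omega> \<partial>N)"
proof -
  interpret filtration "space N" F by fact
  have "space N \<in> sets (F s)"
    using sets.top[of "F s"] by (simp add: space_F)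
  then have "(\<integral>\<omega>. indicator (space N) \<omega> * Y t \<omega> \<partial>N) = (\<integral>\<omega>. indicator (space N) \<omega> * Y s \<omega> \<partial>N)"
    using assms(2,4,5) unfolding is_martingale_def by blast
  then show ?thesis by (simp cong: Bochner_Integration.integral_cong)
qed

text \<open>A time with finitely many values splits the expectation over the events
  \<open>T = i\<close>; on each, the martingale identity between \<open>i\<close> and
  \<open>t\<close> applies because that event is known at time \<open>i\<close>. Dynkin's formula
  below is a limit of this case.\<close>

lemma optional_stopping_finite:
  fixes T :: "'w \<Rightarrow> real"
  assumes N: "prob_space N" and mart: "is_martingale N F Y" and filt: "filtration (space N) F"
    and sub: "\<And>t. sets (F t) \<subseteq> sets N"
    and I: "finite I" "\<And>i. i \<in> I \<Longrightarrow> 0 \<le> i \<and> i \<le> t"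
    and T: "\<And>\<omega>. \<omega> \<in> space N \<Longrightarrow> T \<omega> \<in> I"
    and Ti: "\<And>i. i \<in> I \<Longrightarrow> {\<omega> \<in> space N. T \<omega> = i} \<in> sets (F i)"
  shows "integrable N (\<lambda>\<omega>. Y (T \<omega>) \<omega>)" "(\<integral>\<omega>. Y (T \<omega>) \<omega> \<partial>N) = (\<integral>\<omega>. Y t \<omega> \<partial>N)"
proof -
  define A where "A i = {\<omega> \<in> space N. T \<omega> = i}" for i
  have sum_eq: "(\<Sum>i\<in>I. indicator (A i) \<omega> * y i) = y (T \<omega>)" if "\<omega> \<in> space N" for \<omega> and y :: "real \<Rightarrow> real"
  proof -
    have "(\<Sum>i\<in>I. indicator (A i) \<omega> * y i) = (\<Sum>i\<in>I. if i = T \<omega> then y i else 0)"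
      using that by (intro sum.cong) (auto simp: A_def)
    then show ?thesis using T[OF that] I(1) by simp
  qed
  have YI: "integrable N (Y i)" if "0 \<le> i" for i
    using mart that unfolding is_martingale_def by blast
  have AN: "A i \<in> sets N" if "i \<in> I" for i
    using Ti[OF that] sub unfolding A_def by blast
  have int: "integrable N (\<lambda>\<omega>. indicator (A i) \<omega> * Y s \<omega>)" if "i \<in> I" "0 \<le> s" for i s
    using integrable_mult_indicator[OF AN[OF that(1)] YI[OF that(2)]] by simp
  have 1: "integrable N (\<lambda>\<omega>. \<Sum>i\<in>I. indicator (A i) \<omega> * Y i \<omega>)"
    using int I by (intro Bochner_Integration.integrable_sum) auto
  show "integrable N (\<lambda>\<omega>. Y (T \<omega>) \<omega>)"
    by (rule Bochner_Integration.integrable_cong[THEN iffD1, OF refl _ 1]) (rule sum_eq)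
  have "(\<integral>\<omega>. Y (T \<omega>) \<omega> \<partial>N) = (\<integral>\<omega>. (\<Sum>i\<in>I. indicator (A i) \<omega> * Y i \<omega>) \<partial>N)"
    by (rule Bochner_Integration.integral_cong[OF refl]) (simp add: sum_eq)
  also have "\<dots> = (\<Sum>i\<in>I. \<integral>\<omega>. indicator (A i) \<omega> * Y i \<omega> \<partial>N)"
    using int I by (intro Bochner_Integration.integral_sum) auto
  also have "\<dots> = (\<Sum>i\<in>I. \<integral>\<omega>. indicator (A i) \<omega> * Y t \<omega> \<partial>N)"
  proof (intro sum.cong refl)
    fix i assume i: "i \<in> I"
    show "(\<integral>\<omega>. indicator (A i) \<omega> * Y i \<omega> \<partial>N) = (\<integral>\<omega>. indicator (A i) \<omega> * Y t \<omega> \<partial>N)"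
      using mart[unfolded is_martingale_def, THEN conjunct2, rule_format, of i t "A i"] I(2)[OF i] Ti[OF i]
      unfolding A_def by simp
  qed
  also have "\<dots> = (\<integral>\<omega>. (\<Sum>i\<in>I. indicator (A i) \<omega> * Y t \<omega>) \<partial>N)"
  proof (cases "I = {}")
    case False
    then have "0 \<le> t" using I(2) by force
    then show ?thesis
      using int by (intro Bochner_Integration.integral_sum[symmetric]) auto
  qed simp
  also have "\<dots> = (\<integral>\<omega>. Y t \<omega> \<partial>N)"
    by (rule Bochner_Integration.integral_cong[OF refl]) (simp add: sum_eq[where y="\<lambda>_. Y t _"])
  finally show "(\<integral>\<omega>. Y (T \<omega>) \<omega> \<partial>N) = (\<integral>\<omega>. Y t \<omega> \<partial>N)" .
qed

section \<open>Stopping a right-continuous path\<close>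

locale cadlag_process =
  fixes M :: "'w measure" and F :: "real \<Rightarrow> 'w measure" and X :: "real \<Rightarrow> 'w \<Rightarrow> 'a::euclidean_space"
  assumes F_filt: "filtration (space M) F" "\<forall>t. sets (F t) \<subseteq> sets M"
    and X_adapted: "\<forall>t\<ge>0. X t \<in> measurable (F t) borel"
    and X_cadlag: "cadlag_paths M X"
begin

sublocale filtration "space M" F by (rule F_filt(1))

lemma right_limit:
  assumes "\<omega> \<in> space M" "0 \<le> s" "\<And>n. s \<le> r n" "r \<longlonglongrightarrow> s"
  shows "(\<lambda>n. X (r n) \<omega>) \<longlonglongrightarrow> X s \<omega>"
proof -
  have "continuous (at s within {s..}) (\<lambda>s. X s \<omega>)"
    using X_cadlag assms unfolding cadlag_paths_def by blast
  then show ?thesis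
    by (rule continuous_within_tendsto_compose) (use assms in auto)
qed

lemma right_neighbourhood:
  assumes "\<omega> \<in> space M" "0 \<le> s" "open U" "X s \<omega> \<in> U"
  shows "\<exists>\<delta>>0. \<forall>r. s \<le> r \<and> r < s + \<delta> \<longrightarrow> X r \<omega> \<in> U"
proof -
  have "continuous (at s within {s..}) (\<lambda>s. X s \<omega>)"
    using X_cadlag assms unfolding cadlag_paths_def by blast
  then have "\<forall>\<^sub>F r in at s within {s..}. X r \<omega> \<in> U"
    using assms(3,4) unfolding continuous_within by (rule topological_tendstoD)
  then obtain \<delta> where "\<delta> > 0" "\<And>r. r \<in> {s..} \<Longrightarrow> r \<noteq> s \<Longrightarrow> dist r s < \<delta> \<Longrightarrow> X r \<omega> \<in> U"
    unfolding eventually_at by auto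
  then show ?thesis
    using assms(4) by (intro exI[of _ \<delta>]) (force simp: dist_real_def)
qed

text \<open>Right continuity allows approximation by step functions that take the value at the next
  grid point to the right. The \<open>max 0\<close> discards negative times, where nothing is known
  about the path.\<close>

lemma path_measurable:
  assumes \<omega>: "\<omega> \<in> space M"
  shows "(\<lambda>s. X (max 0 s) \<omega>) \<in> borel_measurable borel"
proof (rule borel_measurable_LIMSEQ_metric)
  define r where "r n s = (of_int \<lfloor>real (Suc n) * max 0 s\<rfloor> + 1) / real (Suc n)" for n and s :: real
  show "(\<lambda>s. X (r n s) \<omega>) \<in> borel_measurable borel" for n
  proof -
    have "(\<lambda>s. \<lfloor>real (Suc n) * max 0 s\<rfloor>) \<in> measurable borel (count_space UNIV)"
      by measurable
    from measurable_compose[OF this, of "\<lambda>k. X ((of_int k + 1) / real (Suc n)) \<omega>" borel]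
    show ?thesis by (simp add: r_def)
  qed
  show "(\<lambda>n. X (r n s) \<omega>) \<longlonglongrightarrow> X (max 0 s) \<omega>" for s
  proof (rule right_limit[OF \<omega>])
    show le: "max 0 s \<le> r n s" for n
    proof -
      have "real (Suc n) * max 0 s \<le> of_int \<lfloor>real (Suc n) * max 0 s\<rfloor> + 1" by linarith
      then show ?thesis unfolding r_def by (subst pos_le_divide_eq) (auto simp: mult.commute)
    qed
    have ge: "r n s \<le> max 0 s + 1 / real (Suc n)" for n
    proof -
      have "of_int \<lfloor>real (Suc n) * max 0 s\<rfloor> + 1 \<le> real (Suc n) * max 0 s + 1" by linarith
      then have "r n s \<le> (real (Suc n) * max 0 s + 1) / real (Suc n)"
        unfolding r_def by (intro divide_right_mono) auto
      also have "\<dots> = max 0 s + 1 / real (Suc n)" by (simp add: add_divide_distrib)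
      finally show ?thesis .
    qed
    have "(\<lambda>n. max 0 s + 1 / real (Suc n)) \<longlonglongrightarrow> max 0 s + 0"
      by (intro tendsto_add tendsto_const LIMSEQ_Suc[OF lim_1_over_n])
    then show "(\<lambda>n. r n s) \<longlonglongrightarrow> max 0 s"
      using le ge by (intro tendsto_sandwich[of "\<lambda>_. max 0 s" "\<lambda>n. r n s" sequentially "\<lambda>n. max 0 s + 1 / real (Suc n)"]) auto
  qed simp
qed

text \<open>A path outside a closed set at some time stays outside for a short while afterwards, so
  rational times detect the exit. It is the strict inequality that can be decided at time
  \<open>s\<close> in this way, and the discretisation below is therefore written in terms of strict
  events.\<close>

lemma exit_time_less_measurable:
  assumes "closed C"
  shows "{\<omega> \<in> space M. exit_time X C \<omega> < ereal s} \<in> sets (F s)"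
proof -
  have "{\<omega> \<in> space M. exit_time X C \<omega> < ereal s} =
     (\<Union>q\<in>{q \<in> \<rat>. 0 < q \<and> q < s}. {\<omega> \<in> space M. X q \<omega> \<notin> C})" (is "?A = ?B")
  proof
    show "?B \<subseteq> ?A" by (auto simp: exit_time_less_iff)
    show "?A \<subseteq> ?B"
    proof
      fix \<omega> assume "\<omega> \<in> ?A"
      then obtain t where \<omega>: "\<omega> \<in> space M" and t: "0 < t" "t < s" "X t \<omega> \<in> - C"
        by (auto simp: exit_time_less_iff)
      obtain \<delta> where \<delta>: "\<delta> > 0" "\<And>r. t \<le> r \<Longrightarrow> r < t + \<delta> \<Longrightarrow> X r \<omega> \<in> - C"
        using right_neighbourhood[OF \<omega> less_imp_le[OF t(1)] open_Compl[OF assms] t(3)] by blast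
      obtain q where "q \<in> \<rat>" "t < q" "q < min s (t + \<delta>)"
        using Rats_dense_in_real[of t "min s (t + \<delta>)"] t \<delta>(1) by auto
      then show "\<omega> \<in> ?B" using \<omega> t \<delta>(2)[of q] by auto
    qed
  qed
  also have "\<dots> \<in> sets (F s)"
  proof (intro sets.countable_UN'')
    show "countable {q \<in> \<rat>. 0 < q \<and> q < s}"
      by (rule countable_subset[OF _ countable_rat]) auto
    fix q assume q: "q \<in> {q \<in> \<rat>. 0 < q \<and> q < s}"
    then have "X q \<in> measurable (F q) borel" using X_adapted by simp
    then have "X q -` (- C) \<inter> space (F q) \<in> sets (F q)"
      by (rule measurable_sets) (use assms in auto)
    moreover have "X q -` (- C) \<inter> space (F q) = {\<omega> \<in> space M. X q \<omega> \<notin> C}"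
      by (auto simp: space_F)
    ultimately show "{\<omega> \<in> space M. X q \<omega> \<notin> C} \<in> sets (F s)"
      using sets_F_mono[of q s] q by auto
  qed
  finally show ?thesis .
qed

text \<open>The same term as in \<open>harmonic_in\<close>; the cap \<open>t\<close> makes it
  finite, so that nothing is lost in passing to real numbers.\<close>

definition stop :: "'a set \<Rightarrow> real \<Rightarrow> 'w \<Rightarrow> real" where
  "stop C t \<omega> = real_of_ereal (min (ereal t) (exit_time X C \<omega>))"

lemma ereal_stop: "0 \<le> t \<Longrightarrow> ereal (stop C t \<omega>) = min (ereal t) (exit_time X C \<omega>)"
  using exit_time_nonneg[of X C \<omega>] unfolding stop_def
  by (cases "exit_time X C \<omega>") (auto simp: min_def)

lemma stop_bounds: "0 \<le> t \<Longrightarrow> 0 \<le> stop C t \<omega>" "0 \<le> t \<Longrightarrow> stop C t \<omega> \<le> t"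
proof -
  assume t: "0 \<le> t"
  show "0 \<le> stop C t \<omega>"
    using exit_time_nonneg[of X C \<omega>] t unfolding stop_def by (intro real_of_ereal_pos) auto
  have "ereal (stop C t \<omega>) \<le> ereal t" by (simp add: ereal_stop[OF t])
  then show "stop C t \<omega> \<le> t" by simp
qed

lemma stop_less_iff:
  assumes "0 \<le> t" "s \<le> t"
  shows "stop C t \<omega> < s \<longleftrightarrow> exit_time X C \<omega> < ereal s"
proof -
  have "stop C t \<omega> < s \<longleftrightarrow> ereal (stop C t \<omega>) < ereal s" by simp
  also have "\<dots> \<longleftrightarrow> exit_time X C \<omega> < ereal s"
    unfolding ereal_stop[OF assms(1)] using assms(2) by (auto simp: min_less_iff_disj)
  finally show ?thesis .
qed

lemma stop_mono:
  assumes "0 \<le> t" "A \<subseteq> B"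
  shows "stop A t \<omega> \<le> stop B t \<omega>"
proof -
  have "ereal (stop A t \<omega>) \<le> ereal (stop B t \<omega>)"
    unfolding ereal_stop[OF assms(1)] using exit_time_mono[OF assms(2), of X \<omega>] by (intro min.mono) auto
  then show ?thesis by simp
qed

lemma before_stop:
  assumes "0 < s" "s < stop C t \<omega>" "0 \<le> t"
  shows "X s \<omega> \<in> C"
proof (rule ccontr)
  assume "X s \<omega> \<notin> C"
  then have "exit_time X C \<omega> < ereal (stop C t \<omega>)"
    using assms by (auto simp: exit_time_less_iff)
  then have "stop C t \<omega> < stop C t \<omega>"
    using stop_less_iff[OF assms(3) stop_bounds(2)[OF assms(3)]] by blast
  then show False by simp
qed

text \<open>The exit time is an infimum, so the path may still lie in \<open>C\<close> at that
  moment. It cannot lie in an open part of \<open>C\<close>, because right continuity would keep it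
  there and postpone the exit.\<close>

lemma at_stop:
  assumes "\<omega> \<in> space M" "0 \<le> t" "stop C t \<omega> < t" "open U" "U \<subseteq> C"
  shows "X (stop C t \<omega>) \<omega> \<notin> U"
proof
  define s where "s = stop C t \<omega>"
  assume "X (stop C t \<omega>) \<omega> \<in> U"
  then obtain \<delta> where \<delta>: "\<delta> > 0" "\<And>r. s \<le> r \<Longrightarrow> r < s + \<delta> \<Longrightarrow> X r \<omega> \<in> U"
    using right_neighbourhood[OF assms(1) stop_bounds(1)[OF assms(2)] assms(4)] unfolding s_def by blast
  define s' where "s' = min t (s + \<delta>)"
  have s': "s < s'" "s' \<le> t" using \<delta> assms(3) by (auto simp: s'_def s_def)
  then have "exit_time X C \<omega> < ereal s'"
    using stop_less_iff[OF assms(2) s'(2), of C \<omega>] by (simp add: s_def)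
  then obtain r where r: "0 < r" "r < s'" "X r \<omega> \<notin> C" by (auto simp: exit_time_less_iff)
  have "\<not> r < s" using before_stop[OF r(1) _ assms(2)] r(3) by (auto simp: s_def)
  then have "X r \<omega> \<in> U" using \<delta>(2)[of r] r(2) by (auto simp: s'_def)
  then show False using assms(5) r(3) by auto
qed

text \<open>The grid times approach from the right, the side on which the paths are
  continuous.\<close>

lemma discrete_stop:
  assumes t: "0 < t" and C: "closed C"
  obtains T :: "nat \<Rightarrow> 'w \<Rightarrow> real" and I :: "nat \<Rightarrow> real set" where
    "\<And>n. finite (I n)" "\<And>n i. i \<in> I n \<Longrightarrow> 0 \<le> i \<and> i \<le> t"
    "\<And>n \<omega>. \<omega> \<in> space M \<Longrightarrow> T n \<omega> \<in> I n"
    "\<And>n i. i \<in> I n \<Longrightarrow> {\<omega> \<in> space M. T n \<omega> = i} \<in> sets (F i)"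
    "\<And>n \<omega>. \<omega> \<in> space M \<Longrightarrow> stop C t \<omega> \<le> T n \<omega>"
    "\<And>\<omega>. \<omega> \<in> space M \<Longrightarrow> (\<lambda>n. T n \<omega>) \<longlonglongrightarrow> stop C t \<omega>"
proof -
  define S where "S = stop C t"
  have S: "0 \<le> S \<omega>" "S \<omega> \<le> t" for \<omega> using stop_bounds t by (auto simp: S_def)
  define g where "g n j = t * real j / real (Suc n)" for n j
  \<comment> \<open>The \<open>+ 1\<close> moves to the first grid point strictly after
    \<open>S\<close>, so that \<open>J n \<omega> \<le> j\<close> is the strict event
    \<open>S \<omega> < g n j\<close>; the cap at \<open>Suc n\<close> in \<open>T\<close> keeps the
    time at most \<open>t\<close> when \<open>S \<omega> = t\<close>.\<close>
  define J where "J n \<omega> = nat \<lfloor>S \<omega> * real (Suc n) / t\<rfloor> + 1" for n \<omega>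
  define T where "T n \<omega> = g n (min (Suc n) (J n \<omega>))" for n \<omega>
  define I where "I n = g n ` {1..Suc n}" for n
  have g_inj: "g n i = g n j \<longleftrightarrow> i = j" for n i j using t by (auto simp: g_def)
  have g_less: "S \<omega> < g n j \<longleftrightarrow> J n \<omega> \<le> j" if "1 \<le> j" for n \<omega> j
  proof -
    have "S \<omega> < g n j \<longleftrightarrow> S \<omega> * real (Suc n) / t < real j"
      using t by (simp add: g_def field_simps)
    also have "\<dots> \<longleftrightarrow> \<lfloor>S \<omega> * real (Suc n) / t\<rfloor> < int j"
      by (simp add: floor_less_iff)
    also have "\<dots> \<longleftrightarrow> nat \<lfloor>S \<omega> * real (Suc n) / t\<rfloor> < j"
      using that by linarith
    also have "\<dots> \<longleftrightarrow> J n \<omega> \<le> j" by (auto simp: J_def)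
    finally show ?thesis .
  qed
  have g_le: "g n j \<le> t" if "j \<le> Suc n" for n j
  proof -
    have "t * real j \<le> t * real (Suc n)" using that t by (intro mult_left_mono) auto
    then show ?thesis unfolding g_def by (subst pos_divide_le_eq) auto
  qed
  have S_meas: "{\<omega> \<in> space M. S \<omega> < g n j} \<in> sets (F (g n j))" if "j \<le> Suc n" for n j
    using exit_time_less_measurable[OF C, of "g n j"] stop_less_iff[OF _ g_le[OF that]] t by (simp add: S_def)
  show ?thesis
  proof (rule that[of I T])
    show "finite (I n)" for n by (simp add: I_def)
    show "0 \<le> i \<and> i \<le> t" if "i \<in> I n" for n i
      using that t g_le by (auto simp: I_def g_def)
    show "T n \<omega> \<in> I n" for n \<omega>
      unfolding T_def I_def by (intro imageI) (auto simp: J_def)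
    show "{\<omega> \<in> space M. T n \<omega> = i} \<in> sets (F i)" if i: "i \<in> I n" for n i
    proof -
      obtain j where j: "1 \<le> j" "j \<le> Suc n" "i = g n j" using i by (auto simp: I_def)
      have le: "{\<omega> \<in> space M. \<not> S \<omega> < g n (j - 1)} \<in> sets (F i)"
      proof -
        have le: "g n (j - 1) \<le> i" using t j by (simp add: g_def divide_right_mono)
        have "j - 1 \<le> Suc n" using j by simp
        then have "{\<omega> \<in> space M. S \<omega> < g n (j - 1)} \<in> sets (F i)"
          by (intro subsetD[OF sets_F_mono[OF le]] S_meas)
        then have "space (F i) - {\<omega> \<in> space M. S \<omega> < g n (j - 1)} \<in> sets (F i)" by auto
        moreover have "space (F i) - {\<omega> \<in> space M. S \<omega> < g n (j - 1)} = {\<omega> \<in> space M. \<not> S \<omega> < g n (j - 1)}"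
          by (auto simp: space_F)
        ultimately show ?thesis by simp
      qed
      have ge: "\<not> S \<omega> < g n (j - 1) \<longleftrightarrow> j \<le> J n \<omega>" for \<omega>
      proof (cases "j = 1")
        case True
        then show ?thesis using S[of \<omega>] by (simp add: g_def J_def)
      next
        case False
        then show ?thesis using g_less[of "j - 1" \<omega> n] j by auto
      qed
      show ?thesis
      \<comment> \<open>The last grid point also collects the paths with
        \<open>S \<omega> = t\<close>, so only the lower condition remains there.\<close>
      proof (cases "j = Suc n")
        case True
        then have "T n \<omega> = i \<longleftrightarrow> \<not> S \<omega> < g n (j - 1)" for \<omega>
          unfolding ge by (auto simp: T_def j(3) g_inj)
        then show ?thesis using le by simp
      next
        case False
        then have "T n \<omega> = i \<longleftrightarrow> J n \<omega> = j" for \<omega>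
          using j by (auto simp: T_def g_inj)
        also have "J n \<omega> = j \<longleftrightarrow> \<not> S \<omega> < g n (j - 1) \<and> S \<omega> < g n j" for \<omega>
          unfolding ge g_less[OF j(1)] by auto
        finally have "{\<omega> \<in> space M. T n \<omega> = i} = {\<omega> \<in> space M. \<not> S \<omega> < g n (j - 1)} \<inter> {\<omega> \<in> space M. S \<omega> < g n j}"
          by auto
        then show ?thesis using le S_meas[OF j(2)] j(3) by auto
      qed
    qed
    have Sle: "stop C t \<omega> \<le> T n \<omega>" for n \<omega>
    proof (cases "Suc n \<le> J n \<omega>")
      case True
      then show ?thesis using S[of \<omega>] by (simp add: T_def g_def S_def)
    next
      case False
      then have "S \<omega> < g n (J n \<omega>)" using g_less[of "J n \<omega>" \<omega> n] by (simp add: J_def)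
      then show ?thesis using False by (simp add: T_def S_def min_def)
    qed
    then show "stop C t \<omega> \<le> T n \<omega>" for n \<omega> .
    have Tle: "T n \<omega> \<le> stop C t \<omega> + t / real (Suc n)" for n \<omega>
    proof -
      have "T n \<omega> \<le> g n (J n \<omega>)"
        using t unfolding T_def g_def by (intro divide_right_mono mult_left_mono) auto
      also have "real (J n \<omega>) \<le> S \<omega> * real (Suc n) / t + 1"
        using S[of \<omega>] t by (simp add: J_def)
      then have "g n (J n \<omega>) \<le> t * (S \<omega> * real (Suc n) / t + 1) / real (Suc n)"
        using t unfolding g_def by (intro divide_right_mono mult_left_mono) auto
      also have "\<dots> = S \<omega> + t / real (Suc n)"
      proof -
        have "t * (s * N / t + 1) / N = s + t / N" if "N \<noteq> 0" for s N :: real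
          using that t by (simp add: field_simps)
        then show ?thesis by (metis of_nat_eq_0_iff nat.distinct(2))
      qed
      finally show ?thesis by (simp add: S_def)
    qed
    show "(\<lambda>n. T n \<omega>) \<longlonglongrightarrow> stop C t \<omega>" for \<omega>
    proof (rule tendsto_sandwich[of "\<lambda>_. stop C t \<omega>" _ _ "\<lambda>n. stop C t \<omega> + t / real (Suc n)"])
      have "(\<lambda>n. stop C t \<omega> + t * (1 / real (Suc n))) \<longlonglongrightarrow> stop C t \<omega> + t * 0"
        by (intro tendsto_intros LIMSEQ_Suc[OF lim_1_over_n])
      then show "(\<lambda>n. stop C t \<omega> + t / real (Suc n)) \<longlonglongrightarrow> stop C t \<omega>" by simp
    qed (use Sle Tle in auto)
  qed
qed

lemma stop_measurable:
  assumes "0 < t" "closed C"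
  shows "stop C t \<in> borel_measurable M" "(\<lambda>\<omega>. X (stop C t \<omega>) \<omega>) \<in> borel_measurable M"
proof -
  obtain T I where TI: "\<And>n. finite (I n)" "\<And>n i. i \<in> I n \<Longrightarrow> 0 \<le> i \<and> i \<le> t"
    "\<And>n \<omega>. \<omega> \<in> space M \<Longrightarrow> T n \<omega> \<in> I n"
    "\<And>n i. i \<in> I n \<Longrightarrow> {\<omega> \<in> space M. T n \<omega> = i} \<in> sets (F i)"
    "\<And>n \<omega>. \<omega> \<in> space M \<Longrightarrow> stop C t \<omega> \<le> T n \<omega>"
    "\<And>\<omega>. \<omega> \<in> space M \<Longrightarrow> (\<lambda>n. T n \<omega>) \<longlonglongrightarrow> stop C t \<omega>"
    by (rule discrete_stop[OF assms]) (rule that; assumption)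
  have Tm: "T n \<in> measurable M (count_space (I n))" for n
  proof (subst measurable_count_space_eq_countable)
    show "countable (I n)" using TI(1) by (rule countable_finite)
    have "T n -` {i} \<inter> space M = {\<omega> \<in> space M. T n \<omega> = i}" for i by auto
    then show "T n \<in> space M \<rightarrow> I n \<and> (\<forall>i\<in>I n. T n -` {i} \<inter> space M \<in> sets M)"
      using TI(3) subsetD[OF F_filt(2)[rule_format] TI(4)] by (simp add: Pi_iff)
  qed
  have sub: "X i \<in> measurable M borel" if "0 \<le> i" for i
  proof (rule measurableI)
    fix A :: "'a set" assume A: "A \<in> sets borel"
    have "X i -` A \<inter> space (F i) \<in> sets (F i)"
      using X_adapted that A by (intro measurable_sets) auto
    then show "X i -` A \<inter> space M \<in> sets M" using F_filt(2) by (auto simp: space_F)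
  qed simp
  show "stop C t \<in> borel_measurable M"
  proof (rule borel_measurable_LIMSEQ_metric)
    show "T n \<in> borel_measurable M" for n
      using measurable_compose[OF Tm, where g="\<lambda>i. i" and L=borel] by simp
  qed (rule TI(6))
  show "(\<lambda>\<omega>. X (stop C t \<omega>) \<omega>) \<in> borel_measurable M"
  proof (rule borel_measurable_LIMSEQ_metric)
    show "(\<lambda>\<omega>. X (T n \<omega>) \<omega>) \<in> borel_measurable M" for n
      by (rule measurable_compose_countable'[OF _ Tm])
         (use TI(1,2) sub in \<open>auto intro: countable_finite\<close>)
    show "(\<lambda>n. X (T n \<omega>) \<omega>) \<longlonglongrightarrow> X (stop C t \<omega>) \<omega>" if "\<omega> \<in> space M" for \<omega>
      using that assms TI(5,6) by (intro right_limit stop_bounds) auto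
  qed
qed

end

section \<open>The exit distribution\<close>

text \<open>An inequality between measures does not pass through a generating class, since
  complements do not inherit it. Instead Vitali's theorem fills an open set by disjoint balls up to
  a Lebesgue null set, which \<open>\<nu>\<close> ignores, and outer regularity of the finite
  measure \<open>Q\<close> leads from open to Borel sets.\<close>

lemma measure_le_on_open:
  fixes Q \<nu> :: "'a::euclidean_space measure"
  assumes Q: "sets Q = sets borel" "emeasure Q (space Q) \<noteq> \<infinity>"
    and \<nu>: "sets \<nu> = sets borel" "\<And>N. N \<in> null_sets lborel \<Longrightarrow> N \<in> null_sets \<nu>"
    and D: "open D" and ball: "\<And>c s. 0 < s \<Longrightarrow> ball c s \<subseteq> D \<Longrightarrow> emeasure \<nu> (ball c s) \<le> emeasure Q (ball c s)"
    and A: "A \<in> sets borel" "A \<subseteq> D"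
  shows "emeasure \<nu> A \<le> emeasure Q A"
proof -
  have le_open: "emeasure \<nu> U \<le> emeasure Q U" if U: "open U" "U \<subseteq> D" for U
  proof -
    define K where "K = {(c, s). 0 < s \<and> ball c s \<subseteq> U}"
    have cover: "\<exists>i. i \<in> K \<and> x \<in> ball (fst i) (snd i) \<and> snd i < d" if xd: "x \<in> U" "0 < d" for x d
    proof -
      obtain e where "0 < e" "ball x e \<subseteq> U" by (rule openE[OF U(1) xd(1)])
      then have "(x, min e (d/2)) \<in> K" using xd(2) by (auto simp: K_def)
      then show ?thesis using \<open>0 < e\<close> xd(2) by (intro exI[of _ "(x, min e (d/2))"]) auto
    qed
    obtain C where C: "countable C" "C \<subseteq> K"
       "pairwise (\<lambda>i j. disjnt (ball (fst i) (snd i)) (ball (fst j) (snd j))) C"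
       "negligible (U - (\<Union>i\<in>C. ball (fst i) (snd i)))"
    proof (rule Vitali_covering_theorem_balls[of U K fst snd])
      show "\<exists>i. i \<in> K \<and> x \<in> ball (fst i) (snd i) \<and> snd i < d" if "x \<in> U" "0 < d" for x d
        using that by (rule cover)
    qed (rule that)
    define V where "V = (\<Union>i\<in>C. ball (fst i) (snd i))"
    have VU: "V \<subseteq> U" using C(2) by (force simp: V_def K_def)
    have oV: "open V" by (auto simp: V_def)
    have disj: "disjoint_family_on (\<lambda>i. ball (fst i) (snd i)) C"
      using C(3) by (auto simp: disjoint_family_on_def pairwise_def disjnt_def)
    have "U - V \<in> null_sets lborel"
      using C(4) U(1) oV by (simp add: negligible_iff_null_sets V_def[symmetric] null_sets_completion_iff)
    then have "U - V \<in> null_sets \<nu>" by (rule \<nu>(2))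
    then have "emeasure \<nu> U = emeasure \<nu> (U - (U - V))"
      using U(1) \<nu>(1) by (intro emeasure_Diff_null_set[symmetric]) auto
    also have "U - (U - V) = V" using VU by auto
    also have "emeasure \<nu> V = (\<integral>\<^sup>+ i. emeasure \<nu> (ball (fst i) (snd i)) \<partial>count_space C)"
      unfolding V_def using \<nu>(1) C(1) disj by (intro emeasure_UN_countable) auto
    also have "\<dots> \<le> (\<integral>\<^sup>+ i. emeasure Q (ball (fst i) (snd i)) \<partial>count_space C)"
    proof (intro nn_integral_mono)
      fix i assume "i \<in> space (count_space C)"
      then have "i \<in> K" using C(2) by auto
      then have "0 < snd i" "ball (fst i) (snd i) \<subseteq> U" unfolding K_def by (simp_all add: split_beta)
      then have "0 < snd i" "ball (fst i) (snd i) \<subseteq> D" using U(2) by blast+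
      then show "emeasure \<nu> (ball (fst i) (snd i)) \<le> emeasure Q (ball (fst i) (snd i))" by (rule ball)
    qed
    also have "\<dots> = emeasure Q V"
      unfolding V_def using Q(1) C(1) disj by (intro emeasure_UN_countable[symmetric]) auto
    also have "\<dots> \<le> emeasure Q U"
      using VU U(1) Q(1) by (intro emeasure_mono) auto
    finally show ?thesis .
  qed
  have "emeasure \<nu> A \<le> (INF U \<in> {U. A \<subseteq> U \<and> open U}. emeasure Q U)"
  proof (rule INF_greatest)
    fix U assume "U \<in> {U. A \<subseteq> U \<and> open U}"
    then have U: "A \<subseteq> U \<inter> D" "open (U \<inter> D)" "open U" using A(2) D by auto
    have "emeasure \<nu> A \<le> emeasure \<nu> (U \<inter> D)"
      using U \<nu>(1) by (intro emeasure_mono) auto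
    also have "\<dots> \<le> emeasure Q (U \<inter> D)" using U by (intro le_open) auto
    also have "\<dots> \<le> emeasure Q U" using U Q(1) by (intro emeasure_mono) auto
    finally show "emeasure \<nu> A \<le> emeasure Q U" .
  qed
  also have "\<dots> = emeasure Q A"
    using outer_regular[OF Q A(1)] by simp
  finally show ?thesis .
qed

context cadlag_process
begin

text \<open>The lower bound asks for information on the open interval only, since a stopped path is
  known to lie in the closed set only strictly between time 0 and the stopping time.\<close>

lemma path_integral:
  fixes \<phi> :: "'a \<Rightarrow> real"
  assumes \<omega>: "\<omega> \<in> space M" and \<phi> [measurable]: "\<phi> \<in> borel_measurable borel"
    and C: "\<And>y. \<bar>\<phi> y\<bar> \<le> C"
  defines "H s \<equiv> (LINT r:{0..s}|lborel. \<phi> (X r \<omega>))"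
  shows "H 0 = 0"
    and "0 \<le> s \<Longrightarrow> s \<le> s' \<Longrightarrow> \<bar>H s' - H s\<bar> \<le> C * (s' - s)"
    and "0 \<le> s \<Longrightarrow> (\<And>r. 0 < r \<Longrightarrow> r < s \<Longrightarrow> c \<le> \<phi> (X r \<omega>)) \<Longrightarrow> c * s \<le> H s"
proof -
  define q where "q r = \<phi> (X (max 0 r) \<omega>)" for r
  have [measurable]: "q \<in> borel_measurable borel"
    unfolding q_def by (rule measurable_compose[OF path_measurable[OF \<omega>] \<phi>])
  have H: "H s = (\<integral>r. indicator {0..s} r * q r \<partial>lborel)" for s
    unfolding H_def set_lebesgue_integral_def
    by (intro Bochner_Integration.integral_cong) (auto simp: q_def indicator_def)
  have int: "integrable lborel (\<lambda>r. indicator {a..b} r * q r)" for a b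
  proof (rule Bochner_Integration.integrable_bound)
    show "integrable lborel (\<lambda>r. indicator {a..b} r * C)"
      by (intro integrable_mult_left integrable_real_indicator) (auto simp: emeasure_lborel_Icc_eq)
    show "AE r in lborel. norm (indicator {a..b} r * q r) \<le> norm (indicator {a..b} r * C)"
      using C order_trans[OF C abs_ge_self] by (intro AE_I2) (auto simp: q_def abs_mult intro!: mult_left_mono)
  qed measurable
  show "H 0 = 0"
    unfolding H
  proof (rule integral_eq_zero_AE)
    show "AE r in lborel. indicator {0..0} r * q r = 0"
      using AE_lborel_singleton[of "0::real"] by eventually_elim auto
  qed
  show "\<bar>H s' - H s\<bar> \<le> C * (s' - s)" if "0 \<le> s" "s \<le> s'"
  proof -
    have "H s' - H s = (\<integral>r. indicator {0..s'} r * q r - indicator {0..s} r * q r \<partial>lborel)"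
      unfolding H by (rule Bochner_Integration.integral_diff[symmetric, OF int int])
    also have "\<bar>\<dots>\<bar> \<le> (\<integral>r. \<bar>indicator {0..s'} r * q r - indicator {0..s} r * q r\<bar> \<partial>lborel)"
      by (rule integral_abs_bound)
    also have "\<dots> \<le> (\<integral>r. indicator {s..s'} r * C \<partial>lborel)"
    proof (rule integral_mono)
      show "integrable lborel (\<lambda>r. \<bar>indicator {0..s'} r * q r - indicator {0..s} r * q r\<bar>)"
        by (intro integrable_abs Bochner_Integration.integrable_diff int)
      show "integrable lborel (\<lambda>r. indicator {s..s'} r * C)"
        by (intro integrable_mult_left integrable_real_indicator) (auto simp: emeasure_lborel_Icc_eq)
      show "\<bar>indicator {0..s'} r * q r - indicator {0..s} r * q r\<bar> \<le> indicator {s..s'} r * C" for r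
        using that C[of "X (max 0 r) \<omega>"] by (auto simp: q_def indicator_def)
    qed
    also have "\<dots> = C * (s' - s)" using that by simp
    finally show ?thesis .
  qed
  show "c * s \<le> H s" if s: "0 \<le> s" and c: "\<And>r. 0 < r \<Longrightarrow> r < s \<Longrightarrow> c \<le> \<phi> (X r \<omega>)"
  proof -
    have "c * s = (\<integral>r. indicator {0..s} r * c \<partial>lborel)" using s by simp
    also have "\<dots> \<le> H s"
      unfolding H
    proof (rule integral_mono_AE)
      show "integrable lborel (\<lambda>r. indicator {0..s} r * c)"
        by (intro integrable_mult_left integrable_real_indicator) (auto simp: emeasure_lborel_Icc_eq)
      show "AE r in lborel. indicator {0..s} r * c \<le> indicator {0..s} r * q r"
        using AE_lborel_singleton[of "0::real"] AE_lborel_singleton[of s]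
        by eventually_elim (auto simp: q_def indicator_def intro!: c)
    qed (rule int)
    finally show ?thesis .
  qed
qed

end

section \<open>The law of the process at a bounded exit time\<close>

locale jump_process = regular_kernel K l \<alpha> K0 \<kappa> + cadlag_process M F X
  for K :: "'a::euclidean_space \<Rightarrow> 'a \<Rightarrow> real" and l \<alpha> K0 \<kappa>
    and M :: "'w measure" and F :: "real \<Rightarrow> 'w measure" and X :: "real \<Rightarrow> 'w \<Rightarrow> 'a" +
  fixes P :: "'a \<Rightarrow> 'w measure"
  assumes P_prob: "\<forall>x. prob_space (P x) \<and> sets (P x) = sets M"
    and P_kernel: "\<forall>A\<in>sets M. (\<lambda>x. emeasure (P x) A) \<in> borel_measurable borel"
    and X_start: "\<forall>x. AE \<omega> in P x. X 0 \<omega> = x"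
    and X_mp: "\<forall>f\<in>C2b. \<forall>x. is_martingale (P x) F
         (\<lambda>t \<omega>. f (X t \<omega>) - f (X 0 \<omega>) - (LINT s:{0..t}|lborel. Lop K f (X s \<omega>)))"
begin

lemma prob_P: "prob_space (P x)" and sets_P [measurable_cong, simp]: "sets (P x) = sets M"
  and space_P [simp]: "space (P x) = space M"
  using P_prob sets_eq_imp_space_eq[of "P x" M] by auto

lemma X0_measurable [measurable]: "X 0 \<in> borel_measurable M"
proof (rule measurableI)
  fix A :: "'a set" assume A: "A \<in> sets borel"
  have "X 0 -` A \<inter> space (F 0) \<in> sets (F 0)"
    using X_adapted A by (intro measurable_sets) auto
  then show "X 0 -` A \<inter> space M \<in> sets M" using F_filt(2) by (auto simp: space_F)
qed simp

text \<open>For the discretised times this is optional stopping. In the limit the first term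
  converges by right continuity, and the time integral because it is Lipschitz in its upper limit;
  everything is bounded, so the expectations converge.\<close>

lemma dynkin:
  assumes f: "f \<in> C2b" and t: "0 < t" and C: "closed C"
  defines "H \<equiv> \<lambda>\<omega>. (LINT s:{0..stop C t \<omega>}|lborel. Lop K f (X s \<omega>))"
  shows "integrable (P x) H" "(\<integral>\<omega>. f (X (stop C t \<omega>) \<omega>) \<partial>P x) = f x + (\<integral>\<omega>. H \<omega> \<partial>P x)"
proof -
  interpret prob_space "P x" by (rule prob_P)
  obtain B where B: "\<And>x. \<bar>f x\<bar> \<le> B"
    using f unfolding C2b_def bounded_iff by auto
  note cf = C2b_continuous[OF f] and f_meas [measurable] = C2b_measurable[OF f]
    and Lm [measurable] = Lop_C2b_measurable[OF f]
  obtain D where D: "\<And>y. \<bar>Lop K f y\<bar> \<le> D"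
    using Lop_C2b_bounded[OF f] by auto
  have D0: "0 \<le> D" using D[of 0] by simp
  define h where "h s \<omega> = (LINT r:{0..s}|lborel. Lop K f (X r \<omega>))" for s \<omega>
  define Y where "Y s \<omega> = f (X s \<omega>) - f (X 0 \<omega>) - h s \<omega>" for s \<omega>
  have h: "h 0 \<omega> = 0" "0 \<le> s \<Longrightarrow> s \<le> s' \<Longrightarrow> \<bar>h s' \<omega> - h s \<omega>\<bar> \<le> D * (s' - s)" if "\<omega> \<in> space M" for \<omega> s s'
    unfolding h_def by (rule path_integral[OF that Lm D]; assumption)+
  have mart: "is_martingale (P x) F Y"
    using X_mp f unfolding Y_def[abs_def] h_def by blast
  have filt: "filtration (space (P x)) F" by (simp add: filtration_axioms)
  obtain T I where TI: "\<And>n. finite (I n)" "\<And>n i. i \<in> I n \<Longrightarrow> 0 \<le> i \<and> i \<le> t"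
    "\<And>n \<omega>. \<omega> \<in> space M \<Longrightarrow> T n \<omega> \<in> I n"
    "\<And>n i. i \<in> I n \<Longrightarrow> {\<omega> \<in> space M. T n \<omega> = i} \<in> sets (F i)"
    "\<And>n \<omega>. \<omega> \<in> space M \<Longrightarrow> stop C t \<omega> \<le> T n \<omega>"
    "\<And>\<omega>. \<omega> \<in> space M \<Longrightarrow> (\<lambda>n. T n \<omega>) \<longlonglongrightarrow> stop C t \<omega>"
    by (rule discrete_stop[OF t C]) (rule that; assumption)
  have S: "0 \<le> stop C t \<omega>" "stop C t \<omega> \<le> t" for \<omega> using stop_bounds t by auto
  have os: "integrable (P x) (\<lambda>\<omega>. Y (T n \<omega>) \<omega>)" "(\<integral>\<omega>. Y (T n \<omega>) \<omega> \<partial>P x) = 0" for n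
  proof -
    show "integrable (P x) (\<lambda>\<omega>. Y (T n \<omega>) \<omega>)"
      using F_filt(2) TI by (intro optional_stopping_finite(1)[OF prob_P mart filt, of "I n" t]) auto
    have "(\<integral>\<omega>. Y (T n \<omega>) \<omega> \<partial>P x) = (\<integral>\<omega>. Y t \<omega> \<partial>P x)"
      using F_filt(2) TI by (intro optional_stopping_finite(2)[OF prob_P mart filt, of "I n" t]) auto
    also have "\<dots> = (\<integral>\<omega>. Y 0 \<omega> \<partial>P x)"
      using t by (intro is_martingale_expectation[OF prob_P mart filt]) auto
    also have "\<dots> = (\<integral>\<omega>. 0 \<partial>P x)"
      by (intro Bochner_Integration.integral_cong) (auto simp: Y_def h(1))
    finally show "(\<integral>\<omega>. Y (T n \<omega>) \<omega> \<partial>P x) = 0" by simp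
  qed
  have lim: "(\<lambda>n. Y (T n \<omega>) \<omega>) \<longlonglongrightarrow> Y (stop C t \<omega>) \<omega>" if \<omega>: "\<omega> \<in> space M" for \<omega>
  proof -
    have "(\<lambda>n. X (T n \<omega>) \<omega>) \<longlonglongrightarrow> X (stop C t \<omega>) \<omega>"
      using \<omega> TI(5,6) S by (intro right_limit) auto
    then have "(\<lambda>n. f (X (T n \<omega>) \<omega>)) \<longlonglongrightarrow> f (X (stop C t \<omega>) \<omega>)"
      by (rule continuous_on_tendsto_compose[OF cf]) auto
    moreover have "(\<lambda>n. h (T n \<omega>) \<omega>) \<longlonglongrightarrow> h (stop C t \<omega>) \<omega>"
    proof (rule LIM_zero_cancel, rule Lim_null_comparison)
      show "\<forall>\<^sub>F n in sequentially. norm (h (T n \<omega>) \<omega> - h (stop C t \<omega>) \<omega>) \<le> D * (T n \<omega> - stop C t \<omega>)"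
        using h(2)[OF \<omega> S(1) TI(5)[OF \<omega>]] by (intro always_eventually allI) simp
      have "(\<lambda>n. D * (T n \<omega> - stop C t \<omega>)) \<longlonglongrightarrow> D * (stop C t \<omega> - stop C t \<omega>)"
        by (intro tendsto_intros TI(6)[OF \<omega>])
      then show "(\<lambda>n. D * (T n \<omega> - stop C t \<omega>)) \<longlonglongrightarrow> 0" by simp
    qed
    ultimately show ?thesis unfolding Y_def by (intro tendsto_intros)
  qed
  have bound: "norm (Y s \<omega>) \<le> 2 * B + D * t" if "\<omega> \<in> space M" "0 \<le> s" "s \<le> t" for s \<omega>
  proof -
    have "\<bar>h s \<omega>\<bar> \<le> D * s" using h(2)[OF that(1), of 0 s] h(1)[OF that(1)] that by simp
    also have "\<dots> \<le> D * t" using that D0 by (intro mult_left_mono) auto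
    finally show ?thesis
      unfolding Y_def using B[of "X s \<omega>"] B[of "X 0 \<omega>"] by simp
  qed
  have Ym: "(\<lambda>\<omega>. Y (stop C t \<omega>) \<omega>) \<in> borel_measurable (P x)"
    by (rule borel_measurable_LIMSEQ_metric[where f="\<lambda>n \<omega>. Y (T n \<omega>) \<omega>"]) (use os(1) lim in auto)
  have "(\<lambda>n. \<integral>\<omega>. Y (T n \<omega>) \<omega> \<partial>P x) \<longlonglongrightarrow> (\<integral>\<omega>. Y (stop C t \<omega>) \<omega> \<partial>P x)"
  proof (rule integral_dominated_convergence)
    show "integrable (P x) (\<lambda>_. 2 * B + D * t)" by simp
    show "AE \<omega> in P x. (\<lambda>n. Y (T n \<omega>) \<omega>) \<longlonglongrightarrow> Y (stop C t \<omega>) \<omega>"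
      using lim by (intro AE_I2) simp
    show "AE \<omega> in P x. norm (Y (T n \<omega>) \<omega>) \<le> 2 * B + D * t" for n
    proof (intro AE_I2)
      fix \<omega> assume "\<omega> \<in> space (P x)"
      then have \<omega>: "\<omega> \<in> space M" by simp
      show "norm (Y (T n \<omega>) \<omega>) \<le> 2 * B + D * t"
        using TI(2)[OF TI(3)[OF \<omega>]] by (intro bound \<omega>) auto
    qed
  qed (use Ym os(1) in auto)
  then have EY: "(\<integral>\<omega>. Y (stop C t \<omega>) \<omega> \<partial>P x) = 0"
    by (simp add: os(2) LIMSEQ_const_iff)
  have Xm: "(\<lambda>\<omega>. f (X (stop C t \<omega>) \<omega>)) \<in> borel_measurable (P x)"
    using measurable_compose[OF stop_measurable(2)[OF t C] f_meas] by (simp add: measurable_cong_sets[OF sets_P refl])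
  have X0m: "(\<lambda>\<omega>. f (X 0 \<omega>)) \<in> borel_measurable (P x)"
    by measurable
  \<comment> \<open>This identity yields measurability of the time integral without joint
    measurability of \<open>X\<close>: the other terms are measurable, \<open>Y\<close> at the
    stopping time being a pointwise limit.\<close>
  have H: "H \<omega> = f (X (stop C t \<omega>) \<omega>) - f (X 0 \<omega>) - Y (stop C t \<omega>) \<omega>" for \<omega>
    by (simp add: H_def Y_def h_def)
  have int: "integrable (P x) (\<lambda>\<omega>. f (X (stop C t \<omega>) \<omega>))" "integrable (P x) (\<lambda>\<omega>. f (X 0 \<omega>))"
    "integrable (P x) (\<lambda>\<omega>. Y (stop C t \<omega>) \<omega>)"
  proof -
    show "integrable (P x) (\<lambda>\<omega>. f (X (stop C t \<omega>) \<omega>))" "integrable (P x) (\<lambda>\<omega>. f (X 0 \<omega>))"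
      using Xm X0m B by (auto intro!: integrable_const_bound[where B=B])
    show "integrable (P x) (\<lambda>\<omega>. Y (stop C t \<omega>) \<omega>)"
      by (rule integrable_const_bound[where B="2 * B + D * t", OF AE_I2 Ym]) (rule bound, use S in auto)
  qed
  show "integrable (P x) H"
    unfolding H[abs_def] by (intro Bochner_Integration.integrable_diff int)
  have "(\<integral>\<omega>. f (X 0 \<omega>) \<partial>P x) = (\<integral>\<omega>. f x \<partial>P x)"
    using X_start by (intro integral_cong_AE) (auto elim!: eventually_mono)
  then have "(\<integral>\<omega>. f (X 0 \<omega>) \<partial>P x) = f x" using prob_space by simp
  then show "(\<integral>\<omega>. f (X (stop C t \<omega>) \<omega>) \<partial>P x) = f x + (\<integral>\<omega>. H \<omega> \<partial>P x)"
    unfolding H[abs_def] using int EY by simp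
qed

text \<open>Markov's inequality for the test function centred at the starting point, where it
  vanishes: the generator bound contributes 6, and the lower bound 1/2 from distance
  \<open>R\<close> on doubles it.\<close>

lemma exit_tail:
  fixes x :: 'a
  assumes t: "0 < t" and C: "closed C" and R: "0 < R" "R < 1"
    and c: "0 \<le> c" "\<And>y. trunc_mass R y \<le> ennreal c"
  shows "measure (P x) {\<omega> \<in> space M. R \<le> norm (X (stop C t \<omega>) \<omega> - x)} \<le> 12 * c * t"
proof -
  interpret prob_space "P x" by (rule prob_P)
  define f where "f y = (norm (y - x))\<^sup>2 / (R\<^sup>2 + (norm (y - x))\<^sup>2)" for y
  have f: "f \<in> C2b" "\<bar>Lop K f y\<bar> \<le> 6 * c" for y
    using Lop_test_function[OF R c] unfolding f_def by auto
  note [measurable] = C2b_measurable[OF f(1)] and Lm = Lop_C2b_measurable[OF f(1)]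
  define S where "S = stop C t"
  have S: "0 \<le> S \<omega>" "S \<omega> \<le> t" for \<omega> using stop_bounds t by (auto simp: S_def)
  have XS [measurable]: "(\<lambda>\<omega>. X (S \<omega>) \<omega>) \<in> borel_measurable M"
    unfolding S_def by (rule stop_measurable[OF t C])
  define A where "A = {\<omega> \<in> space M. R \<le> norm (X (S \<omega>) \<omega> - x)}"
  have A [measurable]: "A \<in> sets M" unfolding A_def by measurable
  define H where "H \<omega> = (LINT s:{0..S \<omega>}|lborel. Lop K f (X s \<omega>))" for \<omega>
  have H: "integrable (P x) H" "(\<integral>\<omega>. f (X (S \<omega>) \<omega>) \<partial>P x) = f x + (\<integral>\<omega>. H \<omega> \<partial>P x)"
    using dynkin[OF f(1) t C] unfolding H_def[abs_def] S_def by auto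
  have H_le: "H \<omega> \<le> 6 * c * t" if "\<omega> \<in> space M" for \<omega>
  proof -
    have "\<bar>H \<omega>\<bar> \<le> 6 * c * S \<omega>"
      using path_integral(1)[OF that Lm f(2)] path_integral(2)[OF that Lm f(2), of 0 "S \<omega>"] S(1)
      by (simp add: H_def)
    also have "\<dots> \<le> 6 * c * t" using S c(1) by (intro mult_left_mono) auto
    finally show ?thesis by simp
  qed
  have fb: "0 \<le> f y" "f y \<le> 1" for y
  proof -
    have "0 < R\<^sup>2 + (norm (y - x))\<^sup>2" using R by (intro add_pos_nonneg) auto
    then show "0 \<le> f y" "f y \<le> 1" by (auto simp: f_def)
  qed
  have "measure (P x) A / 2 = (\<integral>\<omega>. indicator A \<omega> * (1/2 :: real) \<partial>P x)" by simp
  also have "\<dots> \<le> (\<integral>\<omega>. f (X (S \<omega>) \<omega>) \<partial>P x)"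
  proof (rule integral_mono_AE)
    show "integrable (P x) (\<lambda>\<omega>. indicator A \<omega> * (1/2 :: real))"
      by (intro integrable_mult_left integrable_real_indicator) (auto simp: less_top[symmetric])
    show "integrable (P x) (\<lambda>\<omega>. f (X (S \<omega>) \<omega>))"
      using fb by (intro integrable_const_bound[where B=1]) auto
    have "1/2 \<le> f y" if "R \<le> norm (y - x)" for y
    proof -
      have "R\<^sup>2 \<le> (norm (y - x))\<^sup>2" using that R by (intro power_mono) auto
      moreover have "0 < R\<^sup>2 + (norm (y - x))\<^sup>2" using R by (intro add_pos_nonneg) auto
      ultimately show ?thesis by (simp add: f_def pos_le_divide_eq)
    qed
    then show "AE \<omega> in P x. indicator A \<omega> * (1/2 :: real) \<le> f (X (S \<omega>) \<omega>)"
      using fb by (intro AE_I2) (auto simp: A_def indicator_def)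
  qed
  also have "\<dots> = (\<integral>\<omega>. H \<omega> \<partial>P x)" using H(2) by (simp add: f_def[of x])
  also have "\<dots> \<le> 6 * c * t"
    using H_le by (intro integral_le_const H(1) AE_I2) auto
  finally show ?thesis by (simp add: A_def S_def)
qed

text \<open>With probability at least 1/2 the stopped position is within \<open>\<rho> / 2\<close>
  of \<open>x\<close>, hence in the open ball about \<open>z\<close>; by \<open>at_stop\<close> this
  is possible only if the cap \<open>t\<close> was reached. The 24 is twice the 12 of
  \<open>exit_tail\<close>.\<close>

lemma expected_stop_ge:
  fixes x z :: 'a
  assumes t: "0 < t" and \<rho>: "0 < \<rho>" "norm (x - z) \<le> \<rho> / 2" "\<rho> < 1"
    and c: "0 \<le> c" "\<And>y. trunc_mass (\<rho>/2) y \<le> ennreal c"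
    and small: "24 * c * t \<le> 1"
  shows "t / 2 \<le> (\<integral>\<omega>. stop (cball z \<rho>) t \<omega> \<partial>P x)"
proof -
  interpret prob_space "P x" by (rule prob_P)
  define S where "S = stop (cball z \<rho>) t"
  have S: "0 \<le> S \<omega>" "S \<omega> \<le> t" for \<omega> using stop_bounds t by (auto simp: S_def)
  have XS [measurable]: "(\<lambda>\<omega>. X (S \<omega>) \<omega>) \<in> borel_measurable M" "S \<in> borel_measurable M"
    unfolding S_def by (rule stop_measurable[OF t closed_cball])+
  define A where "A = {\<omega> \<in> space M. \<rho> / 2 \<le> norm (X (S \<omega>) \<omega> - x)}"
  have A [measurable]: "A \<in> sets M" unfolding A_def by measurable
  have "measure (P x) A \<le> 12 * c * t"
    using exit_tail[where C="cball z \<rho>" and R="\<rho> / 2" and x=x, OF t closed_cball _ _ c] \<rho> unfolding A_def S_def by simp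
  then have PA: "measure (P x) A \<le> 1/2" using small by simp
  have out: "S \<omega> = t" if "\<omega> \<in> space M" "\<omega> \<notin> A" for \<omega>
  proof (rule ccontr)
    assume "S \<omega> \<noteq> t"
    then have "X (S \<omega>) \<omega> \<notin> ball z \<rho>"
      using S(2)[of \<omega>] at_stop[OF that(1), of t "cball z \<rho>" "ball z \<rho>"] t by (auto simp: S_def)
    then have "\<rho> \<le> norm (X (S \<omega>) \<omega> - z)" by (simp add: dist_norm norm_minus_commute)
    also have "\<dots> \<le> norm (X (S \<omega>) \<omega> - x) + norm (x - z)"
      using norm_triangle_ineq[of "X (S \<omega>) \<omega> - x" "x - z"] by simp
    finally show False using that \<rho>(2) by (auto simp: A_def)
  qed
  have intA: "integrable (P x) (\<lambda>\<omega>. indicator A \<omega> * t)"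
    by (intro integrable_mult_left integrable_real_indicator) (auto simp: less_top[symmetric])
  have "t * (1 / 2) \<le> t * (1 - measure (P x) A)" using PA t by (intro mult_left_mono) auto
  also have "\<dots> = t - measure (P x) A * t" by (simp add: right_diff_distrib mult.commute)
  also have "\<dots> = (\<integral>\<omega>. t - indicator A \<omega> * t \<partial>P x)"
    by (subst Bochner_Integration.integral_diff[OF integrable_const intA]) (use prob_space in simp)
  also have "\<dots> \<le> (\<integral>\<omega>. S \<omega> \<partial>P x)"
  proof (rule integral_mono_AE)
    show "integrable (P x) (\<lambda>\<omega>. t - indicator A \<omega> * t)"
      by (intro Bochner_Integration.integrable_diff intA) simp
    show "integrable (P x) S"
      using S by (intro integrable_const_bound[where B=t]) auto
    show "AE \<omega> in P x. t - indicator A \<omega> * t \<le> S \<omega>"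
      using out S by (intro AE_I2) (auto simp: indicator_def)
  qed
  finally show ?thesis by (simp add: S_def)
qed

end

section \<open>Lower bounds for hitting probabilities\<close>

lemma nn_integral_lborel_translate:
  fixes f :: "'a::euclidean_space \<Rightarrow> ennreal"
  assumes [measurable]: "f \<in> borel_measurable borel"
  shows "(\<integral>\<^sup>+ w. f (w - z) \<partial>lborel) = (\<integral>\<^sup>+ w. f w \<partial>lborel)"
  using nn_integral_distr[of "(+) (- z)" lborel borel f] by (simp add: lborel_distr_plus)

context regular_kernel
begin

lemma nn_integral_J_annulus:
  assumes "0 < r" "r \<le> R" "R < 1"
  shows "(\<integral>\<^sup>+ w. ennreal (indicator {r<..<R} (norm (w - z)) * J (w - z)) \<partial>lborel) = ennreal (\<omega> * (L r - L R))"
proof -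
  have "(\<integral>\<^sup>+ w. ennreal (indicator {r<..<R} (norm (w - z)) * J (w - z)) \<partial>lborel) =
     (\<integral>\<^sup>+ h. ennreal (indicator {r<..<R} (norm (h::'a)) * J h) \<partial>lborel)"
    by (rule nn_integral_lborel_translate[of "\<lambda>h. ennreal (indicator {r<..<R} (norm h) * J h)"]) measurable
  also have "\<dots> = ennreal \<omega> * (\<integral>\<^sup>+ s. ennreal (indicator {r<..<R} s * (lz s / s)) \<partial>lborel)"
    by (rule nn_integral_J) auto
  also have "(\<integral>\<^sup>+ s. ennreal (indicator {r<..<R} s * (lz s / s)) \<partial>lborel) =
      (\<integral>\<^sup>+ s. ennreal (indicator {r..<R} s * (lz s / s)) \<partial>lborel)"
  proof (rule nn_integral_cong_AE)
    show "AE s in lborel. ennreal (indicator {r<..<R} s * (lz s / s)) = ennreal (indicator {r..<R} s * (lz s / s))"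
      using AE_lborel_singleton[of r] by eventually_elim (auto simp: indicator_def)
  qed
  also have "\<dots> = ennreal (L r - L R)"
    unfolding L_diff[OF assms] using assms
    by (intro nn_integral_eq_integral integrable_lz_div[of r]) (auto simp: indicator_def)
  also have "ennreal \<omega> * \<dots> = ennreal (\<omega> * (L r - L R))"
    using \<omega>_pos by (simp add: ennreal_mult')
  finally show ?thesis .
qed

abbreviation J_mass :: "'a \<Rightarrow> 'a set \<Rightarrow> ennreal" where
  "J_mass z A \<equiv> \<integral>\<^sup>+ w. ennreal (indicator A w * J (w - z)) \<partial>lborel"

text \<open>The distance from \<open>y\<close> to \<open>w\<close> lies between 1/2 and 3/2 of the
  distance from \<open>z\<close> to \<open>w\<close>, so \<open>lz\<close> changes by at most the
  factor \<open>C\<close> and the power of the distance by at most \<open>2 ^ DIM('a)\<close>. One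
  density centred at \<open>z\<close> thus bounds the jump intensity from every position in a small
  ball.\<close>

lemma K_ge_J_shifted:
  assumes C: "1 \<le> C" and scale: "\<And>s c. 0 < s \<Longrightarrow> s < 4 * s0 \<Longrightarrow> 1/4 \<le> c \<Longrightarrow> c \<le> 4 \<Longrightarrow> lz (c * s) \<le> C * lz s"
    and s0: "s0 \<le> 1/8"
    and w: "0 < norm (w - z)" "norm (w - z) < s0" and y: "norm (y - z) \<le> norm (w - z) / 2"
  shows "1 / (\<kappa> * C * 2 ^ DIM('a)) * J (w - z) \<le> K y (w - y)"
proof -
  define a where "a = norm (w - z)"
  define b where "b = norm (w - y)"
  have "a \<le> b + norm (y - z)" "b \<le> a + norm (y - z)"
    using norm_triangle_ineq[of "w - y" "y - z"] norm_triangle_ineq4[of "w - z" "y - z"]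
    by (auto simp: a_def b_def)
  then have ab: "a / 2 \<le> b" "b \<le> 3 / 2 * a" using y by (auto simp: a_def)
  have a: "0 < a" "a < s0" using w by (auto simp: a_def)
  have b: "0 < b" "b < 1" "b < 4 * s0" using ab a s0 by auto
  have "lz ((a / b) * b) \<le> C * lz b"
    using ab a b by (intro scale) (auto simp: field_simps)
  then have la: "lz a \<le> C * lz b" using b by simp
  have "b ^ DIM('a) \<le> (2 * a) ^ DIM('a)" using ab a b by (intro power_mono) auto
  then have pw: "b ^ DIM('a) \<le> 2 ^ DIM('a) * a ^ DIM('a)" by (simp add: power_mult_distrib)
  have "J (w - z) / (C * 2 ^ DIM('a)) = (lz a / C) / (2 ^ DIM('a) * a ^ DIM('a))"
    by (simp add: J_def a_def)
  also have "\<dots> \<le> lz b / b ^ DIM('a)"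
    using la C pw b a by (intro frac_le) (auto simp: field_simps)
  also have "\<dots> = J (w - y)" by (simp add: J_def b_def)
  finally have "J (w - z) / (C * 2 ^ DIM('a)) / \<kappa> \<le> J (w - y) / \<kappa>"
    using kappa(1) by (intro divide_right_mono) auto
  also have "\<dots> \<le> K y (w - y)"
    using b by (intro K_bounds) (auto simp: b_def)
  finally show ?thesis by (simp add: mult_ac)
qed

end

context jump_process
begin

text \<open>For a nonnegative test function supported in the annulus, Dynkin's formula bounds its
  mean from below by the expected stopping time times its integral against \<open>j\<close>, because
  the path stays in the small ball until it is stopped. Dominated convergence leads to balls, and
  \<open>measure_le_on_open\<close> to Borel sets.\<close>

lemma hitting_lower_bound:
  fixes x z :: 'a
  assumes C: "1 \<le> C" and scale: "\<And>s c. 0 < s \<Longrightarrow> s < 4 * s0 \<Longrightarrow> 1/4 \<le> c \<Longrightarrow> c \<le> 4 \<Longrightarrow> lz (c * s) \<le> C * lz s"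
    and s0: "s0 \<le> 1/8"
    and t: "0 < t" and r: "0 < r" "r < R" "R \<le> s0" "\<rho> \<le> r / 2" and x: "norm (x - z) \<le> r"
    and A: "A \<in> sets borel" "A \<subseteq> {w. norm (w - z) \<in> {r<..<R}}"
    and v: "0 \<le> v" "ennreal v \<le> J_mass z A"
  shows "(\<integral>\<omega>. stop (cball z \<rho>) t \<omega> \<partial>P x) * (1 / (\<kappa> * C * 2 ^ DIM('a))) * v
     \<le> measure (P x) {\<omega> \<in> space M. X (stop (cball z \<rho>) t \<omega>) \<omega> \<in> A}"
proof -
  interpret prob_space "P x" by (rule prob_P)
  define S where "S = stop (cball z \<rho>) t"
  have S: "0 \<le> S \<omega>" "S \<omega> \<le> t" for \<omega> using stop_bounds t by (auto simp: S_def)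
  have XS [measurable]: "(\<lambda>\<omega>. X (S \<omega>) \<omega>) \<in> borel_measurable M" "S \<in> borel_measurable M"
    unfolding S_def by (rule stop_measurable[OF t closed_cball])+
  have Sint: "integrable (P x) S"
    using S by (intro integrable_const_bound[where B=t]) auto
  define e where "e = (\<integral>\<omega>. S \<omega> \<partial>P x)"
  have e0: "0 \<le> e" unfolding e_def using S by (intro integral_nonneg_AE) auto
  define q where "q = 1 / (\<kappa> * C * 2 ^ DIM('a))"
  have q0: "0 < q" using kappa(1) C by (simp add: q_def)
  define Ann where "Ann = {w. norm (w - z) \<in> {r<..<R}}"
  have oO: "open Ann"
  proof -
    have "Ann = (\<lambda>w. norm (w - z)) -` {r<..<R}" by (auto simp: Ann_def)
    then show ?thesis by (simp add: open_vimage continuous_intros)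
  qed
  have [measurable]: "Ann \<in> sets borel" using oO by simp
  define j where "j w = q * (indicator Ann w * J (w - z))" for w
  have j_meas [measurable]: "j \<in> borel_measurable borel" unfolding j_def by measurable
  have j0: "0 \<le> j w" for w using q0 by (simp add: j_def indicator_def)
  have j_int: "integrable lborel j"
  proof -
    have "(\<integral>\<^sup>+ w. ennreal (indicator Ann w * J (w - z)) \<partial>lborel) = ennreal (\<omega> * (L r - L R))"
      using nn_integral_J_annulus[of r R z] r s0 by (simp add: Ann_def indicator_def)
    then have "integrable lborel (\<lambda>w. indicator Ann w * J (w - z))"
      by (intro integrableI_nonneg) auto
    then show ?thesis unfolding j_def by (rule integrable_mult_right)
  qed
  \<comment> \<open>Since \<open>\<rho> \<le> r / 2\<close>, every point of the closed ball is at
    most half as far from \<open>z\<close> as any point of the annulus.\<close>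
  have jK: "j w \<le> K y (w - y)" if "w \<in> Ann" "y \<in> cball z \<rho>" for w y
  proof -
    have "norm (y - z) \<le> norm (w - z) / 2"
      using that r by (auto simp: Ann_def dist_norm norm_minus_commute)
    then have "q * J (w - z) \<le> K y (w - y)"
      unfolding q_def using that r by (intro K_ge_J_shifted[OF C scale s0]) (auto simp: Ann_def)
    then show ?thesis using that by (simp add: j_def)
  qed
  define Q where "Q = distr (P x) borel (\<lambda>\<omega>. X (S \<omega>) \<omega>)"
  define \<nu> where "\<nu> = density lborel (\<lambda>w. ennreal (e * j w))"
  have Q_eq: "emeasure Q B = ennreal (measure (P x) {\<omega> \<in> space M. X (S \<omega>) \<omega> \<in> B})" if "B \<in> sets borel" for B
    unfolding Q_def using that
    by (subst emeasure_distr) (auto simp: emeasure_eq_measure vimage_def Int_def conj_commute)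
  have ball_le: "emeasure \<nu> (ball c s) \<le> emeasure Q (ball c s)" if s: "0 < s" "ball c s \<subseteq> Ann" for c s
  proof -
    obtain \<phi> where \<phi>: "\<And>n. \<phi> n \<in> C2b" "\<And>n y. 0 \<le> \<phi> n y" "\<And>n y. \<phi> n y \<le> 1"
      "\<And>n y. y \<notin> ball c s \<Longrightarrow> \<phi> n y = 0" "\<And>y. y \<in> ball c s \<Longrightarrow> (\<lambda>n. \<phi> n y) \<longlonglongrightarrow> 1"
      by (rule C2b_ball_approx[OF s(1), of c]) (rule that; assumption)
    note \<phi>_meas [measurable] = C2b_measurable[OF \<phi>(1)]
    have lim: "(\<lambda>n. \<phi> n y) \<longlonglongrightarrow> indicator (ball c s) y" for y
      using \<phi>(4,5) by (cases "y \<in> ball c s") auto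
    have step: "e * (\<integral>w. \<phi> n w * j w \<partial>lborel) \<le> (\<integral>\<omega>. \<phi> n (X (S \<omega>) \<omega>) \<partial>P x)" for n
    proof -
      define k where "k = (\<integral>w. \<phi> n w * j w \<partial>lborel)"
      note Lm = Lop_C2b_measurable[OF \<phi>(1)]
      obtain D where D: "\<And>y. \<bar>Lop K (\<phi> n) y\<bar> \<le> D"
        using Lop_C2b_bounded[OF \<phi>(1)] by auto
      define H where "H \<omega> = (LINT s:{0..S \<omega>}|lborel. Lop K (\<phi> n) (X s \<omega>))" for \<omega>
      have H: "integrable (P x) H" "(\<integral>\<omega>. \<phi> n (X (S \<omega>) \<omega>) \<partial>P x) = \<phi> n x + (\<integral>\<omega>. H \<omega> \<partial>P x)"
        using dynkin[OF \<phi>(1) t closed_cball] unfolding H_def[abs_def] S_def by auto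
      have k_le: "k \<le> Lop K (\<phi> n) y" if y: "y \<in> cball z \<rho>" for y
        unfolding k_def
      proof (rule Lop_ge[OF \<phi>(1,2), where U="ball z r"])
        show "y \<in> ball z r" using y r by auto
        show "\<phi> n w = 0" if "w \<in> ball z r" for w
        proof -
          have "w \<notin> Ann" using that by (auto simp: Ann_def dist_norm norm_minus_commute)
          then show ?thesis using s(2) by (intro \<phi>(4)) auto
        qed
        show "j w \<le> K y (w - y)" if w: "\<phi> n w \<noteq> 0" for w
        proof (rule jK)
          show "w \<in> Ann" using \<phi>(4)[of w n] w s(2) by blast
        qed (rule y)
      qed (use j0 in auto)
      have "k * S \<omega> \<le> H \<omega>" if \<omega>: "\<omega> \<in> space M" for \<omega>
        unfolding H_def
      proof (rule path_integral(3)[OF \<omega> Lm D S(1)])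
        show "k \<le> Lop K (\<phi> n) (X r' \<omega>)" if "0 < r'" "r' < S \<omega>" for r'
          using that t by (intro k_le before_stop[of r' _ t]) (auto simp: S_def)
      qed
      then have "(\<integral>\<omega>. k * S \<omega> \<partial>P x) \<le> (\<integral>\<omega>. H \<omega> \<partial>P x)"
        using Sint H(1) by (intro integral_mono_AE) auto
      then show ?thesis unfolding k_def[symmetric] using H(2) \<phi>(2)[of n x] by (simp add: e_def mult.commute)
    qed
    have [measurable]: "ball c s \<in> sets borel" by simp
    have lim1: "(\<lambda>n. \<integral>w. \<phi> n w * j w \<partial>lborel) \<longlonglongrightarrow> (\<integral>w. indicator (ball c s) w * j w \<partial>lborel)"
    proof (rule integral_dominated_convergence[OF _ _ j_int])
      show "AE w in lborel. (\<lambda>n. \<phi> n w * j w) \<longlonglongrightarrow> indicator (ball c s) w * j w"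
        by (intro AE_I2 tendsto_mult lim tendsto_const)
      show "AE w in lborel. norm (\<phi> n w * j w) \<le> j w" for n
        using \<phi>(2,3) j0 by (intro AE_I2) (simp add: abs_mult mult_left_le_one_le)
    qed measurable
    have lim2: "(\<lambda>n. \<integral>\<omega>. \<phi> n (X (S \<omega>) \<omega>) \<partial>P x) \<longlonglongrightarrow> (\<integral>\<omega>. indicator (ball c s) (X (S \<omega>) \<omega>) \<partial>P x)"
    proof (rule integral_dominated_convergence[where w="\<lambda>_. 1"])
      show "AE \<omega> in P x. (\<lambda>n. \<phi> n (X (S \<omega>) \<omega>)) \<longlonglongrightarrow> indicator (ball c s) (X (S \<omega>) \<omega>)"
        by (intro AE_I2 lim)
      show "AE \<omega> in P x. norm (\<phi> n (X (S \<omega>) \<omega>)) \<le> 1" for n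
        using \<phi>(2,3) by (intro AE_I2) simp
      have "ball c s \<in> sets borel" by simp
      then show "(\<lambda>\<omega>. indicator (ball c s) (X (S \<omega>) \<omega>) :: real) \<in> borel_measurable (P x)"
        using measurable_compose[OF XS(1) borel_measurable_indicator, of "ball c s"]
        by (simp add: measurable_cong_sets[OF sets_P refl])
      show "(\<lambda>\<omega>. \<phi> n (X (S \<omega>) \<omega>)) \<in> borel_measurable (P x)" for n
        using measurable_compose[OF XS(1) \<phi>_meas[of n]] by (simp add: measurable_cong_sets[OF sets_P refl])
    qed simp
    have "e * (\<integral>w. indicator (ball c s) w * j w \<partial>lborel) \<le> (\<integral>\<omega>. indicator (ball c s) (X (S \<omega>) \<omega>) \<partial>P x)"
      by (rule LIMSEQ_le[OF tendsto_mult[OF tendsto_const lim1] lim2]) (use step in auto)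
    also have "\<dots> = (\<integral>\<omega>. indicator {\<omega> \<in> space M. X (S \<omega>) \<omega> \<in> ball c s} \<omega> \<partial>P x)"
      by (intro Bochner_Integration.integral_cong) (auto simp: indicator_def)
    also have "\<dots> = measure (P x) {\<omega> \<in> space M. X (S \<omega>) \<omega> \<in> ball c s}"
      by (simp add: Int_absorb2)
    finally have le: "e * (\<integral>w. indicator (ball c s) w * j w \<partial>lborel) \<le> measure (P x) {\<omega> \<in> space M. X (S \<omega>) \<omega> \<in> ball c s}" .
    have "emeasure \<nu> (ball c s) = (\<integral>\<^sup>+ w. ennreal (e * (indicator (ball c s) w * j w)) \<partial>lborel)"
      unfolding \<nu>_def by (subst emeasure_density) (auto intro!: nn_integral_cong simp: indicator_def)
    also have "\<dots> = ennreal (\<integral>w. e * (indicator (ball c s) w * j w) \<partial>lborel)"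
    proof (rule nn_integral_eq_integral)
      show "integrable lborel (\<lambda>w. e * (indicator (ball c s) w * j w))"
        using integrable_mult_indicator[OF _ j_int, of "ball c s"] by (intro integrable_mult_right) simp
    qed (use e0 j0 in \<open>auto simp: indicator_def\<close>)
    also have "\<dots> = ennreal (e * (\<integral>w. indicator (ball c s) w * j w \<partial>lborel))" by simp
    finally show ?thesis using le by (simp add: Q_eq ennreal_leI)
  qed
  have "emeasure \<nu> A \<le> emeasure Q A"
  proof (rule measure_le_on_open[where D=Ann])
    show "emeasure Q (space Q) \<noteq> \<infinity>"
      using Q_eq[of UNIV] by (simp add: Q_def)
    show "N \<in> null_sets \<nu>" if "N \<in> null_sets lborel" for N
      unfolding \<nu>_def using that
      by (subst null_sets_density_iff) (auto intro: AE_I' dest: null_setsD2)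
    show "A \<subseteq> Ann" using A(2) by (simp add: Ann_def)
  qed (use A oO ball_le in \<open>auto simp: Q_def \<nu>_def\<close>)
  also have "emeasure \<nu> A = (\<integral>\<^sup>+ w. ennreal (e * q) * ennreal (indicator A w * J (w - z)) \<partial>lborel)"
    unfolding \<nu>_def using A e0 q0
    by (subst emeasure_density)
       (auto intro!: nn_integral_cong simp: indicator_def j_def Ann_def ennreal_mult'[symmetric] mult.assoc)
  also have "\<dots> = ennreal (e * q) * J_mass z A"
  proof (intro nn_integral_cmult)
    note [measurable] = A(1)
    show "(\<lambda>w. ennreal (indicator A w * J (w - z))) \<in> borel_measurable lborel" by measurable
  qed
  finally have "ennreal (e * q) * J_mass z A \<le> emeasure Q A" .
  moreover have "ennreal (e * q) * ennreal v \<le> ennreal (e * q) * J_mass z A"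
    by (intro mult_left_mono v) simp
  ultimately have "ennreal (e * q * v) \<le> emeasure Q A"
    using e0 q0 v(1) by (simp add: ennreal_mult' order_trans)
  then have "ennreal (e * q * v) \<le> ennreal (measure (P x) {\<omega> \<in> space M. X (S \<omega>) \<omega> \<in> A})"
    using Q_eq[OF A(1)] by simp
  then show ?thesis by (simp add: e_def q_def S_def)
qed

text \<open>Exit times of open balls need not be measurable; but the expected exit time of the closed
  ball is monotone in the radius, and at each of its continuity points both exit times agree.\<close>

lemma exit_open_eq_closed:
  fixes x z :: 'a
  assumes t: "0 < t" and ab: "a < b"
  obtains \<rho> where "a < \<rho>" "\<rho> < b" "AE \<omega> in P x. stop (ball z \<rho>) t \<omega> = stop (cball z \<rho>) t \<omega>"
proof -
  interpret prob_space "P x" by (rule prob_P)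
  define S where "S \<rho> = stop (cball z \<rho>) t" for \<rho>
  have S: "0 \<le> S \<rho> \<omega>" "S \<rho> \<omega> \<le> t" for \<rho> \<omega> using stop_bounds t by (auto simp: S_def)
  have S_meas [measurable]: "S \<rho> \<in> borel_measurable M" for \<rho>
    unfolding S_def by (rule stop_measurable[OF t closed_cball])
  have Sint: "integrable (P x) (S \<rho>)" for \<rho>
    using S by (intro integrable_const_bound[where B=t]) auto
  have S_mono: "S \<rho> \<omega> \<le> S \<rho>' \<omega>" if "\<rho> \<le> \<rho>'" for \<rho> \<rho>' \<omega>
    unfolding S_def using t that by (intro stop_mono) auto
  define g where "g \<rho> = (\<integral>\<omega>. S \<rho> \<omega> \<partial>P x)" for \<rho>
  have "mono g"
    unfolding g_def by (intro monoI integral_mono Sint S_mono)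
  then have "countable {\<rho>. \<not> isCont g \<rho>}" by (rule mono_ctble_discont)
  moreover have "uncountable {a<..<b}" using ab by (simp add: uncountable_open_interval)
  ultimately have "\<not> {a<..<b} \<subseteq> {\<rho>. \<not> isCont g \<rho>}" using countable_subset by blast
  then obtain \<rho> where \<rho>: "a < \<rho>" "\<rho> < b" "isCont g \<rho>" by auto
  define r where "r k = \<rho> - 1 / real (Suc k)" for k
  have "(\<lambda>k. \<rho> - 1 / real (Suc k)) \<longlonglongrightarrow> \<rho> - 0"
    by (intro tendsto_diff tendsto_const LIMSEQ_Suc[OF lim_1_over_n])
  then have r_lim: "r \<longlonglongrightarrow> \<rho>" by (simp add: r_def[abs_def])
  have "(\<lambda>k. g (r k)) \<longlonglongrightarrow> g \<rho>"
    using isCont_tendsto_compose[OF \<rho>(3) r_lim] .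
  then have "(\<lambda>k. g \<rho> - g (r k)) \<longlonglongrightarrow> g \<rho> - g \<rho>"
    by (intro tendsto_diff tendsto_const)
  from tendsto_ennrealI[OF this] have lim0: "(\<lambda>k. ennreal (g \<rho> - g (r k))) \<longlonglongrightarrow> 0"
    by simp
  have Sr: "S (r k) \<omega> \<le> S \<rho> \<omega>" for k \<omega> by (rule S_mono) (simp add: r_def)
  \<comment> \<open>The stopping time of the open ball may fail to be measurable; this infimum is a
    measurable function dominating the difference of the two times, since
    \<open>cball z (r k)\<close> lies inside \<open>ball z \<rho>\<close> for every
    \<open>k\<close>.\<close>
  define D where "D \<omega> = (INF k. ennreal (S \<rho> \<omega> - S (r k) \<omega>))" for \<omega>
  have D_meas [measurable]: "D \<in> borel_measurable (P x)"
    unfolding D_def by measurable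
  have "(\<integral>\<^sup>+ \<omega>. D \<omega> \<partial>P x) \<le> ennreal (g \<rho> - g (r k))" for k
  proof -
    have "(\<integral>\<^sup>+ \<omega>. D \<omega> \<partial>P x) \<le> (\<integral>\<^sup>+ \<omega>. ennreal (S \<rho> \<omega> - S (r k) \<omega>) \<partial>P x)"
      unfolding D_def by (intro nn_integral_mono INF_lower) simp
    also have "\<dots> = ennreal (\<integral>\<omega>. S \<rho> \<omega> - S (r k) \<omega> \<partial>P x)"
      using Sr by (intro nn_integral_eq_integral Bochner_Integration.integrable_diff Sint) auto
    also have "(\<integral>\<omega>. S \<rho> \<omega> - S (r k) \<omega> \<partial>P x) = g \<rho> - g (r k)"
      unfolding g_def by (intro Bochner_Integration.integral_diff Sint)
    finally show ?thesis .
  qed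
  then have "(\<integral>\<^sup>+ \<omega>. D \<omega> \<partial>P x) \<le> 0"
    by (intro LIMSEQ_le_const[OF lim0]) auto
  then have "AE \<omega> in P x. D \<omega> = 0"
    using nn_integral_0_iff_AE[OF D_meas] by simp
  then have "AE \<omega> in P x. stop (ball z \<rho>) t \<omega> = stop (cball z \<rho>) t \<omega>"
  proof eventually_elim
    case (elim \<omega>)
    have le: "stop (ball z \<rho>) t \<omega> \<le> S \<rho> \<omega>"
      unfolding S_def using t by (intro stop_mono) auto
    have "S (r k) \<omega> \<le> stop (ball z \<rho>) t \<omega>" for k
    proof -
      have "r k < \<rho>" by (simp add: r_def)
      then have "cball z (r k) \<subseteq> ball z \<rho>" by auto
      then show ?thesis unfolding S_def using t by (intro stop_mono) auto
    qed
    then have "ennreal (S \<rho> \<omega> - stop (ball z \<rho>) t \<omega>) \<le> D \<omega>"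
      unfolding D_def by (intro INF_greatest ennreal_leI) simp
    then have "S \<rho> \<omega> - stop (ball z \<rho>) t \<omega> \<le> 0" using elim by (simp add: ennreal_eq_0_iff)
    then show ?case using le by (simp add: S_def)
  qed
  with \<rho> show ?thesis by (intro that)
qed

text \<open>A harmonic function is not assumed to be measurable. Harmonicity in the empty set, whose exit
  time is \<open>0\<close>, makes \<open>u (X 0 _)\<close> measurable, and \<open>u x\<close> is its expectation under the kernel \<open>P x\<close>.\<close>

lemma harmonic_measurable:
  assumes "harmonic_in P F X u D"
  shows "u \<in> borel_measurable borel"
proof -
  have "stop {} t \<omega> = 0" if "0 \<le> t" for t \<omega>
  proof -
    have "\<not> stop {} t \<omega> > 0"
    proof
      assume pos: "stop {} t \<omega> > 0"
      show False
        using before_stop[of "stop {} t \<omega> / 2" "{}" t \<omega>] pos that by simp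
    qed
    then show ?thesis using stop_bounds(1)[OF that, of "{}" \<omega>] by simp
  qed
  moreover have mart: "is_martingale (P x) F (\<lambda>t \<omega>. u (X (stop {} t \<omega>) \<omega>))" for x
    using assms unfolding harmonic_in_def stop_def by simp
  ultimately have "(\<lambda>\<omega>. u (X 0 \<omega>)) \<in> borel_measurable (F 0)"
    using mart[of undefined] unfolding is_martingale_def by (auto dest: spec[of _ 0])
  then have m: "(\<lambda>\<omega>. u (X 0 \<omega>)) \<in> borel_measurable M"
    by (rule measurable_from_subalg[rotated]) (use F_filt(2) in \<open>auto simp: subalgebra_def space_F\<close>)
  have "P \<in> measurable borel (subprob_algebra M)"
    using P_kernel prob_P prob_space_imp_subprob_space
    by (intro measurable_subprob_algebra) auto
  then have "(\<lambda>x. \<integral>\<omega>. u (X 0 \<omega>) \<partial>P x) \<in> borel_measurable borel"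
    by (rule measurable_compose[OF _ integral_measurable_subprob_algebra[OF m]])
  moreover have "(\<integral>\<omega>. u (X 0 \<omega>) \<partial>P x) = u x" for x
  proof -
    interpret prob_space "P x" by (rule prob_P)
    have "(\<integral>\<omega>. u (X 0 \<omega>) \<partial>P x) = (\<integral>\<omega>. u x \<partial>P x)"
      using X_start m by (intro integral_cong_AE) (auto elim!: eventually_mono simp: measurable_cong_sets[OF sets_P refl])
    then show ?thesis using prob_space by simp
  qed
  ultimately show ?thesis by simp
qed

text \<open>Harmonicity speaks of open sets, the estimates of closed balls; a radius at which both
  exit times agree reconciles them. That radius depends on \<open>x\<close>, so it is used through
  its bounds \<open>a\<close> and \<open>b\<close> only.\<close>

lemma harmonic_mean_value:
  fixes x z :: 'a
  assumes u: "harmonic_in P F X u D" and t: "0 < t" and ab: "a < b" "cball z b \<subseteq> D"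
  obtains \<rho> where "a < \<rho>" "\<rho> < b" "u x = (\<integral>\<omega>. u (X (stop (cball z \<rho>) t \<omega>) \<omega>) \<partial>P x)"
proof -
  interpret prob_space "P x" by (rule prob_P)
  obtain \<rho> where \<rho>: "a < \<rho>" "\<rho> < b" "AE \<omega> in P x. stop (ball z \<rho>) t \<omega> = stop (cball z \<rho>) t \<omega>"
    by (rule exit_open_eq_closed[OF t ab(1), where x=x and z=z])
  have u_meas: "u \<in> borel_measurable borel" by (rule harmonic_measurable[OF u])
  have "closure (ball z \<rho>) \<subseteq> cball z b" using \<rho>(2) by (intro closure_minimal) auto
  then have mart: "is_martingale (P x) F (\<lambda>t \<omega>. u (X (stop (ball z \<rho>) t \<omega>) \<omega>))"
    using u ab(2) unfolding harmonic_in_def stop_def by auto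
  have filt: "filtration (space (P x)) F" by (simp add: filtration_axioms)
  have S0: "stop (ball z \<rho>) 0 \<omega> = 0" for \<omega>
    using stop_bounds[of 0 "ball z \<rho>" \<omega>] by simp
  have m: "(\<lambda>\<omega>. u (X 0 \<omega>)) \<in> borel_measurable (P x)"
    using measurable_compose[OF X0_measurable u_meas] by (simp add: measurable_cong_sets[OF sets_P refl])
  have m1: "(\<lambda>\<omega>. u (X (stop (ball z \<rho>) t \<omega>) \<omega>)) \<in> borel_measurable (P x)"
    using mart t unfolding is_martingale_def by (simp add: borel_measurable_integrable)
  have m2: "(\<lambda>\<omega>. u (X (stop (cball z \<rho>) t \<omega>) \<omega>)) \<in> borel_measurable (P x)"
    using measurable_compose[OF stop_measurable(2)[OF t closed_cball] u_meas] by (simp add: measurable_cong_sets[OF sets_P refl])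
  have "u x = (\<integral>\<omega>. u x \<partial>P x)" using prob_space by simp
  also have "\<dots> = (\<integral>\<omega>. u (X 0 \<omega>) \<partial>P x)"
    using X_start m by (intro integral_cong_AE) (auto elim!: eventually_mono)
  also have "\<dots> = (\<integral>\<omega>. u (X (stop (ball z \<rho>) t \<omega>) \<omega>) \<partial>P x)"
    using is_martingale_expectation[OF prob_P mart filt, of 0 t] t by (simp add: S0)
  also have "\<dots> = (\<integral>\<omega>. u (X (stop (cball z \<rho>) t \<omega>) \<omega>) \<partial>P x)"
    using \<rho>(3) m1 m2 by (intro integral_cong_AE) (auto elim!: eventually_mono)
  finally show ?thesis using \<rho>(1,2) by (intro that)
qed

end

context jump_process
begin

text \<open>All that the iteration needs to know of the process: time and paths are replaced by one
  probability measure. The constant \<open>c0\<close> must not depend on the ratio of the radii,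
  because the factor between levels is chosen afterwards in terms of \<open>c0\<close>.\<close>

abbreviation exit_law :: "real \<Rightarrow> real \<Rightarrow> 'a \<Rightarrow> real \<Rightarrow> real \<Rightarrow> 'a measure \<Rightarrow> bool" where
  "exit_law c0 s0 z r R Q \<equiv> prob_space Q \<and> sets Q = sets borel \<and>
     (\<forall>A\<in>sets borel. A \<subseteq> {w. norm (w - z) \<in> {r<..<R}} \<longrightarrow>
        ennreal (\<omega> * (L r - L R) / 2) \<le> J_mass z A \<longrightarrow> c0 \<le> measure Q A) \<and>
     (\<forall>\<rho>. r \<le> \<rho> \<longrightarrow> \<rho> < s0 \<longrightarrow> measure Q {w. \<rho> \<le> norm (w - z)} \<le> L \<rho> / L r)"

lemma exit_distribution:
  obtains C s0 c0 where "1 \<le> C" "0 < s0" "s0 \<le> 1/8" "0 < c0" "c0 \<le> 1"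
    "\<And>R. 0 < R \<Longrightarrow> R < s0 \<Longrightarrow> L (R / 4) \<le> C * L R"
    "\<And>u D x z r R. harmonic_in P F X u D \<Longrightarrow> 0 < r \<Longrightarrow> r < R \<Longrightarrow> R < s0 \<Longrightarrow> cball z r \<subseteq> D \<Longrightarrow>
       norm (x - z) \<le> r / 8 \<Longrightarrow> 2 * L R \<le> L r \<Longrightarrow>
       \<exists>Q. exit_law c0 s0 z r R Q \<and> u x = (\<integral>w. u w \<partial>Q)"
proof -
  obtain C s0 where C: "1 \<le> C" "0 < s0" "s0 \<le> 1/8"
    "\<And>s c. 0 < s \<Longrightarrow> s < 4 * s0 \<Longrightarrow> 1/4 \<le> c \<Longrightarrow> c \<le> 4 \<Longrightarrow> lz (c * s) \<le> C * lz s"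
    "\<And>R. 0 < R \<Longrightarrow> R < s0 \<Longrightarrow> L (R / 4) \<le> C * L R"
    "\<And>y R. 0 < R \<Longrightarrow> R < s0 \<Longrightarrow>
       trunc_mass R y \<le> ennreal (C * L R)"
    by (rule kernel_scale_bounds) (rule that; assumption)
  define q where "q = 1 / (\<kappa> * C * 2 ^ DIM('a))"
  have q0: "0 < q" using kappa(1) C by (simp add: q_def)
  \<comment> \<open>The product of three lower bounds: \<open>t / 2\<close> for the expected
    stopping time, \<open>q\<close> for the kernel comparison, and \<open>\<omega> * L r / 4\<close>
    for half of the annulus; 192 is 24 times 2 times 4.\<close>
  define c1 where "c1 = q * \<omega> / (192 * C ^ 3)"
  have c1: "0 < c1" using q0 \<omega>_pos C(1) by (simp add: c1_def)
  show ?thesis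
  proof (rule that[of C s0 "min 1 c1"])
    fix u D r R and x z :: 'a
    assume u: "harmonic_in P F X u D" and r: "0 < r" "r < R" "R < s0" and zD: "cball z r \<subseteq> D"
      and x: "norm (x - z) \<le> r / 8" and LR: "2 * L R \<le> L r"
    interpret prob_space "P x" by (rule prob_P)
    have Lr: "0 < L r" using r C(3) by (intro L_pos) auto
    \<comment> \<open>One power of \<open>C\<close> comes from the bound on the truncated mass, two
      from \<open>L (\<rho> / 2) \<le> L (r / 16) \<le> C\<^sup>2 * L r\<close>; the 24 is the one
      in \<open>expected_stop_ge\<close>.\<close>
    define t where "t = 1 / (24 * C ^ 3 * L r)"
    have t: "0 < t" using Lr C(1) by (simp add: t_def)
    \<comment> \<open>Above \<open>r / 4\<close>, the radius exceeds twice the distance of the start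
      from the centre; below \<open>r / 2\<close>, the annulus beyond \<open>r\<close> is far enough
      for the kernel comparison.\<close>
    obtain \<rho> where \<rho>: "r / 4 < \<rho>" "\<rho> < r / 2" and ux: "u x = (\<integral>\<omega>. u (X (stop (cball z \<rho>) t \<omega>) \<omega>) \<partial>P x)"
    proof (rule harmonic_mean_value[OF u t, of "r/4" "r/2" z x])
      show "cball z (r / 2) \<subseteq> D" using zD r by (auto intro!: subsetD[OF zD])
    qed (use r in auto)
    define S where "S = stop (cball z \<rho>) t"
    have XS [measurable]: "(\<lambda>\<omega>. X (S \<omega>) \<omega>) \<in> borel_measurable M"
      unfolding S_def by (rule stop_measurable[OF t closed_cball])
    then have XSP: "(\<lambda>\<omega>. X (S \<omega>) \<omega>) \<in> measurable (P x) borel"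
      by (simp add: measurable_cong_sets[OF sets_P refl])
    have L4: "L (r' / 4) \<le> C * L r'" if "0 < r'" "r' < s0" for r'
      using that by (rule C(5))
    have cL: "C * L (\<rho> / 2) \<le> C ^ 3 * L r"
    proof -
      have "L (\<rho> / 2) \<le> L ((r / 4) / 4)" using \<rho> r C(3) by (intro L_antimono) auto
      also have "\<dots> \<le> C * L (r / 4)" using r by (intro L4) auto
      also have "\<dots> \<le> C * (C * L r)" using r C(1) by (intro mult_left_mono L4) auto
      finally have "C * L (\<rho> / 2) \<le> C * (C * (C * L r))" using C(1) by (intro mult_left_mono) auto
      then show ?thesis by (simp add: power3_eq_cube mult_ac)
    qed
    have ES: "t / 2 \<le> (\<integral>\<omega>. S \<omega> \<partial>P x)"
      unfolding S_def
    proof (rule expected_stop_ge[OF t])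
      show "0 < \<rho>" "\<rho> < 1" using \<rho> r C(3) by auto
      show "norm (x - z) \<le> \<rho> / 2" using x \<rho> by simp
      show "0 \<le> C * L (\<rho> / 2)"
        using C(1) L_pos[of "\<rho>/2"] \<rho> r C(3) by auto
      show "trunc_mass (\<rho>/2) y \<le> ennreal (C * L (\<rho> / 2))" for y
        using \<rho> r C(2) by (intro C(6)) auto
      have "24 * (C * L (\<rho> / 2)) * t \<le> 24 * (C ^ 3 * L r) * t"
        using cL t by (intro mult_right_mono mult_left_mono) auto
      also have "\<dots> = 1" using Lr C(1) by (simp add: t_def)
      finally show "24 * (C * L (\<rho> / 2)) * t \<le> 1" .
    qed
    define Q where "Q = distr (P x) borel (\<lambda>\<omega>. X (S \<omega>) \<omega>)"
    have Q_eq: "measure Q B = measure (P x) {\<omega> \<in> space M. X (S \<omega>) \<omega> \<in> B}" if "B \<in> sets borel" for B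
      unfolding Q_def using that XSP
      by (subst measure_distr) (auto simp: vimage_def Int_def conj_commute)
    have pQ: "prob_space Q" unfolding Q_def by (rule prob_space_distr[OF XSP])
    have uQ: "u x = (\<integral>w. u w \<partial>Q)"
      unfolding Q_def using integral_distr[OF XSP harmonic_measurable[OF u]] ux by (simp add: S_def)
    have hit: "min 1 c1 \<le> measure Q A"
      if A: "A \<in> sets borel" "A \<subseteq> {w. norm (w - z) \<in> {r<..<R}}"
        "ennreal (\<omega> * (L r - L R) / 2) \<le> J_mass z A" for A
    proof -
      have v: "\<omega> * L r / 4 \<le> \<omega> * (L r - L R) / 2"
        using LR \<omega>_pos mult_left_mono[of "L r / 2" "L r - L R" \<omega>] by (simp add: field_simps)
      have v0: "0 \<le> \<omega> * L r / 4" using \<omega>_pos Lr by simp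
      have "c1 = (t / 2) * q * (\<omega> * L r / 4)"
        using Lr C(1) by (simp add: c1_def t_def)
      also have "\<dots> \<le> (\<integral>\<omega>. S \<omega> \<partial>P x) * q * (\<omega> * (L r - L R) / 2)"
        using ES q0 v v0 t by (intro mult_mono mult_right_mono) auto
      also have "\<dots> \<le> measure (P x) {\<omega> \<in> space M. X (S \<omega>) \<omega> \<in> A}"
        unfolding S_def q_def
        using A r \<rho> x v v0 by (intro hitting_lower_bound[OF C(1,4,3) t, of r R]) auto
      finally show ?thesis using Q_eq[OF A(1)] by simp
    qed
    have tail: "measure Q {w. \<rho>' \<le> norm (w - z)} \<le> L \<rho>' / L r" if \<rho>': "r \<le> \<rho>'" "\<rho>' < s0" for \<rho>'
    proof -
      have p: "0 < \<rho>'" "0 < L \<rho>'" using \<rho>' r C(3) by (auto intro!: L_pos)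
      have "measure Q {w. \<rho>' \<le> norm (w - z)} = measure (P x) {\<omega> \<in> space M. X (S \<omega>) \<omega> \<in> {w. \<rho>' \<le> norm (w - z)}}"
        by (rule Q_eq) measurable
      also have "\<dots> \<le> measure (P x) {\<omega> \<in> space M. \<rho>' / 2 \<le> norm (X (S \<omega>) \<omega> - x)}"
      proof (rule finite_measure_mono)
        show "{\<omega> \<in> space M. X (S \<omega>) \<omega> \<in> {w. \<rho>' \<le> norm (w - z)}} \<subseteq> {\<omega> \<in> space M. \<rho>' / 2 \<le> norm (X (S \<omega>) \<omega> - x)}"
        proof safe
          fix \<omega> assume "\<rho>' \<le> norm (X (S \<omega>) \<omega> - z)"
          also have "\<dots> \<le> norm (X (S \<omega>) \<omega> - x) + norm (x - z)"
            using norm_triangle_ineq[of "X (S \<omega>) \<omega> - x" "x - z"] by simp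
          finally show "\<rho>' / 2 \<le> norm (X (S \<omega>) \<omega> - x)" using x \<rho>' r by simp
        qed
      qed measurable
      also have "\<dots> \<le> 12 * (C * L (\<rho>' / 2)) * t"
        unfolding S_def
      proof (rule exit_tail[OF t closed_cball])
        show "0 < \<rho>' / 2" "\<rho>' / 2 < 1" using p \<rho>' C(3) by auto
        show "0 \<le> C * L (\<rho>' / 2)" using C(1,3) L_pos[of "\<rho>' / 2"] p \<rho>' by auto
        show "trunc_mass (\<rho>'/2) y \<le> ennreal (C * L (\<rho>' / 2))" for y
          using \<rho>' p C(2) by (intro C(6)) auto
      qed
      also have "\<dots> \<le> 12 * (C * (C * L \<rho>')) * t"
      proof -
        have "L (\<rho>' / 2) \<le> L (\<rho>' / 4)" using p \<rho>' C(3) by (intro L_antimono) auto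
        also have "\<dots> \<le> C * L \<rho>'" using p \<rho>' by (intro L4)
        finally show ?thesis using C(1) t by (intro mult_right_mono mult_left_mono) auto
      qed
      also have "\<dots> = L \<rho>' / L r * (1 / (2 * C))"
        using C(1) Lr by (simp add: t_def power3_eq_cube)
      also have "\<dots> \<le> L \<rho>' / L r * 1"
        using C(1) Lr p by (intro mult_left_mono) auto
      finally show ?thesis by simp
    qed
    show "\<exists>Q. exit_law (min 1 c1) s0 z r R Q \<and> u x = (\<integral>w. u w \<partial>Q)"
      using pQ uQ hit tail by (intro exI[of _ Q]) (simp add: Q_def)
  qed (use C c1 in auto)
qed

end

section \<open>Decay of oscillation\<close>

lemma sum_power_diff_le:
  fixes \<delta> :: real
  assumes "0 < \<delta>" "\<delta> \<le> 1/2"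
  shows "(\<Sum>j<n. \<delta> ^ (n - j)) \<le> 2 * \<delta>"
proof -
  have "(\<Sum>j<n. \<delta> ^ (n - j)) = (\<Sum>j<n. \<delta> * \<delta> ^ (n - Suc j))"
  proof (intro sum.cong refl)
    fix j assume "j \<in> {..<n}"
    then have "n - j = Suc (n - Suc j)" by auto
    then show "\<delta> ^ (n - j) = \<delta> * \<delta> ^ (n - Suc j)" by simp
  qed
  also have "\<dots> = \<delta> * (\<Sum>j<n. \<delta> ^ j)"
    by (simp add: sum_distrib_left[symmetric] sum.nat_diff_reindex)
  also have "\<dots> \<le> \<delta> * (1 / (1 - \<delta>))"
    using geometric_sum_less[of \<delta> "{..<n}"] assms by (intro mult_left_mono) auto
  also have "\<dots> \<le> \<delta> * 2"
    using assms by (intro mult_left_mono) (auto simp: field_simps)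
  finally show ?thesis by simp
qed

text \<open>The mean of \<open>v - m\<close> is at most the previous oscillation \<open>En\<close>,
  reduced by half on \<open>A\<close>, plus the cost of larger displacements. Going beyond
  \<open>r j\<close> raises the oscillation by powers of \<open>1 / \<beta>\<close> but has a
  probability decaying like powers of \<open>1 / a\<close>, so the costs form a geometric series
  with ratio \<open>1 / (a * \<beta>)\<close>. Its sum \<open>c0 / 4\<close> is half of the gain
  \<open>c0 / 2\<close>.\<close>

lemma mean_value_decay:
  fixes v :: "'a::euclidean_space \<Rightarrow> real" and \<beta> a c0 B :: real
  assumes Q: "prob_space Q" "sets Q = sets borel"
    and v [measurable]: "v \<in> borel_measurable borel" and vB: "\<And>w. \<bar>v w\<bar> \<le> B"
    and n: "1 \<le> n" and \<beta>: "0 < \<beta>" "\<beta> \<le> 1" and a: "0 < a" "1 / (a * \<beta>) \<le> 1/2" "1 / (a * \<beta>) \<le> c0 / 8"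
    and \<beta>c: "\<beta>\<^sup>2 = 1 - c0 / 4"
    and r: "\<And>j k. j \<le> k \<Longrightarrow> k < n \<Longrightarrow> r k \<le> r j" and r0: "\<And>k. k < n \<Longrightarrow> 0 \<le> r k"
    and tail: "\<And>k. k < n \<Longrightarrow> measure Q {w. r k \<le> norm (w - z)} \<le> (1 / a) ^ (n - k)"
    and osc: "\<And>k w w'. k < n \<Longrightarrow> w \<in> cball z (r k) \<Longrightarrow> w' \<in> cball z (r k) \<Longrightarrow> v w - v w' \<le> E * \<beta> ^ k"
    and E: "2 * B \<le> E"
    and m: "m = (INF w\<in>cball z (r (n - 1)). v w)"
    and A: "A \<in> sets borel" "c0 \<le> measure Q A"
      "\<And>w. w \<in> A \<Longrightarrow> v w \<le> m + E * \<beta> ^ (n - 1) / 2"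
  shows "(\<integral>w. v w \<partial>Q) \<le> m + E * \<beta> ^ (n + 1)"
proof -
  interpret prob_space Q by fact
  have B0: "0 \<le> B" using vB[of z] by simp
  have E0: "0 \<le> E" using E B0 by simp
  have ne: "cball z (r (n - 1)) \<noteq> {}" using r0[of "n - 1"] n by simp
  have m_ge: "v w - m \<le> D" if D: "\<And>w'. w' \<in> cball z (r (n - 1)) \<Longrightarrow> v w - v w' \<le> D" for w D
  proof -
    have "v w - D \<le> m" unfolding m using D ne by (intro cINF_greatest) (auto simp: algebra_simps)
    then show ?thesis by simp
  qed
  define En where "En = E * \<beta> ^ (n - 1)"
  have En0: "0 \<le> En" using E0 \<beta> by (simp add: En_def)
  define \<delta> where "\<delta> = 1 / (a * \<beta>)"
  have \<delta>: "0 < \<delta>" "\<delta> \<le> 1/2" "\<delta> \<le> c0 / 8" using a \<beta> by (auto simp: \<delta>_def)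
  define O' where "O' j = {w. r j \<le> norm (w - z)}" for j
  have [measurable]: "O' j \<in> sets borel" for j unfolding O'_def by measurable
  note [measurable] = A(1)
  \<comment> \<open>For \<open>j = 0\<close> truncated subtraction gives the exponent 0, which
    matches the trivial bound \<open>2 * B \<le> E\<close> outside the largest ball. For other
    \<open>j\<close>, a point between \<open>r j\<close> and \<open>r (j - 1)\<close> shares the
    ball of radius \<open>r (j - 1)\<close> with the whole inner ball.\<close>
  define G where "G w = En * (1 - indicator A w / 2) + (\<Sum>j<n. E * \<beta> ^ (j - 1) * indicator (O' j) w)" for w
  have nn: "0 \<le> (\<Sum>j<n. E * \<beta> ^ (j - 1) * indicator (O' j) w)" for w
    using E0 \<beta> by (intro sum_nonneg) auto
  have pw: "v w - m \<le> G w" for w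
  proof (cases "w \<in> cball z (r (n - 1))")
    case True
    have "v w - m \<le> En * (1 - indicator A w / 2)"
    proof (cases "w \<in> A")
      case True
      then show ?thesis using A(3)[OF True] by (simp add: En_def)
    next
      case False
      have "v w - m \<le> En"
        unfolding En_def using True n by (intro m_ge osc) auto
      then show ?thesis using False by simp
    qed
    then show ?thesis using nn[of w] by (simp add: G_def)
  next
    case False
    then have out: "r (n - 1) \<le> norm (w - z)" by (simp add: dist_norm norm_minus_commute)
    define j where "j = (LEAST j. r j \<le> norm (w - z))"
    have j: "r j \<le> norm (w - z)" "j \<le> n - 1"
      unfolding j_def using out by (rule LeastI, rule Least_le)
    have jn: "j < n" using j(2) n by simp
    have "v w - m \<le> E * \<beta> ^ (j - 1)"
    proof (cases "j = 0")
      case True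
      have "v w - m \<le> 2 * B"
      proof (rule m_ge)
        show "v w - v w' \<le> 2 * B" for w' using vB[of w] vB[of w'] by simp
      qed
      then show ?thesis using True E by simp
    next
      case False
      then have "\<not> r (j - 1) \<le> norm (w - z)"
        using not_less_Least[of "j - 1" "\<lambda>j. r j \<le> norm (w - z)"] by (simp add: j_def[symmetric])
      then have w: "w \<in> cball z (r (j - 1))" by (simp add: dist_norm norm_minus_commute)
      show ?thesis
      proof (rule m_ge)
        fix w' assume "w' \<in> cball z (r (n - 1))"
        moreover have "r (n - 1) \<le> r (j - 1)" using jn n by (intro r) auto
        ultimately have "w' \<in> cball z (r (j - 1))" by auto
        then show "v w - v w' \<le> E * \<beta> ^ (j - 1)" using w jn by (intro osc) auto
      qed
    qed
    also have "\<dots> = E * \<beta> ^ (j - 1) * indicator (O' j) w" using j by (simp add: O'_def)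
    also have "\<dots> \<le> (\<Sum>j<n. E * \<beta> ^ (j - 1) * indicator (O' j) w)"
      using jn E0 \<beta> by (intro member_le_sum) auto
    also have "\<dots> \<le> G w" using En0 unfolding G_def by (simp add: indicator_def)
    finally show ?thesis .
  qed
  have Gint1: "integrable Q (\<lambda>w. En * (1 - indicator A w / 2))"
    using Q(2) A(1) by (intro integrable_mult_right Bochner_Integration.integrable_diff integrable_divide integrable_real_indicator)
      (auto simp: less_top[symmetric])
  have Gint2: "integrable Q (\<lambda>w. E * \<beta> ^ (j - 1) * indicator (O' j) w)" for j
    using Q(2) by (intro integrable_mult_right integrable_real_indicator) (auto simp: less_top[symmetric])
  have vQ: "v \<in> borel_measurable Q" using v by (simp add: measurable_cong_sets[OF Q(2) refl])
  have vint: "integrable Q v"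
    using vB by (intro integrable_const_bound[where B=B] vQ) auto
  have "(\<integral>w. v w \<partial>Q) - m = (\<integral>w. v w - m \<partial>Q)"
    using vint prob_space by simp
  also have "\<dots> \<le> (\<integral>w. G w \<partial>Q)"
    unfolding G_def[abs_def]
    by (intro integral_mono Bochner_Integration.integrable_diff vint Bochner_Integration.integrable_add Gint1
        Bochner_Integration.integrable_sum Gint2) (use pw in \<open>auto simp: G_def\<close>)
  also have "\<dots> = (\<integral>w. En * (1 - indicator A w / 2) \<partial>Q) + (\<Sum>j<n. \<integral>w. E * \<beta> ^ (j - 1) * indicator (O' j) w \<partial>Q)"
    unfolding G_def[abs_def]
    by (subst Bochner_Integration.integral_add[OF Gint1 Bochner_Integration.integrable_sum[OF Gint2]],
        subst Bochner_Integration.integral_sum[OF Gint2]) (rule refl)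
  also have "(\<integral>w. En * (1 - indicator A w / 2) \<partial>Q) = En * (1 - measure Q A / 2)"
    using Q(2) A(1) prob_space by (simp add: Bochner_Integration.integral_diff less_top[symmetric])
  also have "\<dots> \<le> En * (1 - c0 / 2)"
    using A(2) En0 by (intro mult_left_mono) auto
  also have "(\<Sum>j<n. \<integral>w. E * \<beta> ^ (j - 1) * indicator (O' j) w \<partial>Q) \<le> (\<Sum>j<n. En * \<delta> ^ (n - j))"
  proof (rule sum_mono)
    fix j assume "j \<in> {..<n}"
    then have jn: "j < n" by simp
    have "(\<integral>w. E * \<beta> ^ (j - 1) * indicator (O' j) w \<partial>Q) = E * \<beta> ^ (j - 1) * measure Q (O' j)"
      using Q(2) by (simp add: sets_eq_imp_space_eq[OF Q(2)])
    also have "\<dots> \<le> E * \<beta> ^ (j - 1) * (1 / a) ^ (n - j)"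
      using tail[OF jn] E0 \<beta> by (intro mult_left_mono) (auto simp: O'_def)
    also have "\<dots> \<le> (En * (1 / \<beta>) ^ (n - j)) * (1 / a) ^ (n - j)"
    proof (rule mult_right_mono)
      \<comment> \<open>An equality unless \<open>j = 0\<close>, where the truncated exponent leaves
        a spare factor \<open>1 / \<beta>\<close>.\<close>
      have "\<beta> ^ (j - 1) \<le> \<beta> ^ (n - 1) * (1 / \<beta>) ^ (n - j)"
      proof (cases j)
        case 0
        have "\<beta> ^ (n - 1) * (1 / \<beta>) ^ n = 1 / \<beta>"
          using \<beta> n by (cases n) (simp_all add: power_one_over field_simps)
        then show ?thesis using 0 \<beta> by simp
      next
        case (Suc i)
        have "\<beta> ^ (n - 1) = \<beta> ^ i * \<beta> ^ (n - j)"
          using Suc jn by (simp flip: power_add)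
        then show ?thesis using Suc \<beta> by (simp add: power_one_over)
      qed
      then show "E * \<beta> ^ (j - 1) \<le> En * (1 / \<beta>) ^ (n - j)"
        unfolding En_def mult.assoc using E0 by (intro mult_left_mono)
    qed (use a in simp)
    also have "\<dots> = En * \<delta> ^ (n - j)"
      by (simp add: \<delta>_def power_mult_distrib[symmetric] mult.commute)
    finally show "(\<integral>w. E * \<beta> ^ (j - 1) * indicator (O' j) w \<partial>Q) \<le> En * \<delta> ^ (n - j)" .
  qed
  also have "(\<Sum>j<n. En * \<delta> ^ (n - j)) \<le> En * (2 * \<delta>)"
    unfolding sum_distrib_left[symmetric] using sum_power_diff_le[OF \<delta>(1,2)] En0 by (intro mult_left_mono)
  also have "En * (2 * \<delta>) \<le> En * (c0 / 4)"
    using \<delta>(3) En0 by (intro mult_left_mono) auto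
  finally have "(\<integral>w. v w \<partial>Q) - m \<le> En * (1 - c0 / 2) + En * (c0 / 4)" by simp
  also have "\<dots> = En * \<beta>\<^sup>2" unfolding \<beta>c by (simp add: algebra_simps)
  also have "\<dots> = E * \<beta> ^ (n + 1)"
  proof -
    have "\<beta> ^ (n - 1) * \<beta>\<^sup>2 = \<beta> ^ (n + 1)" using n by (simp flip: power_add)
    then show ?thesis by (simp add: En_def)
  qed
  finally show ?thesis by simp
qed

context jump_process
begin

text \<open>The radius \<open>s\<close> enters only through \<open>a ^ n * L r0 \<le> L s\<close>,
  so the induction hypothesis applies at every radius that reaches the level, and nothing is claimed
  about levels that a bounded \<open>L\<close> never reaches.\<close>

lemma oscillation_decay:
  obtains C s0 a \<beta> where "1 \<le> C" "0 < s0" "s0 \<le> 1/8" "16 \<le> a" "1/2 \<le> \<beta>" "\<beta> < 1"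
    "\<And>R. 0 < R \<Longrightarrow> R < s0 \<Longrightarrow> L (R / 4) \<le> C * L R"
    "\<And>u D z r0 n s B w w'. harmonic_in P F X u D \<Longrightarrow> 0 < r0 \<Longrightarrow> r0 < s0 \<Longrightarrow> cball z r0 \<subseteq> D \<Longrightarrow>
       \<forall>y. \<bar>u y\<bar> \<le> B \<Longrightarrow> 0 < s \<Longrightarrow> s \<le> r0 \<Longrightarrow> a ^ n * L r0 \<le> L s \<Longrightarrow>
       w \<in> cball z s \<Longrightarrow> w' \<in> cball z s \<Longrightarrow> u w - u w' \<le> 2 * B / \<beta> * \<beta> ^ n"
proof -
  obtain C s0 c0 where C: "1 \<le> C" "0 < s0" "s0 \<le> 1/8" "0 < c0" "c0 \<le> 1"
    "\<And>R. 0 < R \<Longrightarrow> R < s0 \<Longrightarrow> L (R / 4) \<le> C * L R"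
    "\<And>u D x z r R. harmonic_in P F X u D \<Longrightarrow> 0 < r \<Longrightarrow> r < R \<Longrightarrow> R < s0 \<Longrightarrow> cball z r \<subseteq> D \<Longrightarrow>
       norm (x - z) \<le> r / 8 \<Longrightarrow> 2 * L R \<le> L r \<Longrightarrow>
       \<exists>Q. exit_law c0 s0 z r R Q \<and> u x = (\<integral>w. u w \<partial>Q)"
    by (rule exit_distribution) (rule that; assumption)
  \<comment> \<open>The first entry makes \<open>1 / (a * \<beta>)\<close> at most
    \<open>c0 / 8\<close>, as \<open>\<beta> \<ge> 1/2\<close>. Exceeding \<open>C\<^sup>2\<close>
    forces a radius one level further down to be at most an eighth of the previous one, as
    \<open>exit_distribution\<close> requires of the starting point.\<close>
  define a where "a = max (16 / c0) (C\<^sup>2 + 1)"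
  have a_c0: "16 / c0 \<le> a" and aC: "C\<^sup>2 < a" by (auto simp: a_def)
  have "16 \<le> 16 / c0" using C(4,5) by (simp add: field_simps)
  then have a16: "16 \<le> a" using a_c0 by simp
  \<comment> \<open>One contraction by \<open>1 - c0 / 4\<close> takes the exponent from
    \<open>N - 1\<close> to \<open>N + 1\<close>, because the annulus between \<open>r N\<close> and
    \<open>r (N - 1)\<close> uses up a level; hence the square root.\<close>
  define \<beta> where "\<beta> = sqrt (1 - c0 / 4)"
  have \<beta>c: "\<beta>\<^sup>2 = 1 - c0 / 4" using C(5) by (simp add: \<beta>_def)
  have \<beta>: "1/2 \<le> \<beta>" "\<beta> < 1"
  proof -
    have "(1/2)\<^sup>2 \<le> 1 - c0 / 4" using C(5) by (simp add: power2_eq_square)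
    then show "1/2 \<le> \<beta>" unfolding \<beta>_def by (rule real_le_rsqrt)
    show "\<beta> < 1" unfolding \<beta>_def using C(4) by simp
  qed
  have a\<beta>: "1 / (a * \<beta>) \<le> c0 / 8" "1 / (a * \<beta>) \<le> 1/2"
  proof -
    have "1 / (a * \<beta>) \<le> 1 / (16 / c0 * (1/2))"
      using a_c0 \<beta> C(4) a16 by (intro divide_left_mono mult_mono mult_pos_pos) auto
    then show "1 / (a * \<beta>) \<le> c0 / 8" by simp
    then show "1 / (a * \<beta>) \<le> 1/2" using C(5) by simp
  qed
  show ?thesis
  proof (rule that[of C s0 a \<beta>])
    fix u D r0 and z :: 'a and B :: real
    assume u: "harmonic_in P F X u D" and r0: "0 < r0" "r0 < s0" and zD: "cball z r0 \<subseteq> D"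
      and "\<forall>y. \<bar>u y\<bar> \<le> B"
    then have uB: "\<bar>u y\<bar> \<le> B" for y by blast
    have [measurable]: "u \<in> borel_measurable borel" by (rule harmonic_measurable[OF u])
    have B0: "0 \<le> B" using uB[of z] by simp
    \<comment> \<open>Dividing by \<open>\<beta>\<close> makes level 1 as trivial as level 0, so
      that two radii \<open>r N\<close> and \<open>r (N - 1)\<close> are available in the remaining
      case.\<close>
    define E where "E = 2 * B / \<beta>"
    have E: "2 * B \<le> E" unfolding E_def using \<beta> B0 by (simp add: field_simps mult_left_le)
    have E0: "0 \<le> E" using E B0 by simp
    have Lr0: "0 < L r0" using r0 C(3) by (intro L_pos) auto
    have "u w - u w' \<le> E * \<beta> ^ n"
      if "0 < s" "s \<le> r0" "a ^ n * L r0 \<le> L s" "w \<in> cball z s" "w' \<in> cball z s" for n s w w'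
      using that
    proof (induction n arbitrary: s w w' rule: less_induct)
      case (less n)
      consider "n = 0" | "n = 1" | "2 \<le> n" by linarith
      then show ?case
      proof cases
        case 1
        then show ?thesis using uB[of w] uB[of w'] E by simp
      next
        case 2
        then show ?thesis using uB[of w] uB[of w'] \<beta> by (simp add: E_def)
      next
        case n2: 3
        define N where "N = n - 1"
        have 3: "n = N + 1" "1 \<le> N" using n2 by (auto simp: N_def)
        have ex_q: "\<exists>q. s \<le> q \<and> q \<le> r0 \<and> L q = a ^ k * L r0" if k: "k \<le> N" for k
        proof (rule L_IVT)
          show "L r0 \<le> a ^ k * L r0" using a16 Lr0 by simp
          have "a ^ k * L r0 \<le> a ^ n * L r0"
            using k 3 a16 Lr0 by (intro mult_right_mono power_increasing) auto
          then show "a ^ k * L r0 \<le> L s" using less.prems(3) by simp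
        qed (use less.prems r0 C(3) in auto)
        \<comment> \<open>The radii are chosen afresh for each \<open>s\<close>, between
          \<open>s\<close> and \<open>r0\<close>; the hypothesis on \<open>L s\<close> guarantees
          that all levels up to \<open>N\<close> are attained there.\<close>
        define r where "r k = (SOME q. s \<le> q \<and> q \<le> r0 \<and> L q = a ^ k * L r0)" for k
        have r: "s \<le> r k" "r k \<le> r0" "L (r k) = a ^ k * L r0" if "k \<le> N" for k
          using someI_ex[OF ex_q[OF that]] unfolding r_def by auto
        have r_pos: "0 < r k" "r k < s0" "r k < 1" if "k \<le> N" for k
          using r(1,2)[OF that] less.prems(1) r0 C(3) by linarith+
        have r_less: "r k < r j" if jk: "j < k" "k \<le> N" for j k
        proof (rule ccontr)
          assume "\<not> r k < r j"
          then have "L (r k) \<le> L (r j)" using r_pos jk by (intro L_antimono) auto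
          then have "a ^ k \<le> a ^ j" using r(3) jk Lr0 by simp
          moreover have "a ^ j < a ^ k" using jk(1) a16 by (intro power_strict_increasing) auto
          ultimately show False by simp
        qed
        have LN: "0 < L (r N)" using r_pos[of N] by (intro L_pos) auto
        have s_le: "s \<le> r N / 8"
        proof (rule ccontr)
          assume "\<not> s \<le> r N / 8"
          then have "L s \<le> L ((r N / 4) / 4)"
            using r_pos[of N] less.prems r0 C(3) by (intro L_antimono) auto
          also have "\<dots> \<le> C * L (r N / 4)" using r_pos[of N] by (intro C(6)) auto
          also have "\<dots> \<le> C * (C * L (r N))" using r_pos[of N] C(1) by (intro mult_left_mono C(6)) auto
          also have "\<dots> < a * L (r N)"
            using aC LN by (simp add: power2_eq_square mult.assoc[symmetric])
          also have "\<dots> = a ^ n * L r0" using r(3)[of N] 3 by simp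
          finally show False using less.prems(3) by simp
        qed
        define m where "m = (INF w\<in>cball z (r (N - 1)). u w)"
        define m' where "m' = (INF w\<in>cball z (r (N - 1)). - u w)"
        define Ann where "Ann = {w. norm (w - z) \<in> {r N<..<r (N - 1)}}"
        define mid where "mid = m + E * \<beta> ^ (N - 1) / 2"
        have bdd: "bdd_below (u ` cball z (r (N - 1)))" "bdd_below ((\<lambda>w. - u w) ` cball z (r (N - 1)))"
          using uB by (auto intro!: bdd_belowI2[of _ "- B"] simp: abs_le_iff) (metis minus_le_iff)
        have osc: "u y - u y' \<le> E * \<beta> ^ k" if "k < N" "y \<in> cball z (r k)" "y' \<in> cball z (r k)" for k y y'
          using that 3 r[of k] r_pos[of k] by (intro less.IH[of k "r k"]) auto
        have osc': "(- u y) - (- u y') \<le> E * \<beta> ^ k" if "k < N" "y \<in> cball z (r k)" "y' \<in> cball z (r k)" for k y y'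
          using osc[OF that(1,3,2)] by simp
        have in_ball: "y \<in> cball z (r (N - 1))" if "y \<in> cball z s" for y
          using that r(1)[of "N - 1"] by auto
        have r_mono: "r k \<le> r j" if "j \<le> k" "k < N" for j k
          using r_less[of j k] that by (cases "j = k") auto
        have ne: "cball z (r (N - 1)) \<noteq> {}" using r_pos[of "N - 1"] by simp
        have m'_ge: "- m - E * \<beta> ^ (N - 1) \<le> m'"
          unfolding m'_def
        proof (rule cINF_greatest[OF ne])
          fix y assume y: "y \<in> cball z (r (N - 1))"
          have "u y - E * \<beta> ^ (N - 1) \<le> m"
            unfolding m_def
          proof (rule cINF_greatest[OF ne])
            fix y' assume "y' \<in> cball z (r (N - 1))"
            then show "u y - E * \<beta> ^ (N - 1) \<le> u y'"
              using osc[of "N - 1" y y'] y 3 by simp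
          qed
          then show "- m - E * \<beta> ^ (N - 1) \<le> - u y" by simp
        qed
        have Ann_sets [measurable]: "Ann \<in> sets borel" unfolding Ann_def by measurable
        define A1 where "A1 = {w \<in> Ann. u w \<le> mid}"
        define A2 where "A2 = {w \<in> Ann. mid < u w}"
        have A_sets [measurable]: "A1 \<in> sets borel" "A2 \<in> sets borel"
        proof -
          have "A1 = Ann \<inter> {w \<in> space borel. u w \<le> mid}" "A2 = Ann \<inter> {w \<in> space borel. mid < u w}"
            by (auto simp: A1_def A2_def)
          then show "A1 \<in> sets borel" "A2 \<in> sets borel" by simp_all
        qed
        have A_sub: "A1 \<subseteq> {w. norm (w - z) \<in> {r N<..<r (N - 1)}}" "A2 \<subseteq> {w. norm (w - z) \<in> {r N<..<r (N - 1)}}"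
          by (auto simp: A1_def A2_def Ann_def)
        define V where "V = \<omega> * (L (r N) - L (r (N - 1)))"
        have LR: "2 * L (r (N - 1)) \<le> L (r N)"
        proof -
          have "L (r N) = a * L (r (N - 1))"
            using r(3)[of N] r(3)[of "N - 1"] 3 by (cases N) auto
          moreover have "2 * L (r (N - 1)) \<le> a * L (r (N - 1))"
            using a16 L_pos[of "r (N - 1)"] r_pos[of "N - 1"] by (intro mult_right_mono) auto
          ultimately show ?thesis by simp
        qed
        have V0: "0 \<le> V"
          using LR \<omega>_pos L_pos[of "r (N - 1)"] r_pos[of "N - 1"] by (simp add: V_def)
        have "J_mass z A1 + J_mass z A2
          = (\<integral>\<^sup>+ w. ennreal (indicator A1 w * J (w - z)) + ennreal (indicator A2 w * J (w - z)) \<partial>lborel)"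
          by (rule nn_integral_add[symmetric]) measurable
        also have "\<dots> = (\<integral>\<^sup>+ w. ennreal (indicator {r N<..<r (N - 1)} (norm (w - z)) * J (w - z)) \<partial>lborel)"
          by (intro nn_integral_cong) (auto simp: A1_def A2_def Ann_def indicator_def)
        also have "\<dots> = ennreal V"
          unfolding V_def using r_less[of "N - 1" N] r_pos[of N] r_pos[of "N - 1"] 3
          by (intro nn_integral_J_annulus) auto
        finally have split: "J_mass z A1
            + J_mass z A2 = ennreal V" .
        \<comment> \<open>Whichever half is large, a one-sided estimate suffices: if
          \<open>u\<close> is low on it, the mean value bounds \<open>u w\<close> from above; if
          \<open>u\<close> is high on it, the same estimate for \<open>- u\<close> bounds
          \<open>u w'\<close> from below.\<close>
        have half: "ennreal (V / 2) \<le> J_mass z A1 \<or>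
            ennreal (V / 2) \<le> J_mass z A2"
        proof (rule ccontr)
          assume "\<not> ?thesis"
          then have "J_mass z A1
            + J_mass z A2 < ennreal (V / 2) + ennreal (V / 2)"
            by (intro add_strict_mono) (auto simp: not_le)
          also have "\<dots> = ennreal V" using V0 by (simp flip: ennreal_plus)
          finally show False using split by simp
        qed
        have Q: "\<exists>Q. exit_law c0 s0 z (r N) (r (N - 1)) Q \<and> u x = (\<integral>w. u w \<partial>Q)"
          if x: "x \<in> cball z s" for x
        proof (rule C(7)[OF u])
          show "cball z (r N) \<subseteq> D" using zD r(2)[of N] by (auto intro!: subsetD[OF zD])
          show "norm (x - z) \<le> r N / 8" using x s_le by (simp add: dist_norm norm_minus_commute)
          show "r N < r (N - 1)" using 3 by (intro r_less) auto
        qed (use r_pos[of N] r_pos[of "N - 1"] LR in auto)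
        have tail: "measure Q {w. r k \<le> norm (w - z)} \<le> (1 / a) ^ (N - k)"
          if Q: "\<forall>\<rho>. r N \<le> \<rho> \<longrightarrow> \<rho> < s0 \<longrightarrow> measure Q {w. \<rho> \<le> norm (w - z)} \<le> L \<rho> / L (r N)" and k: "k < N"
          for Q k
        proof -
          have "measure Q {w. r k \<le> norm (w - z)} \<le> L (r k) / L (r N)"
            using Q r_less[of k N] r_pos[of k] k by auto
          also have "\<dots> = a ^ k / a ^ N" using r(3) k Lr0 by simp
          also have "\<dots> = (1 / a) ^ (N - k)"
            using k a16 by (simp add: power_one_over power_diff field_simps)
          finally show ?thesis .
        qed
        have a0: "0 < a" "0 < \<beta>" "\<beta> \<le> 1" using a16 \<beta> by auto
        from half show ?thesis
        proof
          assume h: "ennreal (V / 2) \<le> J_mass z A1"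
          obtain Q where Q': "prob_space Q" "sets Q = sets borel" "u w = (\<integral>w. u w \<partial>Q)" "c0 \<le> measure Q A1"
            "\<forall>\<rho>. r N \<le> \<rho> \<longrightarrow> \<rho> < s0 \<longrightarrow> measure Q {w. \<rho> \<le> norm (w - z)} \<le> L \<rho> / L (r N)"
            using Q[OF less.prems(4)] A_sets(1) A_sub(1) h[unfolded V_def] by blast
          have "(\<integral>w. u w \<partial>Q) \<le> m + E * \<beta> ^ (N + 1)"
          proof (rule mean_value_decay[OF Q'(1,2) _ uB 3(2) a0(2,3) a0(1) a\<beta>(2,1) \<beta>c _ _ tail[OF Q'(5)] osc E m_def A_sets(1) Q'(4)])
            show "u y \<le> m + E * \<beta> ^ (N - 1) / 2" if "y \<in> A1" for y
              using that by (simp add: A1_def mid_def)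
          qed (use r_mono r_pos in \<open>auto intro: less_imp_le\<close>)
          moreover have "m \<le> u w'"
            unfolding m_def using less.prems(5) in_ball by (intro cINF_lower bdd) auto
          ultimately show ?thesis using Q'(3) 3(1) by simp
        next
          assume h: "ennreal (V / 2) \<le> J_mass z A2"
          obtain Q where Q': "prob_space Q" "sets Q = sets borel" "u w' = (\<integral>w. u w \<partial>Q)" "c0 \<le> measure Q A2"
            "\<forall>\<rho>. r N \<le> \<rho> \<longrightarrow> \<rho> < s0 \<longrightarrow> measure Q {w. \<rho> \<le> norm (w - z)} \<le> L \<rho> / L (r N)"
            using Q[OF less.prems(5)] A_sets(2) A_sub(2) h[unfolded V_def] by blast
          have "(\<integral>w. - u w \<partial>Q) \<le> m' + E * \<beta> ^ (N + 1)"
          proof (rule mean_value_decay[OF Q'(1,2) _ _ 3(2) a0(2,3) a0(1) a\<beta>(2,1) \<beta>c _ _ tail[OF Q'(5)] osc' E m'_def A_sets(2) Q'(4)])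
            show "- u y \<le> m' + E * \<beta> ^ (N - 1) / 2" if "y \<in> A2" for y
              using that m'_ge by (simp add: A2_def mid_def)
            show "\<bar>- u y\<bar> \<le> B" for y using uB[of y] by simp
          qed (use r_mono r_pos in \<open>auto intro: less_imp_le\<close>)
          moreover have "m' \<le> - u w"
            unfolding m'_def using less.prems(4) in_ball by (intro cINF_lower bdd) auto
          ultimately show ?thesis using Q'(3) 3(1) by simp
        qed
      qed
    qed
    then show "0 < s \<Longrightarrow> s \<le> r0 \<Longrightarrow> a ^ n * L r0 \<le> L s \<Longrightarrow> w \<in> cball z s \<Longrightarrow> w' \<in> cball z s \<Longrightarrow>
        u w - u w' \<le> 2 * B / \<beta> * \<beta> ^ n" for n s w w'
      unfolding E_def by blast
  qed (use C a16 \<beta> in auto)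
qed

section \<open>From discrete levels to a power of \<open>L\<close>\<close>

lemma harmonic_regularity:
  "\<exists>c>0. \<exists>\<gamma>. 0 < \<gamma> \<and> \<gamma> < 1 \<and>
    (\<forall>r x0 u. 0 < r \<and> r < 1/2 \<and> harmonic_in P F X u (ball x0 r) \<longrightarrow>
       (\<forall>x\<in>ball x0 (r/4). \<forall>y\<in>ball x0 (r/4). x \<noteq> y \<longrightarrow>
          \<bar>u x - u y\<bar> \<le> c * sup_norm u * (L (dist x y) powr (- \<gamma>) / L r powr (- \<gamma>))))"
proof -
  obtain C s0 a \<beta> where C: "1 \<le> C" "0 < s0" "s0 \<le> 1/8" "16 \<le> a" "1/2 \<le> \<beta>" "\<beta> < 1"
    "\<And>R. 0 < R \<Longrightarrow> R < s0 \<Longrightarrow> L (R / 4) \<le> C * L R"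
    and osc: "\<And>u D z r0 n s B w w'. harmonic_in P F X u D \<Longrightarrow> 0 < r0 \<Longrightarrow> r0 < s0 \<Longrightarrow> cball z r0 \<subseteq> D \<Longrightarrow>
       \<forall>y. \<bar>u y\<bar> \<le> B \<Longrightarrow> 0 < s \<Longrightarrow> s \<le> r0 \<Longrightarrow> a ^ n * L r0 \<le> L s \<Longrightarrow>
       w \<in> cball z s \<Longrightarrow> w' \<in> cball z s \<Longrightarrow> u w - u w' \<le> 2 * B / \<beta> * \<beta> ^ n"
    by (rule oscillation_decay) (rule that; assumption)
  \<comment> \<open>The exponent with \<open>a powr (- \<gamma>) = \<beta>\<close>; it is below 1
    because \<open>1 / \<beta> \<le> 2 < a\<close>.\<close>
  define \<gamma> where "\<gamma> = - ln \<beta> / ln a"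
  have \<beta>0: "0 < \<beta>" and a0: "0 < a" "0 < ln a" using C(4,5) by auto
  have \<gamma>: "0 < \<gamma>" "\<gamma> < 1"
  proof -
    have "ln \<beta> < 0" using C(6) \<beta>0 by simp
    then show "0 < \<gamma>" unfolding \<gamma>_def using a0(2) by (intro divide_pos_pos) auto
    have "1 / \<beta> \<le> 1 / (1/2)" using C(5) by (intro divide_left_mono) auto
    then have "1 / \<beta> < a" using C(4) by simp
    then have "ln (1 / \<beta>) < ln a" using \<beta>0 a0 by (subst ln_less_cancel_iff) auto
    then have "- ln \<beta> < ln a" using \<beta>0 by (simp add: ln_div)
    then show "\<gamma> < 1" unfolding \<gamma>_def using divide_less_eq_1_pos[OF a0(2)] by blast
  qed
  have a_\<gamma>: "a powr (- \<gamma>) = \<beta>"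
    using \<beta>0 a0 by (simp add: powr_def \<gamma>_def)
  have Lh: "0 < L (1/2)" "0 < L (s0 / 2)" using C(2,3) by (auto intro!: L_pos)
  \<comment> \<open>Compares \<open>L r0\<close> with \<open>L r\<close>: the doubling constant
    serves for \<open>r < s0\<close>, the quotient for larger \<open>r\<close>, where
    \<open>r0 = s0 / 2\<close> and \<open>L r \<ge> L (1/2)\<close>.\<close>
  define C' where "C' = C + L (s0 / 2) / L (1/2)"
  have C': "1 \<le> C'" using C(1) Lh by (simp add: C'_def add_increasing2)
  \<comment> \<open>One factor \<open>1 / \<beta>\<close> is already present in the oscillation
    bound, the other is lost in rounding the level down from \<open>N\<close> to its
    predecessor.\<close>
  define c where "c = 2 * C' / \<beta>\<^sup>2"
  have c: "0 < c" "2 * C' \<le> c"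
  proof -
    show "0 < c" using C' \<beta>0 by (simp add: c_def)
    have "\<beta>\<^sup>2 \<le> 1" using \<beta>0 C(6) by (simp add: power_le_one)
    then show "2 * C' \<le> c" using C' \<beta>0 by (simp add: c_def pos_le_divide_eq mult_left_le)
  qed
  have "\<forall>r x0 u. 0 < r \<and> r < 1/2 \<and> harmonic_in P F X u (ball x0 r) \<longrightarrow>
       (\<forall>x\<in>ball x0 (r/4). \<forall>y\<in>ball x0 (r/4). x \<noteq> y \<longrightarrow>
          \<bar>u x - u y\<bar> \<le> c * sup_norm u * (L (dist x y) powr (- \<gamma>) / L r powr (- \<gamma>)))"
  proof (intro allI impI ballI)
    fix r x0 u x y
    assume *: "0 < r \<and> r < 1/2 \<and> harmonic_in P F X u (ball x0 r)"
      and xy: "x \<in> ball x0 (r / 4)" "y \<in> ball x0 (r / 4)" "x \<noteq> y"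
    have r: "0 < r" "r < 1/2" and u: "harmonic_in P F X u (ball x0 r)" using * by auto
    define B where "B = sup_norm u"
    have "bounded (range u)" using u by (simp add: harmonic_in_def)
    then obtain b where "\<And>z. \<bar>u z\<bar> \<le> b" unfolding bounded_iff by auto
    then have uB: "\<bar>u z\<bar> \<le> B" for z
      unfolding B_def sup_norm_def by (intro cSUP_upper bdd_aboveI2) auto
    have B0: "0 \<le> B" using uB[of x] by simp
    define d where "d = dist x y"
    have d0: "0 < d" using xy(3) by (simp add: d_def)
    have "d \<le> dist x x0 + dist x0 y" unfolding d_def by (rule dist_triangle)
    then have d1: "d < r / 2" using xy(1,2) by (simp add: dist_commute)
    \<comment> \<open>The oscillation is taken in balls about \<open>x\<close> rather than
      \<open>x0\<close>: \<open>r / 4 + r / 2 < r\<close> keeps them in the domain, and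
      \<open>s0 / 2\<close> keeps the radius in the range of the estimates.\<close>
    define r0 where "r0 = min (r / 2) (s0 / 2)"
    have r0: "0 < r0" "r0 < s0" "r0 \<le> r / 2" using r C(2) by (auto simp: r0_def)
    have Lpos: "0 < L d" "0 < L r" "0 < L r0" using d0 d1 r r0 C(3) by (auto intro!: L_pos)
    have Lr0: "L r0 \<le> C' * L r"
    proof (cases "r < s0")
      case True
      then have "L r0 \<le> L (r / 4)" using r C(2) by (intro L_antimono) (auto simp: r0_def)
      also have "\<dots> \<le> C * L r" using r True by (intro C(7))
      also have "\<dots> \<le> C' * L r" using Lpos Lh by (intro mult_right_mono) (auto simp: C'_def)
      finally show ?thesis .
    next
      case False
      then have r0_eq: "r0 = s0 / 2" by (simp add: r0_def)
      have "L (1/2) \<le> L r" using r by (intro L_antimono) auto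
      then have "L (s0 / 2) / L (1/2) * L (1/2) \<le> C' * L r"
        using Lh Lpos C(1) by (intro mult_mono) (auto simp: C'_def)
      then show ?thesis unfolding r0_eq using Lh by simp
    qed
    define \<Lambda> where "\<Lambda> = (L d / L r) powr (- \<gamma>)"
    have \<Lambda>_eq: "L d powr (- \<gamma>) / L r powr (- \<gamma>) = \<Lambda>"
      using Lpos by (simp add: \<Lambda>_def powr_divide)
    have C'_powr: "C' powr \<gamma> \<le> C'"
      using powr_mono[of \<gamma> 1 C'] \<gamma> C' by simp
    have "\<bar>u x - u y\<bar> \<le> c * B * \<Lambda>"
    proof (cases "d \<le> r0")
      \<comment> \<open>Here \<open>L d\<close> is at most \<open>C' * L r\<close>, so the
        right-hand side is bounded below and the trivial bound \<open>2 * B\<close>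
        suffices.\<close>
      case False
      have "L d \<le> L r0" using False r0 d1 r by (intro L_antimono) auto
      then have "L d / L r \<le> C'" using Lr0 Lpos by (simp add: divide_le_eq)
      then have "C' powr (- \<gamma>) \<le> \<Lambda>"
        unfolding \<Lambda>_def using \<gamma> Lpos by (intro powr_mono2') auto
      moreover have "1 / C' \<le> C' powr (- \<gamma>)"
        using C'_powr C' by (simp add: powr_minus_divide divide_left_mono)
      ultimately have "1 / C' \<le> \<Lambda>" by simp
      then have "1 \<le> C' * \<Lambda>" using C' by (simp add: field_simps)
      have "\<bar>u x - u y\<bar> \<le> 2 * B * 1" using uB[of x] uB[of y] by simp
      also have "\<dots> \<le> 2 * B * (C' * \<Lambda>)" using \<open>1 \<le> C' * \<Lambda>\<close> B0 by (intro mult_left_mono) auto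
      also have "\<dots> = 2 * C' * (B * \<Lambda>)" by simp
      also have "\<dots> \<le> c * (B * \<Lambda>)" using c(2) B0 by (intro mult_right_mono) (auto simp: \<Lambda>_def)
      finally show ?thesis by (simp add: mult.assoc)
    next
      case True
      have "L r0 \<le> L d" using True r0 d0 C(3) by (intro L_antimono) auto
      \<comment> \<open>The power before the least one exceeding the ratio is an admissible level
        for \<open>osc\<close>, while the least one itself dominates the ratio and so turns
        \<open>\<beta> ^ N\<close> into a power of \<open>L d / L r0\<close>.\<close>
      define P' where "P' n \<longleftrightarrow> L d / L r0 < a ^ n" for n
      obtain k where "L d / L r0 < a ^ k" using real_arch_pow[of a "L d / L r0"] C(4) by auto
      then have Pk: "P' k" by (simp add: P'_def)
      define N where "N = (LEAST n. P' n)"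
      have PN: "P' N" unfolding N_def using Pk by (rule LeastI)
      have "N \<noteq> 0"
        using PN \<open>L r0 \<le> L d\<close> Lpos by (intro notI) (simp add: P'_def)
      then obtain n where n: "N = Suc n" by (cases N) auto
      have "\<not> P' n" using not_less_Least[of n P'] n by (simp add: N_def[symmetric])
      then have an: "a ^ n * L r0 \<le> L d" using Lpos by (simp add: P'_def not_less field_simps)
      have sub: "cball x r0 \<subseteq> ball x0 r"
      proof
        fix w assume "w \<in> cball x r0"
        then have "dist x0 w < r / 4 + r / 2"
          using dist_triangle[of x0 w x] xy(1) r0(3) by simp
        then show "w \<in> ball x0 r" using r by simp
      qed
      have "u x - u y \<le> 2 * B / \<beta> * \<beta> ^ n" "u y - u x \<le> 2 * B / \<beta> * \<beta> ^ n"
        by (rule osc[OF u r0(1,2) sub _ d0 True an, of B]; use uB d_def in simp)+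
      then have "\<bar>u x - u y\<bar> \<le> 2 * B / \<beta> * \<beta> ^ n" by simp
      also have "\<dots> = 2 * B / \<beta>\<^sup>2 * \<beta> ^ N" using \<beta>0 n by (simp add: power2_eq_square)
      finally have le: "\<bar>u x - u y\<bar> \<le> 2 * B / \<beta>\<^sup>2 * \<beta> ^ N" .
      have "\<beta> ^ N = (a ^ N) powr (- \<gamma>)"
        using a0 by (simp add: a_\<gamma>[symmetric] powr_realpow[symmetric] powr_powr mult.commute)
      also have "\<dots> \<le> (L d / L r0) powr (- \<gamma>)"
        using PN Lpos \<gamma> by (intro powr_mono2') (auto simp: P'_def)
      also have "\<dots> = \<Lambda> * (L r0 / L r) powr \<gamma>"
      proof -
        have "L d / L r0 = (L d / L r) / (L r0 / L r)" using Lpos by simp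
        then have "(L d / L r0) powr (- \<gamma>) = \<Lambda> / (L r0 / L r) powr (- \<gamma>)"
          unfolding \<Lambda>_def using Lpos by (simp only: powr_divide)
        then show ?thesis by (simp add: powr_minus divide_inverse)
      qed
      also have "\<dots> \<le> \<Lambda> * C'"
      proof (rule mult_left_mono)
        have "(L r0 / L r) powr \<gamma> \<le> C' powr \<gamma>"
          using Lr0 Lpos \<gamma> by (intro powr_mono2) (auto simp: divide_le_eq)
        then show "(L r0 / L r) powr \<gamma> \<le> C'" using C'_powr by simp
      qed (simp add: \<Lambda>_def)
      finally have "2 * B / \<beta>\<^sup>2 * \<beta> ^ N \<le> 2 * B / \<beta>\<^sup>2 * (\<Lambda> * C')"
        using B0 by (intro mult_left_mono) auto
      with le have "\<bar>u x - u y\<bar> \<le> 2 * B / \<beta>\<^sup>2 * (\<Lambda> * C')" by (rule order_trans)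
      then show ?thesis by (simp add: c_def mult_ac)
    qed
    then show "\<bar>u x - u y\<bar> \<le> c * sup_norm u * (L (dist x y) powr (- \<gamma>) / L r powr (- \<gamma>))"
      unfolding d_def[symmetric] \<Lambda>_eq B_def .
  qed
  with c(1) \<gamma> show ?thesis by blast
qed

end

theorem theorem1p4:
  fixes K :: "'a::euclidean_space \<Rightarrow> 'a \<Rightarrow> real"
    and l :: "real \<Rightarrow> real"
    and \<alpha> K0 \<kappa> :: real
    and M :: "'w measure"
    and P :: "'a \<Rightarrow> 'w measure"
    and F :: "real \<Rightarrow> 'w measure"
    and X :: "real \<Rightarrow> 'w \<Rightarrow> 'a"
  assumes alpha: "0 \<le> \<alpha>" "\<alpha> < 2"
    and l_pos: "\<forall>r\<in>{0<..<1}. 0 < l r"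
    and l_meas: "l \<in> borel_measurable (restrict_space borel {0<..<1})"
    and l_locbdd: "\<forall>C. compact C \<and> C \<subseteq> {0<..<1} \<longrightarrow> bounded (l ` C)"
    and l_rv: "regularly_varying_at_zero l (- \<alpha>)"
    and K_meas: "(\<lambda>(x, h). K x h) \<in> borel_measurable (borel \<Otimes>\<^sub>M borel)"
    and K_nonneg: "\<forall>x h. h \<noteq> 0 \<longrightarrow> 0 \<le> K x h"
    and K0: "0 < K0"
      "\<forall>x. (\<integral>\<^sup>+ h. ennreal (indicator (UNIV - {0}) h * min 1 (norm h ^ 2) * K x h) \<partial>lborel)
             \<le> ennreal K0"
    and K_sym: "\<forall>x h. h \<noteq> 0 \<longrightarrow> K x h = K x (- h)"
    and kappa: "1 < \<kappa>"
      "\<forall>x h. 0 < norm h \<and> norm h \<le> 1 \<longrightarrow>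
          l (norm h) / norm h ^ DIM('a) / \<kappa> \<le> K x h \<and>
          K x h \<le> \<kappa> * l (norm h) / norm h ^ DIM('a)"
    and P_prob: "\<forall>x. prob_space (P x) \<and> sets (P x) = sets M"
    and P_kernel: "\<forall>A\<in>sets M. (\<lambda>x. emeasure (P x) A) \<in> borel_measurable borel"
    and F_filt: "filtration (space M) F" "\<forall>t. sets (F t) \<subseteq> sets M"
    and X_adapted: "\<forall>t\<ge>0. X t \<in> measurable (F t) borel"
    and X_cadlag: "cadlag_paths M X"
    and X_markov: "strong_markov M P F X"
    and X_start: "\<forall>x. AE \<omega> in P x. X 0 \<omega> = x"
    and X_mp: "\<forall>f\<in>C2b. \<forall>x. is_martingale (P x) F
         (\<lambda>t \<omega>. f (X t \<omega>) - f (X 0 \<omega>) - (LINT s:{0..t}|lborel. Lop K f (X s \<omega>)))"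
  shows "\<exists>c>0. \<exists>\<gamma>. 0 < \<gamma> \<and> \<gamma> < 1 \<and>
    (\<forall>r x0 u. 0 < r \<and> r < 1/2 \<and> harmonic_in P F X u (ball x0 r) \<longrightarrow>
       (\<forall>x\<in>ball x0 (r/4). \<forall>y\<in>ball x0 (r/4). x \<noteq> y \<longrightarrow>
          \<bar>u x - u y\<bar> \<le> c * sup_norm u * (Lfun l (dist x y) powr (- \<gamma>) / Lfun l r powr (- \<gamma>))))"
proof -
  interpret jump_process K l \<alpha> K0 \<kappa> M F X P
    by (intro jump_process.intro regular_kernel.intro cadlag_process.intro jump_process_axioms.intro) (fact assms)+
  show ?thesis by (rule harmonic_regularity)
qed

end
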